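(* Let $p,q\ge0$ be integers, not both $0$, let $U_{z,y}$ ($z,y\in\mathcal{J}_{p,q}$) be the canonical generators of $A_h(p,q)$ and let $P_{z,y}:=U_{z,y}^*U_{z,y}$, which are projections. The $C^*$-subalgebra of $A_h(p,q)$ generated by $\{P_{z,y}:z,y\in\mathcal{J}_{p,q}\}$ is isomorphic to $A_s(2p+q)$.
   Context: Index set: $\mathcal{J}_p=\{i\alpha:i\in\{0,1\},\alpha\in\{1,\dots,p\}\}$, $\mathcal{J}_{p,q}=\mathcal{J}_p\cup\{1,\dots,q\}$ (disjoint union). The bar involution is $\overline{i\alpha}=\bar i\alpha$ with $\bar0=1,\bar1=0$, and $\bar M=M$ for $M\in\{1,\dots,q\}$. $A_h(p,q)$ is the universal unital $C^*$-algebra generated by partial isometries $U_{z,y}$ ($z,y\in\mathcal{J}_{p,q}$) such that $U=(U_{z,y})$ is a unitary matrix and $U_{z,y}=U_{\bar z,\bar y}^*$ for all $z,y$. $A_s(n)$ is the universal $C^*$-algebra generated by the entries of an $n\times n$ magic unitary, i.e. a unitary matrix all of whose entries are projections. *)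

theory Defs
  imports Complex_Main "HOL-Algebra.QuotRing" "HOL-Library.Poly_Mapping"
begin

section \<open>Unital C*-algebras\<close>

record 'a cstar = "'a ring" +
  scale :: "complex \<Rightarrow> 'a \<Rightarrow> 'a"
  star :: "'a \<Rightarrow> 'a"
  nrm :: "'a \<Rightarrow> real"

locale cstar_algebra = ring A for A :: "('a, 'm) cstar_scheme" (structure) +
  assumes scale_closed: "x \<in> carrier A \<Longrightarrow> scale A c x \<in> carrier A"
    and scale_add_right: "\<lbrakk>x \<in> carrier A; y \<in> carrier A\<rbrakk> \<Longrightarrow> scale A c (x \<oplus> y) = scale A c x \<oplus> scale A c y"
    and scale_add_left: "x \<in> carrier A \<Longrightarrow> scale A (c + d) x = scale A c x \<oplus> scale A d x"
    and scale_scale: "x \<in> carrier A \<Longrightarrow> scale A c (scale A d x) = scale A (c * d) x"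
    and scale_one: "x \<in> carrier A \<Longrightarrow> scale A 1 x = x"
    and scale_mult_left: "\<lbrakk>x \<in> carrier A; y \<in> carrier A\<rbrakk> \<Longrightarrow> scale A c x \<otimes> y = scale A c (x \<otimes> y)"
    and scale_mult_right: "\<lbrakk>x \<in> carrier A; y \<in> carrier A\<rbrakk> \<Longrightarrow> x \<otimes> scale A c y = scale A c (x \<otimes> y)"
    and star_closed: "x \<in> carrier A \<Longrightarrow> star A x \<in> carrier A"
    and star_star: "x \<in> carrier A \<Longrightarrow> star A (star A x) = x"
    and star_add: "\<lbrakk>x \<in> carrier A; y \<in> carrier A\<rbrakk> \<Longrightarrow> star A (x \<oplus> y) = star A x \<oplus> star A y"
    and star_scale: "x \<in> carrier A \<Longrightarrow> star A (scale A c x) = scale A (cnj c) (star A x)"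
    and star_mult: "\<lbrakk>x \<in> carrier A; y \<in> carrier A\<rbrakk> \<Longrightarrow> star A (x \<otimes> y) = star A y \<otimes> star A x"
    and nrm_nonneg: "x \<in> carrier A \<Longrightarrow> 0 \<le> nrm A x"
    and nrm_eq_zero_iff: "x \<in> carrier A \<Longrightarrow> nrm A x = 0 \<longleftrightarrow> x = \<zero>"
    and nrm_triangle: "\<lbrakk>x \<in> carrier A; y \<in> carrier A\<rbrakk> \<Longrightarrow> nrm A (x \<oplus> y) \<le> nrm A x + nrm A y"
    and nrm_scale: "x \<in> carrier A \<Longrightarrow> nrm A (scale A c x) = cmod c * nrm A x"
    and nrm_mult: "\<lbrakk>x \<in> carrier A; y \<in> carrier A\<rbrakk> \<Longrightarrow> nrm A (x \<otimes> y) \<le> nrm A x * nrm A y"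
    and cstar_identity: "x \<in> carrier A \<Longrightarrow> nrm A (star A x \<otimes> x) = (nrm A x)\<^sup>2"
    and complete:
      "\<lbrakk>\<And>n::nat. X n \<in> carrier A;
        \<And>e. e > 0 \<Longrightarrow> \<exists>N. \<forall>m\<ge>N. \<forall>n\<ge>N. nrm A (X m \<ominus> X n) < e\<rbrakk>
       \<Longrightarrow> \<exists>x\<in>carrier A. (\<lambda>n. nrm A (X n \<ominus> x)) \<longlonglongrightarrow> 0"

definition is_projection :: "('a, 'm) cstar_scheme \<Rightarrow> 'a \<Rightarrow> bool" where
  "is_projection A x \<longleftrightarrow> x \<in> carrier A \<and> star A x = x \<and> x \<otimes>\<^bsub>A\<^esub> x = x"

definition is_cstar_subalgebra :: "('a, 'm) cstar_scheme \<Rightarrow> 'a set \<Rightarrow> bool" where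
  "is_cstar_subalgebra A B \<longleftrightarrow>
     B \<subseteq> carrier A \<and> \<zero>\<^bsub>A\<^esub> \<in> B \<and>
     (\<forall>x\<in>B. \<forall>y\<in>B. x \<oplus>\<^bsub>A\<^esub> y \<in> B \<and> x \<otimes>\<^bsub>A\<^esub> y \<in> B) \<and>
     (\<forall>c. \<forall>x\<in>B. scale A c x \<in> B) \<and>
     (\<forall>x\<in>B. star A x \<in> B) \<and>
     (\<forall>X x. (\<forall>n::nat. X n \<in> B) \<and> x \<in> carrier A \<and> (\<lambda>n. nrm A (X n \<ominus>\<^bsub>A\<^esub> x)) \<longlonglongrightarrow> 0 \<longrightarrow> x \<in> B)"

text \<open>The unit of \<open>A\<close> is not adjoined: the record below keeps it as its
  \<open>one\<close> field, but it need not belong to the carrier.\<close>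

definition generated_cstar :: "('a, 'm) cstar_scheme \<Rightarrow> 'a set \<Rightarrow> ('a, 'm) cstar_scheme" where
  "generated_cstar A S = A\<lparr>carrier := \<Inter>{B. is_cstar_subalgebra A B \<and> S \<subseteq> B}\<rparr>"

definition cstar_iso :: "('a, 'm) cstar_scheme \<Rightarrow> ('b, 'n) cstar_scheme \<Rightarrow> ('a \<Rightarrow> 'b) set" where
  "cstar_iso A B =
     {f \<in> ring_iso A B. \<forall>x\<in>carrier A. f (star A x) = star B (f x) \<and> (\<forall>c. f (scale A c x) = scale B c (f x))}"

definition cstar_isomorphic :: "('a, 'm) cstar_scheme \<Rightarrow> ('b, 'n) cstar_scheme \<Rightarrow> bool" where
  "cstar_isomorphic A B \<longleftrightarrow> cstar_algebra A \<and> cstar_algebra B \<and> cstar_iso A B \<noteq> {}"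


section \<open>The free unital *-algebra\<close>

text \<open>Words in the letters \<open>g\<close> and \<open>g\<^sup>*\<close> form a monoid, written additively so that the
  convolution product of \<open>Poly_Mapping\<close> becomes the product of noncommutative polynomials.\<close>

datatype 'g letter = Gen 'g | Adj 'g

datatype 'g fword = Word (letters: "'g letter list")

instantiation fword :: (type) monoid_add
begin
definition zero_fword :: "'a fword" where "0 = Word []"
definition plus_fword :: "'a fword \<Rightarrow> 'a fword \<Rightarrow> 'a fword" where
  "v + w = Word (letters v @ letters w)"
instance
  by standard (simp_all add: zero_fword_def plus_fword_def)
end

type_synonym 'g ncpoly = "'g fword \<Rightarrow>\<^sub>0 complex"

fun letter_adj :: "'g letter \<Rightarrow> 'g letter" where
  "letter_adj (Gen g) = Adj g"
| "letter_adj (Adj g) = Gen g"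

definition word_adj :: "'g fword \<Rightarrow> 'g fword" where
  "word_adj w = Word (rev (map letter_adj (letters w)))"

definition gen :: "'g \<Rightarrow> 'g ncpoly" where
  "gen g = Poly_Mapping.single (Word [Gen g]) 1"

definition poly_scale :: "complex \<Rightarrow> 'g ncpoly \<Rightarrow> 'g ncpoly" where
  "poly_scale c x = Poly_Mapping.single 0 c * x"

definition poly_star :: "'g ncpoly \<Rightarrow> 'g ncpoly" where
  "poly_star x = (\<Sum>w\<in>Poly_Mapping.keys x. Poly_Mapping.single (word_adj w) (cnj (Poly_Mapping.lookup x w)))"

definition free_star_alg :: "'g set \<Rightarrow> 'g ncpoly set" where
  "free_star_alg G = {x. \<forall>w\<in>Poly_Mapping.keys x. set (letters w) \<subseteq> Gen ` G \<union> Adj ` G}"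


section \<open>Universal unital C*-algebras\<close>

text \<open>A relation is given by a noncommutative *-polynomial \<open>r\<close>, to be read as \<open>r = 0\<close>.
  The unital C*-algebras generated by a family indexed by \<open>G\<close> satisfying the relations \<open>R\<close>
  correspond to the C*-seminorms on the free *-algebra which vanish on \<open>R\<close>;
  the universal one is the separated completion for the largest such seminorm.\<close>

definition cstar_seminorm :: "'g set \<Rightarrow> 'g ncpoly set \<Rightarrow> ('g ncpoly \<Rightarrow> real) \<Rightarrow> bool" where
  "cstar_seminorm G R s \<longleftrightarrow>
     (\<forall>x\<in>free_star_alg G.
        0 \<le> s x \<and> s (poly_star x * x) = (s x)\<^sup>2 \<and> (\<forall>c. s (poly_scale c x) = cmod c * s x) \<and>
        (\<forall>y\<in>free_star_alg G. s (x + y) \<le> s x + s y \<and> s (x * y) \<le> s x * s y)) \<and>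
     (\<forall>r\<in>R. s r = 0)"

text \<open>This is meaningful only if the relations bound the norm of each generator, as they do
  whenever the generators are partial isometries: the identity \<open>s (u\<^sup>* u) = s ((u\<^sup>* u)\<^sup>2)\<close> gives \<open>s u \<le> 1\<close>.\<close>

definition univ_norm :: "'g set \<Rightarrow> 'g ncpoly set \<Rightarrow> 'g ncpoly \<Rightarrow> real" where
  "univ_norm G R x = Sup {s x | s. cstar_seminorm G R s}"

definition cauchy_ring :: "'g set \<Rightarrow> 'g ncpoly set \<Rightarrow> (nat \<Rightarrow> 'g ncpoly) ring" where
  "cauchy_ring G R =
     \<lparr>carrier = {X. (\<forall>n. X n \<in> free_star_alg G) \<and>
                     (\<forall>e>0. \<exists>N. \<forall>m\<ge>N. \<forall>n\<ge>N. univ_norm G R (X m - X n) < e)},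
      mult = (\<lambda>X Y n. X n * Y n), one = (\<lambda>n. 1), zero = (\<lambda>n. 0), add = (\<lambda>X Y n. X n + Y n)\<rparr>"

definition null_seqs :: "'g set \<Rightarrow> 'g ncpoly set \<Rightarrow> (nat \<Rightarrow> 'g ncpoly) set" where
  "null_seqs G R = {X \<in> carrier (cauchy_ring G R). (\<lambda>n. univ_norm G R (X n)) \<longlonglongrightarrow> 0}"

definition univ_class :: "'g set \<Rightarrow> 'g ncpoly set \<Rightarrow> (nat \<Rightarrow> 'g ncpoly) \<Rightarrow> (nat \<Rightarrow> 'g ncpoly) set" where
  "univ_class G R X = null_seqs G R +>\<^bsub>cauchy_ring G R\<^esub> X"

text \<open>Scalar multiplication, involution and norm act on representatives; the union (respectively
  the image) over all representatives \<open>X\<close> of a coset is that of equal cosets (respectively a singleton).\<close>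

definition univ_cstar :: "'g set \<Rightarrow> 'g ncpoly set \<Rightarrow> (nat \<Rightarrow> 'g ncpoly) set cstar" where
  "univ_cstar G R = (let Q = cauchy_ring G R Quot null_seqs G R in
     \<lparr>carrier = carrier Q, mult = mult Q, one = one Q, zero = zero Q, add = add Q,
      scale = (\<lambda>c P. \<Union>X\<in>P. univ_class G R (\<lambda>n. poly_scale c (X n))),
      star = (\<lambda>P. \<Union>X\<in>P. univ_class G R (\<lambda>n. poly_star (X n))),
      nrm = (\<lambda>P. the_elem ((\<lambda>X. lim (\<lambda>n. univ_norm G R (X n))) ` P))\<rparr>)"

definition univ_gen :: "'g set \<Rightarrow> 'g ncpoly set \<Rightarrow> 'g \<Rightarrow> (nat \<Rightarrow> 'g ncpoly) set" where
  "univ_gen G R g = univ_class G R (\<lambda>n. gen g)"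


section \<open>Relations\<close>

definition unitary_rels :: "'i set \<Rightarrow> ('i \<Rightarrow> 'i \<Rightarrow> 'g ncpoly) \<Rightarrow> 'g ncpoly set" where
  "unitary_rels I u =
     {(\<Sum>k\<in>I. u i k * poly_star (u j k)) - (if i = j then 1 else 0) | i j. i \<in> I \<and> j \<in> I} \<union>
     {(\<Sum>k\<in>I. poly_star (u k i) * u k j) - (if i = j then 1 else 0) | i j. i \<in> I \<and> j \<in> I}"

definition partial_isometry_rels :: "'i set \<Rightarrow> ('i \<Rightarrow> 'i \<Rightarrow> 'g ncpoly) \<Rightarrow> 'g ncpoly set" where
  "partial_isometry_rels I u = {u i j * poly_star (u i j) * u i j - u i j | i j. i \<in> I \<and> j \<in> I}"

definition projection_rels :: "'i set \<Rightarrow> ('i \<Rightarrow> 'i \<Rightarrow> 'g ncpoly) \<Rightarrow> 'g ncpoly set" where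
  "projection_rels I u =
     {poly_star (u i j) - u i j | i j. i \<in> I \<and> j \<in> I} \<union>
     {u i j * u i j - u i j | i j. i \<in> I \<and> j \<in> I}"

abbreviation gen_matrix :: "'i \<Rightarrow> 'i \<Rightarrow> ('i \<times> 'i) ncpoly" where
  "gen_matrix i j \<equiv> gen (i, j)"


section \<open>The algebras $A_s(n)$ and $A_h(p,q)$\<close>

definition As :: "nat \<Rightarrow> (nat \<Rightarrow> (nat \<times> nat) ncpoly) set cstar" where
  "As n = univ_cstar ({1..n} \<times> {1..n})
            (unitary_rels {1..n} gen_matrix \<union> projection_rels {1..n} gen_matrix)"

text \<open>\<open>Inl (i, \<alpha>)\<close> is the index $i\alpha$ and \<open>Inr M\<close> the index $M$.\<close>

type_synonym jindex = "(nat \<times> nat) + nat"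

definition Jpq :: "nat \<Rightarrow> nat \<Rightarrow> jindex set" where
  "Jpq p q = ({0, 1} \<times> {1..p}) <+> {1..q}"

fun bar :: "jindex \<Rightarrow> jindex" where
  "bar (Inl (i, \<alpha>)) = Inl (1 - i, \<alpha>)"
| "bar (Inr M) = Inr M"

definition Ah_rels :: "nat \<Rightarrow> nat \<Rightarrow> (jindex \<times> jindex) ncpoly set" where
  "Ah_rels p q =
     partial_isometry_rels (Jpq p q) gen_matrix \<union> unitary_rels (Jpq p q) gen_matrix \<union>
     {gen_matrix z y - poly_star (gen_matrix (bar z) (bar y)) | z y. z \<in> Jpq p q \<and> y \<in> Jpq p q}"

definition Ah :: "nat \<Rightarrow> nat \<Rightarrow> (nat \<Rightarrow> (jindex \<times> jindex) ncpoly) set cstar" where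
  "Ah p q = univ_cstar (Jpq p q \<times> Jpq p q) (Ah_rels p q)"

definition Ah_gen :: "nat \<Rightarrow> nat \<Rightarrow> jindex \<Rightarrow> jindex \<Rightarrow> (nat \<Rightarrow> (jindex \<times> jindex) ncpoly) set" where
  "Ah_gen p q z y = univ_gen (Jpq p q \<times> Jpq p q) (Ah_rels p q) (z, y)"

definition Ah_proj :: "nat \<Rightarrow> nat \<Rightarrow> jindex \<Rightarrow> jindex \<Rightarrow> (nat \<Rightarrow> (jindex \<times> jindex) ncpoly) set" where
  "Ah_proj p q z y = star (Ah p q) (Ah_gen p q z y) \<otimes>\<^bsub>Ah p q\<^esub> Ah_gen p q z y"

end

theory Submission
  imports Defs
begin

text \<open>The matrix $P_{z,y} = U_{z,y}^* U_{z,y}$ is a magic unitary. Its columns sum to \<open>1\<close>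
  because \<open>U\<close> is unitary; its rows do because $U_{z,y} = U_{\bar z,\bar y}^*$ turns $P_{z,y}$ into
  $U_{\bar z,\bar y} U_{\bar z,\bar y}^*$; and projections that sum to \<open>1\<close> are mutually orthogonal. So the
  universal property of $A_s(2p+q)$ gives a *-homomorphism \<open>\<phi>\<close> onto the algebra generated by the
  $P_{z,y}$, and it remains to see that \<open>\<phi>\<close> is isometric.

  For this $A_s(2p+q)$ is enlarged by a flip. Index its magic unitary \<open>g\<close> by the set $J$ of indices of $A_h(p,q)$.
  The bar permutes $J$, so that the entries $g_{\bar z,\bar y}$ form a magic unitary too, and in the crossed
  product by this automorphism of order two, with implementing unitary \<open>w\<close>, the elements
  $w g_{z,y}$ satisfy the relations of $A_h(p,q)$ and have
  $(w g_{z,y})^* (w g_{z,y}) = g_{z,y}$. Concretely the crossed product is an algebra of two by two matrices: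
  $U_{z,y}$ becomes the matrix with upper right entry $g_{\bar z,\bar y}$, lower left entry $g_{z,y}$ and zero diagonal,
  so that $U_{z,y}^* U_{z,y}$ becomes the diagonal matrix with entries $g_{z,y}$ and $g_{\bar z,\bar y}$.
  Hence the norm of \<open>\<phi> x\<close> is at least that of a diagonal matrix with first entry \<open>x\<close>, which is
  at least the norm of \<open>x\<close> (\<open>flip_matrix\<close>, \<open>psi_phi\<close>, \<open>expansive\<close>).

  This needs a C*-norm on two by two matrices over a C*-algebra that is given by axioms only. The
  operator norm on the Hilbert module of pairs will do, once the Cauchy-Schwarz inequality
  (\<open>cauchy_schwarz\<close>) is known. Both this inequality and the orthogonality of projections that sum to \<open>1\<close> rest
  on the theorem that \<open>x\<^sup>\<dagger> * x\<close> is positive (\<open>pos_adj_mult\<close>). All of it is carried out for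
  C*-seminorms on *-algebras that need not be complete. Square roots are then replaced by approximate ones,
  and the results apply directly to seminorms on the free *-algebra.

  The passage from polynomials to the completions is formal: a *-homomorphism between free
  *-algebras that preserves the universal seminorms extends to an isometry of the universal
  C*-algebras, and its range is closed (\<open>generated_cstar_isomorphic\<close>).\<close>

section \<open>Star-algebras with a C*-seminorm\<close>

locale star_algebra =
  fixes scl :: "complex \<Rightarrow> 'a::ring_1 \<Rightarrow> 'a" (infixr "*\<^sub>C" 75)
    and adj :: "'a \<Rightarrow> 'a" ("(_\<^sup>\<dagger>)" [1000] 1000)
  assumes scl_add_right: "c *\<^sub>C (x + y) = c *\<^sub>C x + c *\<^sub>C y"
    and scl_add_left: "(c + d) *\<^sub>C x = c *\<^sub>C x + d *\<^sub>C x"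
    and scl_scl [simp]: "c *\<^sub>C d *\<^sub>C x = (c * d) *\<^sub>C x"
    and scl_one [simp]: "1 *\<^sub>C x = x"
    and scl_mult_left [simp]: "c *\<^sub>C x * y = c *\<^sub>C (x * y)"
    and scl_mult_right [simp]: "x * c *\<^sub>C y = c *\<^sub>C (x * y)"
    and adj_adj [simp]: "x\<^sup>\<dagger>\<^sup>\<dagger> = x"
    and adj_add [simp]: "(x + y)\<^sup>\<dagger> = x\<^sup>\<dagger> + y\<^sup>\<dagger>"
    and adj_scl [simp]: "(c *\<^sub>C x)\<^sup>\<dagger> = cnj c *\<^sub>C x\<^sup>\<dagger>"
    and adj_mult [simp]: "(x * y)\<^sup>\<dagger> = y\<^sup>\<dagger> * x\<^sup>\<dagger>"
begin

lemma scl_zero_left [simp]: "0 *\<^sub>C x = 0"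
  using scl_add_left[of 0 0 x] by simp

lemma scl_zero_right [simp]: "c *\<^sub>C 0 = 0"
  using scl_add_right[of c 0 0] by simp

lemma scl_minus_left: "(- c) *\<^sub>C x = - (c *\<^sub>C x)"
  by (rule minus_unique[symmetric]) (simp flip: scl_add_left)

lemma scl_minus_right [simp]: "c *\<^sub>C (- x) = - (c *\<^sub>C x)"
  by (rule minus_unique[symmetric]) (simp flip: scl_add_right)

lemma scl_diff_right: "c *\<^sub>C (x - y) = c *\<^sub>C x - c *\<^sub>C y"
  using scl_add_right[of c x "-y"] by simp

lemma scl_diff_left: "(c - d) *\<^sub>C x = c *\<^sub>C x - d *\<^sub>C x"
  using scl_add_left[of c "-d" x] by (simp add: scl_minus_left)

lemma adj_zero [simp]: "0\<^sup>\<dagger> = 0"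
  using adj_add[of 0 0] by simp

lemma adj_minus [simp]: "(- x)\<^sup>\<dagger> = - x\<^sup>\<dagger>"
  by (rule minus_unique[symmetric]) (simp flip: adj_add)

lemma adj_diff [simp]: "(x - y)\<^sup>\<dagger> = x\<^sup>\<dagger> - y\<^sup>\<dagger>"
  using adj_add[of x "-y"] by simp

lemma adj_one [simp]: "1\<^sup>\<dagger> = 1"
proof -
  have "1\<^sup>\<dagger> = 1 * 1\<^sup>\<dagger>" by simp
  also have "\<dots> = (1 * 1\<^sup>\<dagger>)\<^sup>\<dagger>" by (subst adj_mult) simp
  finally show ?thesis by simp
qed

lemma adj_sum: "(\<Sum>i\<in>I. f i)\<^sup>\<dagger> = (\<Sum>i\<in>I. (f i)\<^sup>\<dagger>)"
  by (induction I rule: infinite_finite_induct) auto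

abbreviation real_scalar :: "real \<Rightarrow> 'a" ("\<langle>_\<rangle>") where
  "\<langle>r\<rangle> \<equiv> complex_of_real r *\<^sub>C 1"

lemmas scl_algebra = scl_add_right scl_diff_right scl_minus_left

end

text \<open>Incomplete and degenerate norms are included, so that every C*-seminorm on a free *-algebra
  is an instance. The null elements form a *-ideal.\<close>

locale cstar_seminormed_algebra = star_algebra +
  fixes t :: "'a \<Rightarrow> real"
  assumes nonneg [simp]: "0 \<le> t x"
    and cstar: "t (x\<^sup>\<dagger> * x) = (t x)\<^sup>2"
    and norm_scl [simp]: "t (c *\<^sub>C x) = cmod c * t x"
    and norm_add: "t (x + y) \<le> t x + t y"
    and norm_mult_le: "t (x * y) \<le> t x * t y"
begin

lemma norm_zero [simp]: "t 0 = 0"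
  using norm_scl[of 0 0] by simp

lemma norm_minus [simp]: "t (- x) = t x"
  using norm_scl[of "-1" x] by (simp add: scl_minus_left)

lemma norm_diff_commute: "t (x - y) = t (y - x)"
  using norm_minus[of "x - y"] by simp

lemma norm_diff: "t (x - y) \<le> t x + t y"
  using norm_add[of x "-y"] by simp

lemma norm_triangle_sub: "t x \<le> t y + t (x - y)"
  using norm_add[of y "x - y"] by simp

lemma norm_adj [simp]: "t (x\<^sup>\<dagger>) = t x"
proof -
  have le: "t y \<le> t (y\<^sup>\<dagger>)" for y
  proof (cases "t y = 0")
    case False
    have "t y * t y \<le> t (y\<^sup>\<dagger>) * t y"
      using cstar[of y] norm_mult_le[of "y\<^sup>\<dagger>" y] by (simp add: power2_eq_square)
    then show ?thesis
      by (rule mult_right_le_imp_le) (use False nonneg[of y] in \<open>simp add: less_le\<close>)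
  qed simp
  from le[of x] le[of "x\<^sup>\<dagger>"] show ?thesis by simp
qed

text \<open>A seminorm may vanish on \<open>1\<close>, and then it is zero; only \<open>t 1 = t 1 * t 1\<close> is available.\<close>

lemma norm_one_le [simp]: "t 1 \<le> 1"
proof -
  have "t 1 = (t 1)\<^sup>2" using cstar[of 1] by simp
  then have "t 1 = 0 \<or> t 1 = 1" by (simp add: power2_eq_square)
  then show ?thesis by auto
qed

lemma norm_real_scalar: "t \<langle>r\<rangle> \<le> \<bar>r\<bar>"
  using mult_left_mono[OF norm_one_le, of "\<bar>r\<bar>"] by simp

lemma norm_square_hermitian: "x\<^sup>\<dagger> = x \<Longrightarrow> t (x * x) = (t x)\<^sup>2"
  using cstar[of x] by simp

lemma norm_null_mult: "t x = 0 \<Longrightarrow> t (x * y) = 0" "t y = 0 \<Longrightarrow> t (x * y) = 0"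
  using norm_mult_le[of x y] by (auto intro: antisym)

lemma norm_null_add: "t x = 0 \<Longrightarrow> t y = 0 \<Longrightarrow> t (x + y) = 0"
  using norm_add[of x y] by (auto intro: antisym)

lemma norm_cong: "t (x - y) = 0 \<Longrightarrow> t x = t y"
  using norm_triangle_sub[of x y] norm_triangle_sub[of y x] norm_diff_commute[of x y] by simp

section \<open>Approximate square roots\<close>

text \<open>The fixed points \<open>w\<close> of this iteration satisfy \<open>(1 - w) * (1 - w) = 1 - x\<close>. As the iterates are
  polynomials in \<open>x\<close>, they inherit the hermitian property and commute with whatever commutes with \<open>x\<close>.\<close>

primrec sqrt_iter :: "'a \<Rightarrow> nat \<Rightarrow> 'a" where
  "sqrt_iter x 0 = 0"
| "sqrt_iter x (Suc n) = (1 / 2) *\<^sub>C (x + sqrt_iter x n * sqrt_iter x n)"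

lemma sqrt_iter_hermitian: "x\<^sup>\<dagger> = x \<Longrightarrow> (sqrt_iter x n)\<^sup>\<dagger> = sqrt_iter x n"
  by (induction n) auto

lemma sqrt_iter_commute:
  assumes "z * x = x * z" shows "z * sqrt_iter x n = sqrt_iter x n * z"
proof (induction n)
  case (Suc n)
  have "z * (sqrt_iter x n * sqrt_iter x n) = sqrt_iter x n * sqrt_iter x n * z"
    using Suc by (metis mult.assoc)
  then show ?case using assms by (simp add: distrib_left distrib_right)
qed simp

text \<open>On the real line the iteration started at \<open>0\<close> increases to \<open>\<omega> = 1 - sqrt (1 - \<theta>)\<close>. With \<open>\<theta> = t x\<close> this
  majorizes the iteration in the algebra, where consecutive iterates approach each other like powers of \<open>\<omega> < 1\<close>.
  The bound on \<open>1 - y\<close> makes the root positive.\<close>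

lemma approx_sqrt:
  assumes x: "x\<^sup>\<dagger> = x" "t x < 1" and e: "e > 0"
  obtains y where "y\<^sup>\<dagger> = y" "t (1 - y) \<le> 1" "t (y * y - (1 - x)) < e"
    "\<And>z. z * x = x * z \<Longrightarrow> z * y = y * z"
proof -
  define \<theta> where "\<theta> = t x"
  define \<omega> where "\<omega> = 1 - sqrt (1 - \<theta>)"
  define w where "w = sqrt_iter x"
  have \<theta>: "0 \<le> \<theta>" "\<theta> < 1" using x by (auto simp: \<theta>_def)
  have \<omega>: "0 \<le> \<omega>" "\<omega> < 1" using \<theta> by (auto simp: \<omega>_def)
  have "(1 - \<omega>)\<^sup>2 = 1 - \<theta>" using \<theta> by (simp add: \<omega>_def)
  then have eq: "(\<theta> + \<omega> * \<omega>) / 2 = \<omega>" by (simp add: power2_eq_square algebra_simps)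
  have w_Suc: "w (Suc n) = (1 / 2) *\<^sub>C (x + w n * w n)" for n by (simp add: w_def)
  have bound: "t (w n) \<le> \<omega>" for n
  proof (induction n)
    case 0 then show ?case using \<omega> by (simp add: w_def)
  next
    case (Suc n)
    have "t (w (Suc n)) = t (x + w n * w n) / 2" by (simp add: w_Suc norm_divide)
    also have "t (x + w n * w n) \<le> \<theta> + \<omega> * \<omega>"
      using norm_add[of x "w n * w n"] norm_mult_le[of "w n" "w n"]
        mult_mono[OF Suc Suc \<omega>(1) nonneg] by (simp add: \<theta>_def)
    finally show ?case using eq by simp
  qed
  have step: "t (w (Suc n) - w n) \<le> \<omega> ^ n * \<theta>" for n
  proof (induction n)
    case 0
    have "t (w (Suc 0) - w 0) = \<theta> / 2" by (simp add: w_def \<theta>_def norm_divide)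
    then show ?case using \<theta> by simp
  next
    case (Suc n)
    let ?a = "w (Suc n)" and ?b = "w n"
    have "w (Suc (Suc n)) - w (Suc n) = (1 / 2) *\<^sub>C (?a * (?a - ?b) + (?a - ?b) * ?b)"
      by (subst (1 2) w_Suc) (simp add: scl_diff_right[symmetric] algebra_simps del: scl_mult_left scl_mult_right)
    then have "t (w (Suc (Suc n)) - w (Suc n)) = t (?a * (?a - ?b) + (?a - ?b) * ?b) / 2"
      by (simp add: norm_divide)
    also have "t (?a * (?a - ?b) + (?a - ?b) * ?b) \<le> \<omega> * t (?a - ?b) + t (?a - ?b) * \<omega>"
      using norm_add[of "?a * (?a - ?b)" "(?a - ?b) * ?b"] norm_mult_le[of ?a "?a - ?b"]
        norm_mult_le[of "?a - ?b" ?b] mult_right_mono[OF bound[of "Suc n"] nonneg[of "?a - ?b"]]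
        mult_left_mono[OF bound[of n] nonneg[of "?a - ?b"]] by linarith
    also have "\<dots> / 2 = \<omega> * t (?a - ?b)" by simp
    also have "\<dots> \<le> \<omega> * (\<omega> ^ n * \<theta>)" using Suc \<omega> by (intro mult_left_mono)
    finally show ?case by (simp add: mult.assoc)
  qed
  obtain n where n: "\<omega> ^ n * 2 < e"
  proof -
    have "(\<lambda>n. \<omega> ^ n * 2) \<longlonglongrightarrow> 0 * 2"
      using \<omega> by (intro tendsto_mult LIMSEQ_realpow_zero tendsto_const)
    then have "eventually (\<lambda>n. \<omega> ^ n * 2 < e) sequentially"
      using e by (intro order_tendstoD) auto
    then show ?thesis using that by (auto simp: eventually_sequentially)
  qed
  show ?thesis
  proof
    show "(1 - w n)\<^sup>\<dagger> = 1 - w n" using x by (simp add: w_def sqrt_iter_hermitian)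
    show "t (1 - (1 - w n)) \<le> 1" using bound[of n] \<omega> by simp
    show "z * (1 - w n) = (1 - w n) * z" if "z * x = x * z" for z
      using sqrt_iter_commute[OF that] by (simp add: w_def algebra_simps)
    have "2 *\<^sub>C w (Suc n) = x + w n * w n" by (simp add: w_Suc)
    then have "(1 - w n) * (1 - w n) - (1 - x) = 2 *\<^sub>C (w (Suc n) - w n)"
      using scl_add_left[of 1 1 "w n"] by (simp add: scl_diff_right algebra_simps)
    then have "t ((1 - w n) * (1 - w n) - (1 - x)) = 2 * t (w (Suc n) - w n)" by simp
    also have "\<dots> \<le> 2 * (\<omega> ^ n * \<theta>)" using step[of n] by simp
    also have "\<dots> \<le> 2 * (\<omega> ^ n * 1)" using \<theta> \<omega> by (intro mult_left_mono) auto
    finally show "t ((1 - w n) * (1 - w n) - (1 - x)) < e" using n by simp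
  qed
qed

text \<open>If \<open>h\<close> is the cosine of an angle, then \<open>2 h\<^sup>2 - 1\<close> is the cosine of the double angle. With \<open>y\<close> an
  approximate root of \<open>1 - h\<^sup>2\<close>, the element \<open>u = h + \<i> y\<close> is almost unitary, so it has norm at most about \<open>1\<close>,
  and \<open>2 h\<^sup>2 - 1\<close> is almost the mean of \<open>u\<^sup>2\<close> and \<open>(u\<^sup>\<dagger>)\<^sup>2\<close>.\<close>

lemma norm_double_square_le_strict:
  assumes h: "h\<^sup>\<dagger> = h" "t h < 1"
  shows "t (1 - 2 *\<^sub>C (h * h)) \<le> 1"
proof (rule field_le_epsilon)
  fix e :: real assume "e > 0"
  then have e: "e / 2 > 0" by simp
  have "t (h * h) = (t h)\<^sup>2" using h by (simp add: norm_square_hermitian)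
  also have "\<dots> < 1" using h by (simp add: power_less_one_iff abs_square_less_1)
  finally have lt: "t (h * h) < 1" .
  have hh: "(h * h)\<^sup>\<dagger> = h * h" using h by simp
  obtain y where y: "y\<^sup>\<dagger> = y" "t (y * y - (1 - h * h)) < e / 2"
    "\<And>z. z * (h * h) = h * h * z \<Longrightarrow> z * y = y * z"
    by (rule approx_sqrt[OF hh lt e]) blast
  have comm: "h * y = y * h" by (rule y(3)) (simp add: mult.assoc)
  define d where "d = y * y - (1 - h * h)"
  have td: "t d < e / 2" using y(2) by (simp add: d_def)
  define u where "u = h + \<i> *\<^sub>C y"
  have ustar: "u\<^sup>\<dagger> = h - \<i> *\<^sub>C y" using h y(1) by (simp add: u_def scl_minus_left)
  have uu: "u\<^sup>\<dagger> * u = 1 + d"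
    by (simp add: ustar) (simp add: u_def d_def algebra_simps scl_algebra comm)
  have "(t u)\<^sup>2 = t (1 + d)" using cstar[of u] by (simp only: uu)
  also have "\<dots> \<le> 1 + e / 2" using norm_add[of 1 d] norm_one_le td by linarith
  finally have tu: "(t u)\<^sup>2 \<le> 1 + e / 2" .
  have sq: "u * u + u\<^sup>\<dagger> * u\<^sup>\<dagger> = 2 *\<^sub>C (h * h - y * y)"
    unfolding ustar using scl_add_left[of 1 1 "h * h"] scl_add_left[of 1 1 "y * y"]
    by (simp add: u_def algebra_simps scl_algebra comm)
  have "h * h - y * y = 2 *\<^sub>C (h * h) - 1 - d"
    using scl_add_left[of 1 1 "h * h"] by (simp add: d_def algebra_simps)
  then have "1 - 2 *\<^sub>C (h * h) = - d - (h * h - y * y)" by (simp add: algebra_simps)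
  then have "t (1 - 2 *\<^sub>C (h * h)) \<le> t d + t (h * h - y * y)"
    using norm_diff[of "- d" "h * h - y * y"] by simp
  moreover have "2 * t (h * h - y * y) \<le> 2 * (t u)\<^sup>2"
  proof -
    have "2 * t (h * h - y * y) = t (u * u + u\<^sup>\<dagger> * u\<^sup>\<dagger>)" by (simp add: sq)
    also have "\<dots> \<le> t u * t u + t (u\<^sup>\<dagger>) * t (u\<^sup>\<dagger>)"
      using norm_add[of "u * u" "u\<^sup>\<dagger> * u\<^sup>\<dagger>"] norm_mult_le[of u u] norm_mult_le[of "u\<^sup>\<dagger>" "u\<^sup>\<dagger>"] by linarith
    finally show ?thesis by (simp add: power2_eq_square)
  qed
  ultimately show "t (1 - 2 *\<^sub>C (h * h)) \<le> 1 + e" using tu td by linarith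
qed

lemma norm_scalar_minus_square_le:
  assumes h: "h\<^sup>\<dagger> = h" and r: "(t h)\<^sup>2 < 2 * r"
  shows "t (\<langle>r\<rangle> - h * h) \<le> r"
proof -
  have r0: "r > 0" using r zero_le_power2[of "t h"] by linarith
  define c where "c = 1 / sqrt (2 * r)"
  define g where "g = of_real c *\<^sub>C h"
  have c: "c > 0" "c * c = 1 / (2 * r)" using r0 by (auto simp: c_def)
  have "t g = c * t h" using c by (simp add: g_def)
  then have "(t g)\<^sup>2 = c * c * (t h)\<^sup>2" by (simp only: power_mult_distrib power2_eq_square[of c])
  also have "\<dots> < 1" using r r0 by (simp add: c)
  finally have "t g < 1" using abs_square_less_1[of "t g"] by simp
  then have "t (1 - 2 *\<^sub>C (g * g)) \<le> 1"
    using h by (intro norm_double_square_le_strict) (simp_all add: g_def)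
  moreover have "2 *\<^sub>C (g * g) = of_real (1 / r) *\<^sub>C (h * h)"
  proof -
    have "2 * (complex_of_real c * complex_of_real c) = of_real (2 * (c * c))" by simp
    also have "2 * (c * c) = 1 / r" by (simp add: c)
    finally show ?thesis by (simp add: g_def mult.assoc)
  qed
  moreover have "\<langle>r\<rangle> - h * h = of_real r *\<^sub>C (1 - of_real (1 / r) *\<^sub>C (h * h))"
    using r0 by (simp add: scl_diff_right)
  ultimately have "t (\<langle>r\<rangle> - h * h) = r * t (1 - of_real (1 / r) *\<^sub>C (h * h))"
    and "t (1 - of_real (1 / r) *\<^sub>C (h * h)) \<le> 1"
    using r0 by (simp_all)
  then show ?thesis using r0 by (simp add: mult_le_cancel_left1)
qed

section \<open>Positive elements\<close>

text \<open>For a hermitian \<open>k\<close> in a C*-algebra and \<open>r \<ge> 0\<close>, the norm of \<open>r - k\<close> is at most \<open>r\<close> exactly if the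
  spectrum of \<open>k\<close> lies in the interval from \<open>0\<close> to \<open>2 r\<close>. This form of positivity needs no spectrum and is obviously
  compatible with sums.\<close>

definition pos :: "'a \<Rightarrow> bool" where
  "pos k \<longleftrightarrow> k\<^sup>\<dagger> = k \<and> (\<exists>r\<ge>0. t (\<langle>r\<rangle> - k) \<le> r)"

lemma pos_hermitian: "pos k \<Longrightarrow> k\<^sup>\<dagger> = k" by (simp add: pos_def)

lemma posI: "k\<^sup>\<dagger> = k \<Longrightarrow> t (\<langle>r\<rangle> - k) \<le> r \<Longrightarrow> pos k"
  unfolding pos_def using nonneg[of "\<langle>r\<rangle> - k"] by (metis order_trans)

lemma pos_real_scalar: "c \<ge> 0 \<Longrightarrow> pos \<langle>c\<rangle>"
  by (rule posI[where r = c]) auto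

lemma pos_square: "h\<^sup>\<dagger> = h \<Longrightarrow> pos (h * h)"
proof -
  assume h: "h\<^sup>\<dagger> = h"
  have "(t h)\<^sup>2 < 2 * ((t h)\<^sup>2 + 1)" by (simp add: add_nonneg_pos)
  from posI[OF _ norm_scalar_minus_square_le[OF h this]] show ?thesis using h by simp
qed

lemma pos_scalar_minus: "k\<^sup>\<dagger> = k \<Longrightarrow> t k \<le> K \<Longrightarrow> pos (\<langle>K\<rangle> - k)"
  by (rule posI[where r = K]) auto

lemma pos_add: "pos h \<Longrightarrow> pos k \<Longrightarrow> pos (h + k)"
proof -
  assume "pos h" "pos k"
  then obtain r s where "h\<^sup>\<dagger> = h" "k\<^sup>\<dagger> = k" "t (\<langle>r\<rangle> - h) \<le> r" "t (\<langle>s\<rangle> - k) \<le> s"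
    by (auto simp: pos_def)
  then show ?thesis
    using norm_add[of "\<langle>r\<rangle> - h" "\<langle>s\<rangle> - k"]
    by (intro posI[where r = "r + s"]) (auto simp: scl_add_left algebra_simps)
qed

lemma pos_scl: "pos h \<Longrightarrow> c \<ge> 0 \<Longrightarrow> pos (of_real c *\<^sub>C h)"
proof -
  assume "pos h" and c: "c \<ge> 0"
  then obtain r where r: "h\<^sup>\<dagger> = h" "t (\<langle>r\<rangle> - h) \<le> r" by (auto simp: pos_def)
  have "\<langle>c * r\<rangle> - of_real c *\<^sub>C h = of_real c *\<^sub>C (\<langle>r\<rangle> - h)" by (simp add: scl_diff_right)
  then show ?thesis using r c mult_left_mono[OF r(2) c]
    by (intro posI[where r = "c * r"]) (auto)
qed

text \<open>For a witness \<open>r\<close> of positivity, \<open>1 - k / r\<close> has norm at most \<open>1\<close>; shrunk by a factor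
  \<open>1 - d\<close>, it can be fed to the approximate square root.\<close>

lemma pos_approx_square:
  assumes k: "pos k" and e: "e > 0"
  obtains l where "pos l" "t (l * l - k) < e" "\<And>z. z * k = k * z \<Longrightarrow> z * l = l * z"
proof -
  obtain r0 where r0: "k\<^sup>\<dagger> = k" "r0 \<ge> 0" "t (\<langle>r0\<rangle> - k) \<le> r0" using k by (auto simp: pos_def)
  define r where "r = r0 + 1"
  have r: "r > 0" using r0 by (simp add: r_def)
  have rk: "t (\<langle>r\<rangle> - k) \<le> r"
  proof -
    have "\<langle>r\<rangle> - k = (\<langle>r0\<rangle> - k) + 1" by (simp add: r_def scl_add_left)
    then have "t (\<langle>r\<rangle> - k) \<le> t (\<langle>r0\<rangle> - k) + t 1" using norm_add[of "\<langle>r0\<rangle> - k" 1] by (simp only:)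
    then show ?thesis using r0 norm_one_le unfolding r_def by linarith
  qed
  define d where "d = min (1/2) (e / (2 * (r + t k + 1)))"
  have pos1: "r + t k + 1 > 0" using r nonneg[of k] by linarith
  have d: "d > 0" "d < 1" "d * (r + t k) < e / 2"
  proof -
    show "d > 0" using e pos1 by (simp add: d_def)
    show "d < 1" by (simp add: d_def)
    have "d * (r + t k) < d * (r + t k + 1)" using \<open>d > 0\<close> by simp
    also have "\<dots> \<le> e / (2 * (r + t k + 1)) * (r + t k + 1)"
      using pos1 by (intro mult_right_mono) (auto simp: d_def)
    also have "\<dots> = e / 2"
    proof -
      have "e / (2 * P) * P = e / 2" if "P > 0" for P :: real using that by simp
      from this[OF pos1] show ?thesis .
    qed
    finally show "d * (r + t k) < e / 2" .
  qed
  \<comment> \<open>The factor \<open>1 - d\<close> makes the norm strictly less than \<open>1\<close>, at the price of an error \<open>d * (r + t k)\<close>.\<close>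
  define x where "x = of_real (1 - d) *\<^sub>C (1 - of_real (1 / r) *\<^sub>C k)"
  have rkr: "of_real r *\<^sub>C (1 - of_real (1 / r) *\<^sub>C k) = \<langle>r\<rangle> - k" using r by (simp add: scl_diff_right)
  then have "r * t (1 - of_real (1 / r) *\<^sub>C k) \<le> r * 1" using rk r norm_scl[of "of_real r" "1 - of_real (1 / r) *\<^sub>C k"] by simp
  then have "t (1 - of_real (1 / r) *\<^sub>C k) \<le> 1" using r by (simp add: mult_le_cancel_left1)
  then have "t x \<le> (1 - d) * 1" unfolding x_def norm_scl using d
    by (intro mult_mono) (auto simp del: of_real_diff)
  then have x: "t x < 1" "x\<^sup>\<dagger> = x" using d r0 by (auto simp: x_def)
  have er: "e / (2 * r) > 0" using e r by simp
  obtain y where y: "y\<^sup>\<dagger> = y" "t (1 - y) \<le> 1" "t (y * y - (1 - x)) < e / (2 * r)"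
    "\<And>z. z * x = x * z \<Longrightarrow> z * y = y * z"
    by (rule approx_sqrt[OF x(2,1) er]) blast
  define l where "l = of_real (sqrt r) *\<^sub>C y"
  show ?thesis
  proof
    have "\<langle>sqrt r\<rangle> - l = of_real (sqrt r) *\<^sub>C (1 - y)" by (simp add: l_def scl_diff_right)
    then have "t (\<langle>sqrt r\<rangle> - l) \<le> sqrt r" using y(2) r by (simp add: mult_left_le)
    then show "pos l" using y(1) by (intro posI[where r = "sqrt r"]) (simp_all add: l_def)
    show "z * l = l * z" if "z * k = k * z" for z
    proof -
      have "z * x = x * z" using that by (simp add: x_def algebra_simps scl_diff_right)
      from y(4)[OF this] show ?thesis by (simp add: l_def)
    qed
    have "complex_of_real (sqrt r) * complex_of_real (sqrt r) = of_real (sqrt r * sqrt r)" by (simp only: of_real_mult)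
    then have ll: "l * l = of_real r *\<^sub>C (y * y)" using r by (simp add: l_def)
    have rx: "of_real r *\<^sub>C (1 - x) = of_real d *\<^sub>C (\<langle>r\<rangle> - k) + k"
    proof -
      have "of_real r *\<^sub>C x = of_real (1 - d) *\<^sub>C (of_real r *\<^sub>C (1 - of_real (1 / r) *\<^sub>C k))"
        unfolding x_def scl_scl by (simp only: mult.commute)
      also have "\<dots> = (\<langle>r\<rangle> - k) - of_real d *\<^sub>C (\<langle>r\<rangle> - k)"
        unfolding rkr by (simp only: of_real_diff of_real_1 scl_diff_left scl_one)
      finally show ?thesis by (simp only: scl_diff_right[of _ 1]) (simp add: algebra_simps)
    qed
    have "l * l - k = of_real r *\<^sub>C (y * y - (1 - x)) + of_real d *\<^sub>C (\<langle>r\<rangle> - k)"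
      unfolding scl_diff_right[of _ "y * y"] rx ll by simp
    then have "t (l * l - k) \<le> r * t (y * y - (1 - x)) + d * t (\<langle>r\<rangle> - k)"
      using norm_add[of "of_real r *\<^sub>C (y * y - (1 - x))" "of_real d *\<^sub>C (\<langle>r\<rangle> - k)"] r d by simp
    moreover have "r * t (y * y - (1 - x)) < r * (e / (2 * r))"
      using y(3) r by (intro mult_strict_left_mono)
    moreover have "d * t (\<langle>r\<rangle> - k) \<le> d * (r + t k)"
    proof (rule mult_left_mono)
      show "t (\<langle>r\<rangle> - k) \<le> r + t k" using norm_diff[of "\<langle>r\<rangle>" k] norm_real_scalar[of r] r by linarith
    qed (use d in simp)
    moreover have "r * (e / (2 * r)) = e / 2" using r by simp
    ultimately show "t (l * l - k) < e" using d(3) by linarith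
  qed
qed

text \<open>The radius in the definition of positivity can be any number from half the norm on. It is this
  sharp threshold, inherited from the double angle formula for squares, that makes norms monotone.\<close>

lemma pos_norm_le:
  assumes k: "pos k" and r: "t k / 2 \<le> r"
  shows "t (\<langle>r\<rangle> - k) \<le> r"
proof (rule field_le_epsilon)
  fix e :: real assume e: "e > 0"
  have e3: "e / 3 > 0" using e by simp
  obtain l where l: "pos l" "t (l * l - k) < e / 3" by (rule pos_approx_square[OF k e3])
  have "(t l)\<^sup>2 = t (l * l)" using pos_hermitian[OF l(1)] by (simp add: norm_square_hermitian)
  also have "\<dots> < 2 * (r + e / 3)"
    using l(2) norm_triangle_sub[of "l * l" k] r e by (simp add: field_simps)
  finally have *: "t (\<langle>r + e / 3\<rangle> - l * l) \<le> r + e / 3"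
    by (intro norm_scalar_minus_square_le pos_hermitian[OF l(1)])
  have eq: "\<langle>r\<rangle> - k = (\<langle>r + e / 3\<rangle> - l * l) + (l * l - k) - \<langle>e / 3\<rangle>"
    by (simp add: scl_add_left)
  have "t (\<langle>r\<rangle> - k) \<le> t (\<langle>r + e / 3\<rangle> - l * l) + t (l * l - k) + t \<langle>e / 3\<rangle>"
    unfolding eq by (rule order_trans[OF norm_diff add_right_mono[OF norm_add]])
  then show "t (\<langle>r\<rangle> - k) \<le> r + e"
    using * l(2) norm_real_scalar[of "e / 3"] e by linarith
qed

lemma pos_closed:
  assumes k: "k\<^sup>\<dagger> = k" and approx: "\<And>d. d > 0 \<Longrightarrow> \<exists>k'. pos k' \<and> t (k - k') < d"
  shows "pos k"
proof (rule posI[OF k, where r = "t k + 1"], rule field_le_epsilon)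
  fix e :: real assume e: "e > 0"
  obtain k' where k': "pos k'" "t (k - k') < min e 1" using approx[of "min e 1"] e by auto
  have "t k' \<le> t k + 1" using norm_triangle_sub[of k' k] k'(2) norm_diff_commute[of k k'] by simp
  then have "t (\<langle>t k + 1\<rangle> - k') \<le> t k + 1"
    using nonneg[of k'] by (intro pos_norm_le k') linarith
  then show "t (\<langle>t k + 1\<rangle> - k) \<le> t k + 1 + e"
    using norm_diff[of "\<langle>t k + 1\<rangle> - k'" "k - k'"] k'(2) by simp
qed

text \<open>Apply the sharp threshold to \<open>h\<close>, of norm \<open>T\<close>, and to \<open>K - h\<close>, of norm \<open>S\<close>. Writing \<open>2 h\<close> by means of
  \<open>S / 2 - (K - h)\<close> and \<open>T / 2 - h\<close> gives \<open>2 T \<le> S / 2 + T / 2 + (T - S) / 2 + K\<close>, in which \<open>S\<close>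
  cancels.\<close>

lemma pos_norm_mono_scalar:
  assumes h: "pos h" and K: "pos (\<langle>K\<rangle> - h)" "K \<ge> 0"
  shows "t h \<le> K"
proof -
  define S where "S = t (\<langle>K\<rangle> - h)"
  define T where "T = t h"
  have 1: "t (\<langle>S / 2\<rangle> - (\<langle>K\<rangle> - h)) \<le> S / 2" by (rule pos_norm_le[OF K(1)]) (simp add: S_def)
  have 2: "t (\<langle>T / 2\<rangle> - h) \<le> T / 2" by (rule pos_norm_le[OF h]) (simp add: T_def)
  have "S \<le> K + T"
    using norm_diff[of "\<langle>K\<rangle>" h] norm_real_scalar[of K] K by (simp add: S_def T_def)
  then have 3: "t \<langle>(T - S) / 2 + K\<rangle> \<le> (T - S) / 2 + K"
    using norm_real_scalar[of "(T - S) / 2 + K"] K by (simp add: field_simps)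
  have eq: "2 *\<^sub>C h = (\<langle>S / 2\<rangle> - (\<langle>K\<rangle> - h)) - (\<langle>T / 2\<rangle> - h) + \<langle>(T - S) / 2 + K\<rangle>"
    using scl_add_left[of 1 1 h]
    by (simp add: scl_algebra scl_add_left scl_diff_left diff_divide_distrib)
  have "2 * T = t (2 *\<^sub>C h)" by (simp add: T_def)
  also have "\<dots> \<le> t (\<langle>S / 2\<rangle> - (\<langle>K\<rangle> - h)) + t (\<langle>T / 2\<rangle> - h) + t \<langle>(T - S) / 2 + K\<rangle>"
    unfolding eq by (rule order_trans[OF norm_add add_right_mono[OF norm_diff]])
  also have "\<dots> \<le> S / 2 + T / 2 + ((T - S) / 2 + K)" using 1 2 3 by linarith
  finally show ?thesis by (simp add: T_def field_simps)
qed

lemma power_le_linear_imp_le_one: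
  fixes x c :: real
  assumes "\<And>k. x ^ (2 ^ k) \<le> 1 + c * 2 ^ k" shows "x \<le> 1"
proof (rule ccontr)
  assume "\<not> x \<le> 1"
  then have x: "x > 1" by simp
  have "(\<lambda>n. 1 * (1 / x) ^ n + c * (of_nat n * (1 / x) ^ n)) \<longlonglongrightarrow> 1 * 0 + c * 0"
    using x by (intro tendsto_add tendsto_mult tendsto_const LIMSEQ_realpow_zero powser_times_n_limit_0) auto
  then have "eventually (\<lambda>n. 1 * (1 / x) ^ n + c * (of_nat n * (1 / x) ^ n) < 1) sequentially"
    by (intro order_tendstoD) auto
  then obtain N where N: "\<And>n. n \<ge> N \<Longrightarrow> (1 / x) ^ n + c * (of_nat n * (1 / x) ^ n) < 1"
    by (auto simp: eventually_sequentially)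
  have "(1 / x) ^ (2 ^ N) + c * (of_nat (2 ^ N) * (1 / x) ^ (2 ^ N)) < 1"
    by (rule N) (simp add: less_imp_le)
  then have "1 + c * 2 ^ N < x ^ (2 ^ N)" using x by (simp add: field_simps)
  with assms[of N] show False by simp
qed

lemma norm_power_hermitian:
  assumes "a\<^sup>\<dagger> = a" shows "t (a ^ (2 ^ k)) = t a ^ (2 ^ k)"
proof (induction k)
  case (Suc k)
  have herm: "(a ^ n)\<^sup>\<dagger> = a ^ n" for n
    by (induction n) (use assms in \<open>auto simp: power_commutes\<close>)
  have "t (a ^ (2 ^ Suc k)) = t (a ^ (2 ^ k) * a ^ (2 ^ k))"
    by (simp add: mult_2 power_add)
  also have "\<dots> = (t (a ^ (2 ^ k)))\<^sup>2" by (rule norm_square_hermitian[OF herm])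
  also have "\<dots> = t a ^ (2 ^ k) * t a ^ (2 ^ k)" by (simp only: Suc power2_eq_square)
  finally show ?case by (simp add: mult_2 power_add)
qed simp

text \<open>This replaces the statement that \<open>y * y\<^sup>\<dagger>\<close> and \<open>y\<^sup>\<dagger> * y\<close> have the same spectrum away from \<open>0\<close>. The powers
  of \<open>a = r - y\<^sup>\<dagger> * y\<close> and \<open>b = r - y * y\<^sup>\<dagger>\<close> are intertwined by \<open>y\<close>, so those of \<open>a\<close> exceed the bound for
  those of \<open>b\<close> by a factor of at most linear growth. Taking roots along powers of two removes that
  factor.\<close>

lemma pos_swap:
  assumes p: "pos (y * y\<^sup>\<dagger> + \<langle>d\<rangle>)" and d: "d \<ge> 0"
  shows "pos (y\<^sup>\<dagger> * y + \<langle>d\<rangle>)"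
proof -
  define T where "T = (t y)\<^sup>2"
  define r where "r = T + 1"
  define \<rho> where "\<rho> = r + d"
  define a where "a = \<langle>r\<rangle> - y\<^sup>\<dagger> * y"
  define b where "b = \<langle>r\<rangle> - y * y\<^sup>\<dagger>"
  have T: "T \<ge> 0" "t (y * y\<^sup>\<dagger>) = T" using cstar[of "y\<^sup>\<dagger>"] by (auto simp: T_def)
  have \<rho>: "\<rho> > 0" "r \<ge> 0" "r \<le> \<rho>" using T d by (auto simp: \<rho>_def r_def)
  have "t (y * y\<^sup>\<dagger> + \<langle>d\<rangle>) / 2 \<le> \<rho>"
    using norm_add[of "y * y\<^sup>\<dagger>" "\<langle>d\<rangle>"] norm_real_scalar[of d] T d by (simp add: \<rho>_def r_def)
  from pos_norm_le[OF p this] have b: "t b \<le> \<rho>"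
    by (simp add: b_def \<rho>_def scl_add_left)
  have ya: "y * a ^ n = b ^ n * y" for n
  proof (induction n)
    case (Suc n)
    have "y * a = b * y" by (simp add: a_def b_def algebra_simps)
    then have "y * a ^ Suc n = b * (y * a ^ n)" by (simp add: mult.assoc[symmetric])
    then show ?case using Suc by (simp add: mult.assoc)
  qed simp
  have tb: "t (b ^ n) \<le> \<rho> ^ n" for n
  proof (induction n)
    case (Suc n)
    then show ?case using norm_mult_le[of b "b ^ n"] mult_mono[OF b Suc] \<rho> by simp
  qed simp
  have ta: "t (a ^ n) \<le> \<rho> ^ n * (1 + n * (T / \<rho>))" for n
  proof (induction n)
    case (Suc n)
    have "a ^ Suc n = of_real r *\<^sub>C a ^ n - y\<^sup>\<dagger> * (y * a ^ n)"
      by (simp add: a_def algebra_simps)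
    then have "a ^ Suc n = of_real r *\<^sub>C a ^ n - y\<^sup>\<dagger> * (b ^ n * y)"
      by (simp only: ya)
    then have "t (a ^ Suc n) \<le> r * t (a ^ n) + t (y\<^sup>\<dagger> * (b ^ n * y))"
      using norm_diff[of "of_real r *\<^sub>C a ^ n" "y\<^sup>\<dagger> * (b ^ n * y)"] \<rho> by simp
    also have "t (y\<^sup>\<dagger> * (b ^ n * y)) \<le> t y * (t (b ^ n) * t y)"
      using norm_mult_le[of "y\<^sup>\<dagger>" "b ^ n * y"] mult_left_mono[OF norm_mult_le[of "b ^ n" y] nonneg[of y]]
      by simp
    also have "\<dots> = T * t (b ^ n)" by (simp add: T_def power2_eq_square algebra_simps)
    also have "\<dots> \<le> T * \<rho> ^ n" using tb T by (intro mult_left_mono)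
    also have "r * t (a ^ n) \<le> \<rho> * (\<rho> ^ n * (1 + n * (T / \<rho>)))"
      using Suc \<rho> by (intro mult_mono) auto
    finally show ?case using \<rho> by (simp add: field_simps)
  qed simp
  have ah: "a\<^sup>\<dagger> = a" by (simp add: a_def)
  have "(t a / \<rho>) ^ (2 ^ k) \<le> 1 + (T / \<rho>) * 2 ^ k" for k
    using ta[of "2 ^ k"] \<rho> unfolding norm_power_hermitian[OF ah]
    by (simp add: power_divide pos_divide_le_eq mult.commute)
  then have "t a / \<rho> \<le> 1" by (rule power_le_linear_imp_le_one)
  then have "t a \<le> \<rho>" using \<rho> by simp
  then show ?thesis
    by (intro posI[where r = \<rho>]) (simp_all add: a_def \<rho>_def scl_add_left)
qed

text \<open>The classical argument, with approximations. Let \<open>h = x\<^sup>\<dagger> * x\<close>, let \<open>l\<close> approximate the absolute value of \<open>h\<close>,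
  and let \<open>k = l - h\<close>, twice the negative part. For \<open>y = x * k\<close> the element \<open>y\<^sup>\<dagger> * y = k * h * k\<close> is
  negative up to a small error. Since \<open>y * y\<^sup>\<dagger> + y\<^sup>\<dagger> * y\<close> is a sum of hermitian squares, \<open>y * y\<^sup>\<dagger>\<close> is then almost positive,
  hence so is \<open>y\<^sup>\<dagger> * y\<close> by \<open>pos_swap\<close>. So \<open>y\<^sup>\<dagger> * y\<close> is small, which forces \<open>k\<close> to be small, and \<open>h\<close>
  is close to the positive element \<open>l\<close>.\<close>

theorem pos_adj_mult: "pos (x\<^sup>\<dagger> * x)"
proof (rule pos_closed)
  fix \<delta> :: real assume \<delta>: "\<delta> > 0"
  define h where "h = x\<^sup>\<dagger> * x"
  have h: "h\<^sup>\<dagger> = h" by (simp add: h_def)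
  \<comment> \<open>The estimates below end in \<open>(t k)\<^sup>2 \<le> 7 * e\<close>, so any divisor larger than \<open>7\<close> serves.\<close>
  define e where "e = \<delta>\<^sup>2 / 16"
  have e: "e > 0" using \<delta> by (simp add: e_def)
  obtain l where l: "pos l" "t (l * l - h * h) < e" "\<And>z. z * (h * h) = h * h * z \<Longrightarrow> z * l = l * z"
    by (rule pos_approx_square[OF pos_square[OF h] e]) blast
  have lh: "h * l = l * h" by (rule l(3)) (simp add: mult.assoc)
  have l_herm: "l\<^sup>\<dagger> = l" by (rule pos_hermitian[OF l(1)])
  define k where "k = l - h"
  have k: "k\<^sup>\<dagger> = k" "k * l = l * k" using h l_herm lh by (auto simp: k_def algebra_simps)
  define y where "y = x * k"
  define E where "E = k * l * k + y\<^sup>\<dagger> * y"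
  have yy: "y\<^sup>\<dagger> * y = k * h * k" using k by (simp add: y_def h_def mult.assoc)
  have "E = k * ((l + h) * (l - h))" by (simp add: E_def yy k_def algebra_simps)
  also have "(l + h) * (l - h) = l * l - h * h" using lh by (simp add: algebra_simps)
  finally have "t E \<le> t k * e"
    using norm_mult_le[of k "l * l - h * h"] mult_left_mono[OF less_imp_le[OF l(2)] nonneg[of k]] by simp
  moreover define e1 where "e1 = t k * e"
  ultimately have E: "t E \<le> e1" "E\<^sup>\<dagger> = E" "e1 \<ge> 0"
    using k(1) l_herm e by (auto simp: E_def mult.assoc)
  have "pos (k * l * k)"
  proof (rule pos_closed)
    show "(k * l * k)\<^sup>\<dagger> = k * l * k" using k(1) l_herm by (simp add: mult.assoc)
    fix d :: real assume d: "d > 0"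
    define d' where "d' = d / (t k * t k + 1)"
    have tk: "t k * t k + 1 > 0" by (simp add: add_nonneg_pos)
    have d': "d' > 0" using d tk by (simp add: d'_def)
    obtain n where n: "pos n" "t (n * n - l) < d'" "\<And>z. z * l = l * z \<Longrightarrow> z * n = n * z"
      by (rule pos_approx_square[OF l(1) d']) blast
    have kn: "k * n = n * k" using n(3) k(2) by simp
    have n_herm: "n\<^sup>\<dagger> = n" by (rule pos_hermitian[OF n(1)])
    have "pos ((k * n) * (k * n))" using kn k n_herm by (intro pos_square) simp
    moreover have "k * l * k - (k * n) * (k * n) = k * (l - n * n) * k"
    proof -
      have "(k * n) * (k * n) = k * (n * n) * k" using kn by (metis mult.assoc)
      then show ?thesis by (simp add: algebra_simps)
    qed
    moreover have "t (k * (l - n * n) * k) < d"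
    proof -
      have "t (k * (l - n * n) * k) \<le> t k * t (l - n * n) * t k"
        using norm_mult_le[of "k * (l - n * n)" k]
          mult_right_mono[OF norm_mult_le[of k "l - n * n"] nonneg[of k]] by linarith
      also have "\<dots> = t k * t k * t (n * n - l)" by (simp add: norm_diff_commute[of l])
      also have "\<dots> \<le> t k * t k * d'" using n(2) by (intro mult_left_mono) auto
      also have "\<dots> < (t k * t k + 1) * d'" using d' by simp
      also have "\<dots> = d" using tk by (simp add: d'_def)
      finally show ?thesis .
    qed
    ultimately show "\<exists>k'. pos k' \<and> t (k * l * k - k') < d" by (metis)
  qed
  then have p1: "pos (k * l * k + (\<langle>e1\<rangle> - E))" by (intro pos_add pos_scalar_minus E)
  then have neg: "pos (\<langle>e1\<rangle> - y\<^sup>\<dagger> * y)" by (simp add: E_def)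
  define c where "c = y + y\<^sup>\<dagger>"
  define d where "d = \<i> *\<^sub>C (y - y\<^sup>\<dagger>)"
  have cd: "c\<^sup>\<dagger> = c" "d\<^sup>\<dagger> = d" by (simp_all add: c_def d_def add.commute scl_algebra)
  have "pos (of_real (1 / 2) *\<^sub>C (c * c + d * d))"
    by (intro pos_scl pos_add pos_square cd) simp
  also have "of_real (1 / 2) *\<^sub>C (c * c + d * d) = y * y\<^sup>\<dagger> + y\<^sup>\<dagger> * y"
  proof -
    have half: "z = (1/2) *\<^sub>C z + (1/2) *\<^sub>C z" for z using scl_add_left[of "1/2" "1/2" z] by simp
    show ?thesis
      using half[of "y * y\<^sup>\<dagger>"] half[of "y\<^sup>\<dagger> * y"]
      by (simp add: c_def d_def algebra_simps scl_algebra)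
  qed
  finally have "pos ((y * y\<^sup>\<dagger> + y\<^sup>\<dagger> * y) + (\<langle>e1\<rangle> - y\<^sup>\<dagger> * y))" by (rule pos_add[OF _ neg])
  then have "pos (y * y\<^sup>\<dagger> + \<langle>e1\<rangle>)" by simp
  then have "pos (y\<^sup>\<dagger> * y + \<langle>e1\<rangle>)" using E(3) by (rule pos_swap)
  moreover have "pos (\<langle>2 * e1\<rangle> - (y\<^sup>\<dagger> * y + \<langle>e1\<rangle>))"
  proof -
    have "complex_of_real (2 * e1) = of_real e1 + of_real e1" by simp
    then have "\<langle>2 * e1\<rangle> = \<langle>e1\<rangle> + \<langle>e1\<rangle>" by (simp only: scl_add_left)
    then show ?thesis using neg by (simp add: algebra_simps)
  qed
  ultimately have "t (y\<^sup>\<dagger> * y + \<langle>e1\<rangle>) \<le> 2 * e1" using E(3) by (intro pos_norm_mono_scalar) auto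
  then have tyy: "t (y\<^sup>\<dagger> * y) \<le> 3 * e1"
    using norm_diff[of "y\<^sup>\<dagger> * y + \<langle>e1\<rangle>" "\<langle>e1\<rangle>"] norm_real_scalar[of e1] E(3) by simp
  \<comment> \<open>\<open>k * l * k = E - y\<^sup>\<dagger> * y\<close> by definition of \<open>E\<close>, and \<open>k * k * k = k * l * k - k * h * k\<close>.\<close>
  have "k * k * k = E - y\<^sup>\<dagger> * y - y\<^sup>\<dagger> * y"
    by (simp add: E_def yy) (simp add: k_def algebra_simps)
  then have k3: "t (k * k * k) \<le> 7 * e1"
    using norm_diff[of "E - y\<^sup>\<dagger> * y" "y\<^sup>\<dagger> * y"] norm_diff[of E "y\<^sup>\<dagger> * y"] tyy E(1) by simp
  have "(t k)\<^sup>2 * (t k)\<^sup>2 = (t (k * k))\<^sup>2" using k(1) by (simp add: norm_square_hermitian power2_eq_square)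
  also have "\<dots> = t ((k * k) * (k * k))"
    using k(1) by (subst norm_square_hermitian[symmetric]) auto
  also have "\<dots> \<le> t (k * k * k) * t k" using norm_mult_le[of "k * k * k" k] by (simp add: mult.assoc)
  also have "\<dots> \<le> 7 * e1 * t k" using k3 by (intro mult_right_mono) auto
  also have "\<dots> = 7 * e * (t k)\<^sup>2" by (simp add: e1_def power2_eq_square)
  finally have "(t k)\<^sup>2 * (t k)\<^sup>2 \<le> 7 * e * (t k)\<^sup>2" .
  then have "(t k)\<^sup>2 \<le> 7 * e"
    using e by (cases "t k = 0") (simp_all only: mult_le_cancel_right, simp_all add: less_le)
  also have "\<dots> < \<delta>\<^sup>2" using \<delta> by (simp add: e_def)
  finally have "t k < \<delta>" using \<delta> by (simp add: power_less_imp_less_base)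
  then show "\<exists>k'. pos k' \<and> t (x\<^sup>\<dagger> * x - k') < \<delta>"
    using l(1) norm_diff_commute[of h l] by (auto simp: k_def h_def)
qed simp

lemma pos_conj:
  assumes "pos h" shows "pos (a\<^sup>\<dagger> * h * a)"
proof (rule pos_closed)
  show "(a\<^sup>\<dagger> * h * a)\<^sup>\<dagger> = a\<^sup>\<dagger> * h * a" using pos_hermitian[OF assms] by (simp add: mult.assoc)
  fix d :: real assume d: "d > 0"
  define d' where "d' = d / (t a * t a + 1)"
  have ta: "t a * t a + 1 > 0" by (simp add: add_nonneg_pos)
  have d': "d' > 0" using d ta by (simp add: d'_def)
  obtain l where l: "pos l" "t (l * l - h) < d'" by (rule pos_approx_square[OF assms d'])
  have "pos ((l * a)\<^sup>\<dagger> * (l * a))" by (rule pos_adj_mult)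
  then have "pos (a\<^sup>\<dagger> * (l * l) * a)" using pos_hermitian[OF l(1)] by (simp add: mult.assoc)
  moreover have "a\<^sup>\<dagger> * h * a - a\<^sup>\<dagger> * (l * l) * a = a\<^sup>\<dagger> * (h - l * l) * a" by (simp add: algebra_simps)
  moreover have "t (a\<^sup>\<dagger> * (h - l * l) * a) < d"
  proof -
    have "t (a\<^sup>\<dagger> * (h - l * l) * a) \<le> t a * t (h - l * l) * t a"
      using norm_mult_le[of "a\<^sup>\<dagger> * (h - l * l)" a]
        mult_right_mono[OF norm_mult_le[of "a\<^sup>\<dagger>" "h - l * l"] nonneg[of a]] by simp
    also have "\<dots> = t a * t a * t (l * l - h)" by (simp add: norm_diff_commute[of h])
    also have "\<dots> \<le> t a * t a * d'" using l(2) by (intro mult_left_mono) auto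
    also have "\<dots> < (t a * t a + 1) * d'" using d' by simp
    also have "\<dots> = d" using ta by (simp add: d'_def)
    finally show ?thesis .
  qed
  ultimately show "\<exists>k'. pos k' \<and> t (a\<^sup>\<dagger> * h * a - k') < d" by metis
qed

lemma pos_sum_adj_mult: "pos (\<Sum>i\<in>I. (f i)\<^sup>\<dagger> * f i)"
  by (induction I rule: infinite_finite_induct)
    (use pos_real_scalar[of 0] in \<open>auto intro: pos_add pos_adj_mult\<close>)

text \<open>A single summand lies below the whole sum, so its norm is at most that of the sum.\<close>

lemma norm_sum_adj_mult_null:
  assumes "finite I" "t (\<Sum>i\<in>I. (f i)\<^sup>\<dagger> * f i) = 0" "j \<in> I"
  shows "t (f j) = 0"
proof -
  have split: "(\<Sum>i\<in>I. (f i)\<^sup>\<dagger> * f i) = (f j)\<^sup>\<dagger> * f j + (\<Sum>i\<in>I - {j}. (f i)\<^sup>\<dagger> * f i)"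
    using assms by (simp add: sum.remove)
  have "pos (\<langle>0\<rangle> - (\<Sum>i\<in>I. (f i)\<^sup>\<dagger> * f i))"
    using assms by (intro pos_scalar_minus) (auto simp: adj_sum)
  from pos_add[OF this pos_sum_adj_mult[of f "I - {j}"]]
  have "pos (\<langle>0\<rangle> - (f j)\<^sup>\<dagger> * f j)" by (simp add: split)
  from pos_norm_mono_scalar[OF pos_adj_mult this] show ?thesis
    using cstar[of "f j"] nonneg by (simp add: antisym_conv)
qed

section \<open>The Cauchy-Schwarz inequality for pairs\<close>

text \<open>Let \<open>a\<close> be the inner product of \<open>v\<close> and \<open>w\<close>, and let \<open>N\<close> be larger than the norm of \<open>V\<close>, the inner product
  of \<open>v\<close> with itself. Positivity of the square of \<open>v a - N w\<close> together with \<open>a\<^sup>\<dagger> * V * a \<le> N a\<^sup>\<dagger> * a\<close> yields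
  \<open>a\<^sup>\<dagger> * a \<le> N W\<close>.\<close>

lemma cauchy_schwarz:
  "(t (v1\<^sup>\<dagger> * w1 + v2\<^sup>\<dagger> * w2))\<^sup>2 \<le> t (v1\<^sup>\<dagger> * v1 + v2\<^sup>\<dagger> * v2) * t (w1\<^sup>\<dagger> * w1 + w2\<^sup>\<dagger> * w2)"
proof -
  define a where "a = v1\<^sup>\<dagger> * w1 + v2\<^sup>\<dagger> * w2"
  define V where "V = v1\<^sup>\<dagger> * v1 + v2\<^sup>\<dagger> * v2"
  define W where "W = w1\<^sup>\<dagger> * w1 + w2\<^sup>\<dagger> * w2"
  have ah: "a\<^sup>\<dagger> = w1\<^sup>\<dagger> * v1 + w2\<^sup>\<dagger> * v2" by (simp add: a_def)
  have V: "V\<^sup>\<dagger> = V" and W: "W\<^sup>\<dagger> = W" by (auto simp: V_def W_def)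
  have key: "(t a)\<^sup>2 \<le> N * t W" if N: "N > t V" for N
  proof -
    have N0: "N > 0" using N nonneg[of V] by linarith
    let ?x = "v1 * a - of_real N *\<^sub>C w1" and ?y = "v2 * a - of_real N *\<^sub>C w2"
    have "pos (?x\<^sup>\<dagger> * ?x + ?y\<^sup>\<dagger> * ?y)" by (intro pos_add pos_adj_mult)
    moreover have "pos (a\<^sup>\<dagger> * (\<langle>N\<rangle> - V) * a)" using N V by (intro pos_conj pos_scalar_minus) auto
    ultimately have p: "pos ((?x\<^sup>\<dagger> * ?x + ?y\<^sup>\<dagger> * ?y) + a\<^sup>\<dagger> * (\<langle>N\<rangle> - V) * a)" by (rule pos_add)
    have e1: "?x\<^sup>\<dagger> * ?x + ?y\<^sup>\<dagger> * ?y =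
        a\<^sup>\<dagger> * V * a - of_real N *\<^sub>C (a\<^sup>\<dagger> * (v1\<^sup>\<dagger> * w1 + v2\<^sup>\<dagger> * w2))
        - of_real N *\<^sub>C ((w1\<^sup>\<dagger> * v1 + w2\<^sup>\<dagger> * v2) * a) + of_real (N * N) *\<^sub>C W"
      by (simp add: V_def W_def algebra_simps scl_algebra)
    have e2: "a\<^sup>\<dagger> * (\<langle>N\<rangle> - V) * a = of_real N *\<^sub>C (a\<^sup>\<dagger> * a) - a\<^sup>\<dagger> * V * a"
      by (simp add: algebra_simps)
    have "pos (of_real (N * N) *\<^sub>C W - of_real N *\<^sub>C (a\<^sup>\<dagger> * a))"
      using p unfolding e1 e2 a_def[symmetric] ah[symmetric] by (simp add: algebra_simps)
    from pos_scl[OF this, of "1 / N"] have "pos (of_real N *\<^sub>C W - a\<^sup>\<dagger> * a)"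
      using N0 by (simp add: scl_diff_right)
    moreover have "pos (of_real N *\<^sub>C (\<langle>t W\<rangle> - W))"
      using N0 W by (intro pos_scl pos_scalar_minus) auto
    ultimately have "pos ((of_real N *\<^sub>C W - a\<^sup>\<dagger> * a) + of_real N *\<^sub>C (\<langle>t W\<rangle> - W))" by (rule pos_add)
    then have "pos (\<langle>N * t W\<rangle> - a\<^sup>\<dagger> * a)" by (simp add: scl_diff_right)
    then have "t (a\<^sup>\<dagger> * a) \<le> N * t W" using N0 by (intro pos_norm_mono_scalar pos_adj_mult) auto
    then show ?thesis by (simp add: cstar)
  qed
  have "(t a)\<^sup>2 \<le> t V * t W + e" if e: "e > 0" for e
  proof -
    have "(t a)\<^sup>2 \<le> (t V + e / (t W + 1)) * t W" using e by (intro key) (simp add: add_nonneg_pos)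
    also have "\<dots> = t V * t W + e * (t W / (t W + 1))" by (simp add: algebra_simps)
    also have "e * (t W / (t W + 1)) \<le> e * 1"
      using e by (intro mult_left_mono) (auto simp: divide_le_eq_1 add_nonneg_pos)
    finally show ?thesis by simp
  qed
  then show ?thesis unfolding a_def V_def W_def by (rule field_le_epsilon)
qed

end

section \<open>Noncommutative polynomials and their evaluation\<close>

lemma letters_zero [simp]: "letters 0 = []"
  by (simp add: zero_fword_def)

lemma ncpoly_sum_monomials: "x = (\<Sum>w\<in>Poly_Mapping.keys x. Poly_Mapping.single w (Poly_Mapping.lookup x w))"
  for x :: "'g ncpoly"
proof (rule poly_mapping_eqI)
  fix v
  have "(\<Sum>w\<in>Poly_Mapping.keys x. Poly_Mapping.lookup (Poly_Mapping.single w (Poly_Mapping.lookup x w)) v)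
      = (\<Sum>w\<in>Poly_Mapping.keys x. if v = w then Poly_Mapping.lookup x w else 0)"
    by (intro sum.cong) (auto simp: lookup_single when_def)
  also have "\<dots> = Poly_Mapping.lookup x v"
    by (simp add: in_keys_iff)
  finally show "Poly_Mapping.lookup x v = Poly_Mapping.lookup
      (\<Sum>w\<in>Poly_Mapping.keys x. Poly_Mapping.single w (Poly_Mapping.lookup x w)) v"
    by (simp add: lookup_sum)
qed

lemma ncpoly_induct [case_names monomial add]:
  fixes x :: "'g ncpoly"
  assumes "\<And>w c. P (Poly_Mapping.single w c)" "\<And>x y. P x \<Longrightarrow> P y \<Longrightarrow> P (x + y)"
  shows "P x"
proof -
  have "P (\<Sum>w\<in>W. Poly_Mapping.single w (Poly_Mapping.lookup x w))" if "finite W" for W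
    using that
  proof (induction W)
    case empty
    show ?case using assms(1)[of undefined 0] by simp
  qed (simp add: assms)
  from this[of "Poly_Mapping.keys x"] show ?thesis using ncpoly_sum_monomials[of x] by simp
qed

lemma poly_star_single [simp]:
  "poly_star (Poly_Mapping.single w c) = Poly_Mapping.single (word_adj w) (cnj c)"
  by (cases "c = 0") (simp_all add: poly_star_def)

lemma poly_star_add: "poly_star (x + y) = poly_star x + poly_star y"
  unfolding poly_star_def by (rule setsum_keys_plus_distrib) (simp_all add: single_add)

lemma letter_adj_letter_adj [simp]: "letter_adj (letter_adj a) = a"
  by (cases a) auto

lemma word_adj_word_adj [simp]: "word_adj (word_adj w) = w"
  by (simp add: word_adj_def rev_map comp_def)

lemma word_adj_plus: "word_adj (v + w) = word_adj w + word_adj v"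
  by (simp add: word_adj_def plus_fword_def)

lemma word_adj_zero [simp]: "word_adj 0 = 0"
  by (simp add: word_adj_def zero_fword_def)

lemma single_zero_central:
  "x * Poly_Mapping.single 0 c = Poly_Mapping.single 0 c * (x :: 'g ncpoly)"
  by (induction x rule: ncpoly_induct) (simp_all add: mult_single distrib_left distrib_right mult.commute)

interpretation free: star_algebra poly_scale poly_star
proof
  fix x y :: "'g ncpoly" and c d
  show "poly_scale c (x + y) = poly_scale c x + poly_scale c y"
    by (simp add: poly_scale_def distrib_left)
  show "poly_scale (c + d) x = poly_scale c x + poly_scale d x"
    by (simp add: poly_scale_def single_add distrib_right)
  show "poly_scale c (poly_scale d x) = poly_scale (c * d) x"
    by (simp add: poly_scale_def mult_single flip: mult.assoc)
  show "poly_scale 1 x = x" by (simp add: poly_scale_def)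
  show "poly_scale c x * y = poly_scale c (x * y)" by (simp add: poly_scale_def mult.assoc)
  show "x * poly_scale c y = poly_scale c (x * y)"
    by (metis poly_scale_def mult.assoc single_zero_central)
  show "poly_star (poly_star x) = x"
    by (induction x rule: ncpoly_induct) (simp_all add: poly_star_add)
  show "poly_star (x + y) = poly_star x + poly_star y" by (rule poly_star_add)
  show *: "poly_star (x * y) = poly_star y * poly_star x" for x y :: "'g ncpoly"
  proof (induction x rule: ncpoly_induct)
    case (monomial w c)
    show ?case
      by (induction y rule: ncpoly_induct)
        (simp_all add: poly_star_add distrib_left distrib_right mult_single word_adj_plus mult.commute)
  qed (simp add: poly_star_add distrib_left distrib_right)
  show "poly_star (poly_scale c x) = poly_scale (cnj c) (poly_star x)"
    unfolding poly_scale_def by (simp add: * single_zero_central)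
qed

context star_algebra
begin

fun letter_eval :: "('g \<Rightarrow> 'a) \<Rightarrow> 'g letter \<Rightarrow> 'a" where
  "letter_eval f (Gen g) = f g"
| "letter_eval f (Adj g) = (f g)\<^sup>\<dagger>"

definition word_eval :: "('g \<Rightarrow> 'a) \<Rightarrow> 'g fword \<Rightarrow> 'a" where
  "word_eval f w = prod_list (map (letter_eval f) (letters w))"

definition poly_eval :: "('g \<Rightarrow> 'a) \<Rightarrow> 'g ncpoly \<Rightarrow> 'a" where
  "poly_eval f x = (\<Sum>w\<in>Poly_Mapping.keys x. Poly_Mapping.lookup x w *\<^sub>C word_eval f w)"

lemma word_eval_plus: "word_eval f (v + w) = word_eval f v * word_eval f w"
  by (simp add: word_eval_def plus_fword_def)

lemma letter_eval_adj: "letter_eval f (letter_adj a) = (letter_eval f a)\<^sup>\<dagger>"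
  by (cases a) auto

lemma prod_list_adj: "(prod_list xs)\<^sup>\<dagger> = prod_list (rev (map adj xs))"
  by (induction xs) simp_all

lemma word_eval_adj: "word_eval f (word_adj w) = (word_eval f w)\<^sup>\<dagger>"
  by (simp add: word_eval_def word_adj_def prod_list_adj rev_map comp_def letter_eval_adj)

lemma poly_eval_single: "poly_eval f (Poly_Mapping.single w c) = c *\<^sub>C word_eval f w"
  by (cases "c = 0") (simp_all add: poly_eval_def)

lemma poly_eval_add: "poly_eval f (x + y) = poly_eval f x + poly_eval f y"
  unfolding poly_eval_def by (rule setsum_keys_plus_distrib) (simp_all add: scl_add_left)

lemma poly_eval_zero [simp]: "poly_eval f 0 = 0"
  by (simp add: poly_eval_def)

lemma poly_eval_minus: "poly_eval f (- x) = - poly_eval f x"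
  by (rule minus_unique[symmetric]) (simp flip: poly_eval_add)

lemma poly_eval_diff: "poly_eval f (x - y) = poly_eval f x - poly_eval f y"
  using poly_eval_add[of f x "- y"] by (simp add: poly_eval_minus)

lemma poly_eval_sum: "poly_eval f (\<Sum>i\<in>I. h i) = (\<Sum>i\<in>I. poly_eval f (h i))"
  by (induction I rule: infinite_finite_induct) (simp_all add: poly_eval_add)

lemma poly_eval_mult: "poly_eval f (x * y) = poly_eval f x * poly_eval f y"
proof (induction x rule: ncpoly_induct)
  case (monomial w c)
  show ?case
    by (induction y rule: ncpoly_induct)
      (simp_all add: poly_eval_add distrib_left mult_single poly_eval_single word_eval_plus mult.commute)
qed (simp add: poly_eval_add distrib_right)

lemma poly_eval_one [simp]: "poly_eval f 1 = 1"
  using poly_eval_single[of f 0 1] by (simp add: word_eval_def)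

lemma poly_eval_scale: "poly_eval f (poly_scale c x) = c *\<^sub>C poly_eval f x"
  unfolding poly_scale_def poly_eval_mult poly_eval_single
  by (simp add: word_eval_def zero_fword_def)

lemma poly_eval_star: "poly_eval f (poly_star x) = (poly_eval f x)\<^sup>\<dagger>"
  by (induction x rule: ncpoly_induct)
    (simp_all add: poly_star_add poly_eval_add poly_eval_single word_eval_adj)

lemma poly_eval_gen [simp]: "poly_eval f (gen g) = f g"
  by (simp add: gen_def poly_eval_single word_eval_def)

lemmas poly_eval_simps = poly_eval_add poly_eval_minus poly_eval_diff poly_eval_sum
  poly_eval_mult poly_eval_scale poly_eval_star

end

lemma free_star_alg_single_iff:
  "Poly_Mapping.single w c \<in> free_star_alg G \<longleftrightarrow> c = 0 \<or> set (letters w) \<subseteq> Gen ` G \<union> Adj ` G"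
  by (auto simp: free_star_alg_def)

lemma free_star_alg_zero [simp]: "0 \<in> free_star_alg G"
  by (simp add: free_star_alg_def)

lemma free_star_alg_add [simp]: "x \<in> free_star_alg G \<Longrightarrow> y \<in> free_star_alg G \<Longrightarrow> x + y \<in> free_star_alg G"
  unfolding free_star_alg_def using keys_add[of x y] by blast

lemma free_star_alg_mult [simp]:
  assumes "x \<in> free_star_alg G" "y \<in> free_star_alg G" shows "x * y \<in> free_star_alg G"
  unfolding free_star_alg_def
proof (intro CollectI ballI)
  fix w assume "w \<in> Poly_Mapping.keys (x * y)"
  then obtain u v where "u \<in> Poly_Mapping.keys x" "v \<in> Poly_Mapping.keys y" "w = u + v"
    using keys_mult[of x y] by blast
  moreover from this have "set (letters w) = set (letters u) \<union> set (letters v)"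
    by (simp add: plus_fword_def)
  moreover have "set (letters u) \<subseteq> Gen ` G \<union> Adj ` G" "set (letters v) \<subseteq> Gen ` G \<union> Adj ` G"
    using assms calculation(1,2) unfolding free_star_alg_def by blast+
  ultimately show "set (letters w) \<subseteq> Gen ` G \<union> Adj ` G" by simp
qed

lemma free_star_alg_one [simp]: "1 \<in> free_star_alg G"
  by (simp add: free_star_alg_def zero_fword_def)

lemma free_star_alg_scale [simp]: "x \<in> free_star_alg G \<Longrightarrow> poly_scale c x \<in> free_star_alg G"
  by (simp add: poly_scale_def free_star_alg_single_iff zero_fword_def)

lemma free_star_alg_minus [simp]: "x \<in> free_star_alg G \<Longrightarrow> - x \<in> free_star_alg G"
  using free_star_alg_scale[of x G "-1"] by (simp add: free.scl_minus_left)

lemma free_star_alg_diff [simp]: "x \<in> free_star_alg G \<Longrightarrow> y \<in> free_star_alg G \<Longrightarrow> x - y \<in> free_star_alg G"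
  using free_star_alg_add[of x G "- y"] by simp

lemma free_star_alg_sum: "(\<And>i. i \<in> I \<Longrightarrow> f i \<in> free_star_alg G) \<Longrightarrow> (\<Sum>i\<in>I. f i) \<in> free_star_alg G"
  by (induction I rule: infinite_finite_induct) auto

lemma free_star_alg_gen [simp]: "g \<in> G \<Longrightarrow> gen g \<in> free_star_alg G"
  by (simp add: gen_def free_star_alg_single_iff)

lemma free_star_alg_star [simp]:
  assumes "x \<in> free_star_alg G" shows "poly_star x \<in> free_star_alg G"
  unfolding poly_star_def
proof (rule free_star_alg_sum)
  fix w assume w: "w \<in> Poly_Mapping.keys x"
  have "letter_adj a \<in> Gen ` G \<union> Adj ` G" if "a \<in> Gen ` G \<union> Adj ` G" for a
    using that by auto
  then show "Poly_Mapping.single (word_adj w) (cnj (Poly_Mapping.lookup x w)) \<in> free_star_alg G"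
    using assms w by (fastforce simp: free_star_alg_single_iff word_adj_def free_star_alg_def)
qed

text \<open>Adjoints can be pushed to the letters, so the cases are those of a free algebra on the letters and
  their adjoints. Statements about *-homomorphisms reduce in this way to the generators.\<close>

lemma free_star_alg_induct [consumes 1, case_names scalar gen star_gen add mult]:
  assumes x: "x \<in> free_star_alg G"
    and scalar: "\<And>c. P (poly_scale c 1)"
    and gen: "\<And>g. g \<in> G \<Longrightarrow> P (gen g)"
    and star_gen: "\<And>g. g \<in> G \<Longrightarrow> P (poly_star (gen g))"
    and add: "\<And>x y. \<lbrakk>x \<in> free_star_alg G; y \<in> free_star_alg G; P x; P y\<rbrakk> \<Longrightarrow> P (x + y)"
    and mult: "\<And>x y. \<lbrakk>x \<in> free_star_alg G; y \<in> free_star_alg G; P x; P y\<rbrakk> \<Longrightarrow> P (x * y)"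
  shows "P x"
proof -
  have letter: "P (Poly_Mapping.single (Word [a]) 1)" if "a \<in> Gen ` G \<union> Adj ` G" for a
    using that gen star_gen by (auto simp: gen_def word_adj_def)
  have word: "P (Poly_Mapping.single (Word as) c)" if "set as \<subseteq> Gen ` G \<union> Adj ` G" for as c
    using that
  proof (induction as)
    case Nil
    then show ?case using scalar[of c] by (simp add: poly_scale_def zero_fword_def)
  next
    case (Cons a as)
    have "Poly_Mapping.single (Word (a # as)) c
        = Poly_Mapping.single (Word [a]) 1 * Poly_Mapping.single (Word as) c"
      by (simp add: mult_single plus_fword_def)
    with Cons show ?case by (auto simp: free_star_alg_single_iff intro!: mult letter)
  qed
  have mono: "P (Poly_Mapping.single w c)" if "set (letters w) \<subseteq> Gen ` G \<union> Adj ` G" for w c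
    using word[OF that] by simp
  have "P (\<Sum>w\<in>W. Poly_Mapping.single w (Poly_Mapping.lookup x w)) \<and>
      (\<Sum>w\<in>W. Poly_Mapping.single w (Poly_Mapping.lookup x w)) \<in> free_star_alg G"
    if "finite W" "W \<subseteq> Poly_Mapping.keys x" for W
    using that
  proof (induction W)
    case empty
    show ?case using scalar[of 0] by simp
  next
    case (insert w W)
    then have w: "set (letters w) \<subseteq> Gen ` G \<union> Adj ` G" using x by (auto simp: free_star_alg_def)
    with insert mono[OF w] show ?case by (auto simp: free_star_alg_single_iff intro!: add)
  qed
  from this[of "Poly_Mapping.keys x"] show ?thesis using ncpoly_sum_monomials[of x] by simp
qed

lemma (in star_algebra) poly_eval_cong:
  assumes "x \<in> free_star_alg G" "\<And>g. g \<in> G \<Longrightarrow> f g = f' g"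
  shows "poly_eval f x = poly_eval f' x"
  using assms(1)
  by (induction x rule: free_star_alg_induct) (simp_all add: poly_eval_simps assms(2))

lemma free_poly_eval_closed:
  assumes "x \<in> free_star_alg G" "\<And>g. g \<in> G \<Longrightarrow> f g \<in> free_star_alg H"
  shows "free.poly_eval f x \<in> free_star_alg H"
  using assms(1)
  by (induction x rule: free_star_alg_induct) (simp_all add: free.poly_eval_simps assms(2))

lemma free_poly_eval_gen: "free.poly_eval gen x = x"
proof -
  have "x \<in> free_star_alg UNIV"
    by (auto simp: free_star_alg_def) (metis letter.exhaust rangeI)
  then show ?thesis
    by (induction x rule: free_star_alg_induct) (simp_all add: free.poly_eval_simps)
qed

text \<open>The retraction of the full free *-algebra onto the one on \<open>G\<close> that kills the other letters. Composed
  with it, a seminorm given on polynomials in \<open>G\<close> only becomes one on a whole type.\<close>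

definition restrict_gens :: "'g set \<Rightarrow> 'g ncpoly \<Rightarrow> 'g ncpoly" where
  "restrict_gens G = free.poly_eval (\<lambda>g. if g \<in> G then gen g else 0)"

lemma restrict_gens_in [simp]: "restrict_gens G x \<in> free_star_alg G"
proof -
  have "x \<in> free_star_alg UNIV"
    by (auto simp: free_star_alg_def) (metis letter.exhaust rangeI)
  then show ?thesis unfolding restrict_gens_def by (rule free_poly_eval_closed) simp
qed

lemma restrict_gens_id [simp]: "x \<in> free_star_alg G \<Longrightarrow> restrict_gens G x = x"
  unfolding restrict_gens_def
  by (subst free.poly_eval_cong[where f' = gen]) (auto simp: free_poly_eval_gen)

section \<open>Two by two matrices\<close>

datatype 'a mat2 = Mat2 (m11: 'a) (m12: 'a) (m21: 'a) (m22: 'a)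

instantiation mat2 :: (ring_1) ring_1
begin

definition zero_mat2 :: "'a mat2" where "0 = Mat2 0 0 0 0"
definition one_mat2 :: "'a mat2" where "1 = Mat2 1 0 0 1"
definition plus_mat2 :: "'a mat2 \<Rightarrow> 'a mat2 \<Rightarrow> 'a mat2" where
  "A + B = Mat2 (m11 A + m11 B) (m12 A + m12 B) (m21 A + m21 B) (m22 A + m22 B)"
definition minus_mat2 :: "'a mat2 \<Rightarrow> 'a mat2 \<Rightarrow> 'a mat2" where
  "A - B = Mat2 (m11 A - m11 B) (m12 A - m12 B) (m21 A - m21 B) (m22 A - m22 B)"
definition uminus_mat2 :: "'a mat2 \<Rightarrow> 'a mat2" where
  "- A = Mat2 (- m11 A) (- m12 A) (- m21 A) (- m22 A)"
definition times_mat2 :: "'a mat2 \<Rightarrow> 'a mat2 \<Rightarrow> 'a mat2" where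
  "A * B = Mat2 (m11 A * m11 B + m12 A * m21 B) (m11 A * m12 B + m12 A * m22 B)
                (m21 A * m11 B + m22 A * m21 B) (m21 A * m12 B + m22 A * m22 B)"

instance
  by standard (simp_all add: zero_mat2_def one_mat2_def plus_mat2_def minus_mat2_def
      uminus_mat2_def times_mat2_def algebra_simps)

end

lemmas mat2_simps = zero_mat2_def one_mat2_def plus_mat2_def minus_mat2_def uminus_mat2_def times_mat2_def

lemma mat2_sum: "(\<Sum>i\<in>I. Mat2 (a i) (b i) (c i) (d i))
    = Mat2 (\<Sum>i\<in>I. a i) (\<Sum>i\<in>I. b i) (\<Sum>i\<in>I. c i) (\<Sum>i\<in>I. d i)"
  for a :: "'i \<Rightarrow> 'a::ring_1"
  by (induction I rule: infinite_finite_induct) (simp_all add: mat2_simps)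

context star_algebra
begin

definition mat_scl :: "complex \<Rightarrow> 'a mat2 \<Rightarrow> 'a mat2" where
  "mat_scl c A = Mat2 (c *\<^sub>C m11 A) (c *\<^sub>C m12 A) (c *\<^sub>C m21 A) (c *\<^sub>C m22 A)"

definition mat_adj :: "'a mat2 \<Rightarrow> 'a mat2" where
  "mat_adj A = Mat2 ((m11 A)\<^sup>\<dagger>) ((m21 A)\<^sup>\<dagger>) ((m12 A)\<^sup>\<dagger>) ((m22 A)\<^sup>\<dagger>)"

lemma star_algebra_mat2: "star_algebra mat_scl mat_adj"
  by standard (simp_all add: mat_scl_def mat_adj_def mat2_simps scl_add_right scl_add_left add.commute)

end

context cstar_seminormed_algebra
begin

definition vec_norm :: "'a \<times> 'a \<Rightarrow> real" where
  "vec_norm v = sqrt (t ((fst v)\<^sup>\<dagger> * fst v + (snd v)\<^sup>\<dagger> * snd v))"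

definition mat_vec :: "'a mat2 \<Rightarrow> 'a \<times> 'a \<Rightarrow> 'a \<times> 'a" where
  "mat_vec A v = (m11 A * fst v + m12 A * snd v, m21 A * fst v + m22 A * snd v)"

text \<open>The operator norm on the pairs, written as the least Lipschitz constant, so that pairs of norm \<open>0\<close>
  cause no difficulty.\<close>

definition op_norm :: "'a mat2 \<Rightarrow> real" where
  "op_norm A = Inf {C. 0 \<le> C \<and> (\<forall>v. vec_norm (mat_vec A v) \<le> C * vec_norm v)}"

lemma vec_norm_nonneg [simp]: "0 \<le> vec_norm v"
  by (simp add: vec_norm_def)

lemma vec_norm_square: "(vec_norm v)\<^sup>2 = t ((fst v)\<^sup>\<dagger> * fst v + (snd v)\<^sup>\<dagger> * snd v)"
  by (simp add: vec_norm_def)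

lemma norm_inner_le: "t ((fst v)\<^sup>\<dagger> * fst w + (snd v)\<^sup>\<dagger> * snd w) \<le> vec_norm v * vec_norm w"
  using cauchy_schwarz[of "fst v" "fst w" "snd v" "snd w"]
  by (intro power2_le_imp_le[OF _ mult_nonneg_nonneg]) (simp_all add: power_mult_distrib vec_norm_square)

lemma vec_norm_add: "vec_norm (a + c, b + d) \<le> vec_norm (a, b) + vec_norm (c, d)"
proof (rule power2_le_imp_le)
  define x where "x = a\<^sup>\<dagger> * a + b\<^sup>\<dagger> * b"
  define y where "y = a\<^sup>\<dagger> * c + b\<^sup>\<dagger> * d"
  define z where "z = c\<^sup>\<dagger> * a + d\<^sup>\<dagger> * b"
  define w where "w = c\<^sup>\<dagger> * c + d\<^sup>\<dagger> * d"
  have "(a + c)\<^sup>\<dagger> * (a + c) + (b + d)\<^sup>\<dagger> * (b + d) = (x + y) + (z + w)"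
    unfolding x_def y_def z_def w_def by (simp add: distrib_left distrib_right)
  then have "(vec_norm (a + c, b + d))\<^sup>2 = t ((x + y) + (z + w))" by (simp add: vec_norm_square)
  also have "\<dots> \<le> t x + t y + (t z + t w)"
    using norm_add[of "x + y" "z + w"] norm_add[of x y] norm_add[of z w] by linarith
  finally have "(vec_norm (a + c, b + d))\<^sup>2 \<le> t x + t y + (t z + t w)" .
  moreover have "t x = (vec_norm (a, b))\<^sup>2" "t w = (vec_norm (c, d))\<^sup>2"
    by (simp_all add: vec_norm_square x_def w_def)
  moreover have "t y \<le> vec_norm (a, b) * vec_norm (c, d)" "t z \<le> vec_norm (a, b) * vec_norm (c, d)"
    using norm_inner_le[of "(a, b)" "(c, d)"] norm_inner_le[of "(c, d)" "(a, b)"]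
    by (simp_all add: y_def z_def mult.commute)
  ultimately show "(vec_norm (a + c, b + d))\<^sup>2 \<le> (vec_norm (a, b) + vec_norm (c, d))\<^sup>2"
    unfolding power2_sum by linarith
qed simp

lemma vec_norm_scl: "vec_norm (c *\<^sub>C a, c *\<^sub>C b) = cmod c * vec_norm (a, b)"
proof -
  have "(c *\<^sub>C a)\<^sup>\<dagger> * c *\<^sub>C a + (c *\<^sub>C b)\<^sup>\<dagger> * c *\<^sub>C b = (cnj c * c) *\<^sub>C (a\<^sup>\<dagger> * a + b\<^sup>\<dagger> * b)"
    by (simp add: scl_add_right mult.commute)
  moreover have "cmod (cnj c * c) = cmod c * cmod c" by (simp add: norm_mult)
  ultimately show ?thesis
    by (simp only: vec_norm_def fst_conv snd_conv norm_scl real_sqrt_mult) simp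
qed

lemma vec_norm_le_sum: "vec_norm (a, b) \<le> t a + t b"
proof (rule power2_le_imp_le)
  have "(vec_norm (a, b))\<^sup>2 \<le> (t a)\<^sup>2 + (t b)\<^sup>2"
    using norm_add[of "a\<^sup>\<dagger> * a" "b\<^sup>\<dagger> * b"] by (simp add: vec_norm_square cstar)
  also have "\<dots> \<le> (t a + t b)\<^sup>2" by (simp add: power2_sum)
  finally show "(vec_norm (a, b))\<^sup>2 \<le> (t a + t b)\<^sup>2" .
qed simp

lemma vec_norm_unit_le: "vec_norm (1, 0) \<le> 1" "vec_norm (0, 1) \<le> 1"
  using order_trans[OF vec_norm_le_sum[of 1 0]] order_trans[OF vec_norm_le_sum[of 0 1]] by simp_all

lemma norm_component_le: "t a \<le> vec_norm (a, b)" "t b \<le> vec_norm (a, b)"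
  using norm_inner_le[of "(1, 0)" "(a, b)"] norm_inner_le[of "(0, 1)" "(a, b)"]
    mult_right_mono[OF vec_norm_unit_le(1), of "vec_norm (a, b)"]
    mult_right_mono[OF vec_norm_unit_le(2), of "vec_norm (a, b)"] by simp_all

lemma mat_vec_bound:
  "vec_norm (mat_vec A v) \<le> (t (m11 A) + t (m12 A) + t (m21 A) + t (m22 A)) * vec_norm v"
proof -
  have le: "t (a * fst v) \<le> t a * vec_norm v" "t (a * snd v) \<le> t a * vec_norm v" for a
    using norm_mult_le[of a "fst v"] norm_mult_le[of a "snd v"]
      mult_left_mono[OF norm_component_le(1)[of "fst v" "snd v"] nonneg[of a]]
      mult_left_mono[OF norm_component_le(2)[of "snd v" "fst v"] nonneg[of a]] by simp_all
  have "vec_norm (mat_vec A v) \<le> t (m11 A * fst v + m12 A * snd v) + t (m21 A * fst v + m22 A * snd v)"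
    unfolding mat_vec_def by (rule vec_norm_le_sum)
  also have "\<dots> \<le> (t (m11 A * fst v) + t (m12 A * snd v)) + (t (m21 A * fst v) + t (m22 A * snd v))"
    by (intro add_mono norm_add)
  also have "\<dots> \<le> (t (m11 A) * vec_norm v + t (m12 A) * vec_norm v)
      + (t (m21 A) * vec_norm v + t (m22 A) * vec_norm v)"
    by (intro add_mono le)
  finally show ?thesis by (simp add: algebra_simps)
qed

lemma op_norm_set_nonempty:
  "{C. 0 \<le> C \<and> (\<forall>v. vec_norm (mat_vec A v) \<le> C * vec_norm v)} \<noteq> {}"
proof -
  have "0 \<le> t (m11 A) + t (m12 A) + t (m21 A) + t (m22 A)" by (intro add_nonneg_nonneg) simp_all
  then show ?thesis using mat_vec_bound[of A] by blast
qed

lemma op_norm_le: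
  assumes "0 \<le> C" "\<And>v. vec_norm (mat_vec A v) \<le> C * vec_norm v" shows "op_norm A \<le> C"
  unfolding op_norm_def using assms by (intro cInf_lower bdd_belowI[of _ 0]) auto

lemma op_norm_nonneg: "0 \<le> op_norm A"
  unfolding op_norm_def by (rule cInf_greatest[OF op_norm_set_nonempty]) simp

lemma op_norm_bound: "vec_norm (mat_vec A v) \<le> op_norm A * vec_norm v"
proof (cases "vec_norm v = 0")
  case True
  then show ?thesis using mat_vec_bound[of A v] by simp
next
  case False
  then have v: "vec_norm v > 0" using vec_norm_nonneg[of v] by linarith
  have "vec_norm (mat_vec A v) / vec_norm v \<le> op_norm A"
    unfolding op_norm_def
    by (rule cInf_greatest[OF op_norm_set_nonempty]) (use v in \<open>simp add: pos_divide_le_eq del: split_paired_All\<close>)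
  then show ?thesis using v by (simp add: pos_divide_le_eq)
qed

lemma op_norm_eq_zero:
  assumes "t (m11 A) = 0" "t (m12 A) = 0" "t (m21 A) = 0" "t (m22 A) = 0"
  shows "op_norm A = 0"
  using op_norm_le[of 0 A] op_norm_nonneg[of A] mat_vec_bound[of A] assms by simp

text \<open>The corner is seen by applying the matrix to the first unit vector. This is how the seminorm on
  the coefficients is recovered from the one on matrices.\<close>

lemma norm_m11_le_op_norm: "t (m11 A) \<le> op_norm A"
proof -
  have "t (m11 A) \<le> vec_norm (mat_vec A (1, 0))"
    using norm_component_le(1)[of "m11 A" "m21 A"] by (simp add: mat_vec_def)
  also have "\<dots> \<le> op_norm A * vec_norm (1, 0)" by (rule op_norm_bound)
  also have "\<dots> \<le> op_norm A * 1"
    by (intro mult_left_mono vec_norm_unit_le op_norm_nonneg)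
  finally show ?thesis by simp
qed

lemma mat_vec_mult: "mat_vec (A * B) v = mat_vec A (mat_vec B v)"
  by (simp add: mat_vec_def times_mat2_def algebra_simps)

lemma op_norm_mult: "op_norm (A * B) \<le> op_norm A * op_norm B"
proof (rule op_norm_le)
  fix v
  have "vec_norm (mat_vec (A * B) v) \<le> op_norm A * vec_norm (mat_vec B v)"
    unfolding mat_vec_mult by (rule op_norm_bound)
  also have "\<dots> \<le> op_norm A * (op_norm B * vec_norm v)"
    by (intro mult_left_mono op_norm_bound op_norm_nonneg)
  finally show "vec_norm (mat_vec (A * B) v) \<le> op_norm A * op_norm B * vec_norm v"
    by (simp add: mult.assoc)
qed (simp add: op_norm_nonneg)

lemma op_norm_add: "op_norm (A + B) \<le> op_norm A + op_norm B"
proof (rule op_norm_le)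
  fix v
  have "mat_vec (A + B) v = (fst (mat_vec A v) + fst (mat_vec B v), snd (mat_vec A v) + snd (mat_vec B v))"
    by (simp add: mat_vec_def plus_mat2_def algebra_simps)
  then have "vec_norm (mat_vec (A + B) v) \<le> vec_norm (mat_vec A v) + vec_norm (mat_vec B v)"
    using vec_norm_add[of "fst (mat_vec A v)" "fst (mat_vec B v)" "snd (mat_vec A v)" "snd (mat_vec B v)"] by simp
  also have "\<dots> \<le> op_norm A * vec_norm v + op_norm B * vec_norm v"
    by (intro add_mono op_norm_bound)
  finally show "vec_norm (mat_vec (A + B) v) \<le> (op_norm A + op_norm B) * vec_norm v"
    by (simp add: algebra_simps)
qed (simp add: op_norm_nonneg)

lemma op_norm_scl: "op_norm (mat_scl c A) = cmod c * op_norm A"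
proof -
  have eq: "vec_norm (mat_vec (mat_scl c A) v) = cmod c * vec_norm (mat_vec A v)" for c A v
    using vec_norm_scl by (simp add: mat_vec_def mat_scl_def flip: scl_add_right)
  have le: "op_norm (mat_scl c A) \<le> cmod c * op_norm A" for c A
    by (rule op_norm_le) (simp_all add: eq op_norm_nonneg mult.assoc mult_left_mono op_norm_bound)
  show ?thesis
  proof (cases "c = 0")
    case True
    then show ?thesis using le[of c A] op_norm_nonneg[of "mat_scl c A"] by simp
  next
    case False
    have "op_norm A = op_norm (mat_scl (inverse c) (mat_scl c A))"
      using False by (simp add: mat_scl_def)
    also have "\<dots> \<le> cmod (inverse c) * op_norm (mat_scl c A)" by (rule le)
    finally have "op_norm A \<le> op_norm (mat_scl c A) / cmod c"
      by (simp add: norm_inverse field_class.field_divide_inverse mult.commute)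
    then have "cmod c * op_norm A \<le> op_norm (mat_scl c A)"
      using False by (simp add: pos_le_divide_eq mult.commute)
    then show ?thesis using le[of c A] by simp
  qed
qed

lemma inner_adj:
  "(fst (mat_vec A v))\<^sup>\<dagger> * fst w + (snd (mat_vec A v))\<^sup>\<dagger> * snd w
   = (fst v)\<^sup>\<dagger> * fst (mat_vec (mat_adj A) w) + (snd v)\<^sup>\<dagger> * snd (mat_vec (mat_adj A) w)"
  by (simp add: mat_vec_def mat_adj_def algebra_simps)

lemma vec_norm_mat_vec_square:
  "(vec_norm (mat_vec A v))\<^sup>2 \<le> vec_norm v * vec_norm (mat_vec (mat_adj A * A) v)"
  unfolding vec_norm_square inner_adj mat_vec_mult by (rule norm_inner_le)

lemma mat_adj_adj [simp]: "mat_adj (mat_adj A) = A"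
  by (simp add: mat_adj_def)

text \<open>As for operators on a Hilbert space: for \<open>u = A\<^sup>* v\<close> the square of the norm of \<open>u\<close> is the inner product of \<open>v\<close>
  with \<open>A u\<close>.\<close>

lemma op_norm_adj_le: "op_norm (mat_adj A) \<le> op_norm A"
proof (rule op_norm_le[OF op_norm_nonneg])
  fix v
  let ?u = "mat_vec (mat_adj A) v"
  have "(vec_norm ?u)\<^sup>2 \<le> vec_norm v * vec_norm (mat_vec A ?u)"
    using vec_norm_mat_vec_square[of "mat_adj A" v] by (simp add: mat_vec_mult)
  also have "\<dots> \<le> vec_norm v * (op_norm A * vec_norm ?u)"
    by (intro mult_left_mono op_norm_bound) simp
  finally have "vec_norm ?u * vec_norm ?u \<le> (op_norm A * vec_norm v) * vec_norm ?u"
    by (simp add: power2_eq_square mult_ac)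
  then show "vec_norm ?u \<le> op_norm A * vec_norm v"
    by (cases "vec_norm ?u = 0")
      (simp_all add: op_norm_nonneg mult_le_cancel_right less_le)
qed

lemma op_norm_cstar: "op_norm (mat_adj A * A) = (op_norm A)\<^sup>2"
proof (rule antisym)
  show "op_norm (mat_adj A * A) \<le> (op_norm A)\<^sup>2"
    using op_norm_mult[of "mat_adj A" A] mult_right_mono[OF op_norm_adj_le[of A] op_norm_nonneg[of A]]
    by (simp add: power2_eq_square)
  have "op_norm A \<le> sqrt (op_norm (mat_adj A * A))"
  proof (rule op_norm_le)
    fix v
    have "(vec_norm (mat_vec A v))\<^sup>2 \<le> vec_norm v * (op_norm (mat_adj A * A) * vec_norm v)"
      by (rule order_trans[OF vec_norm_mat_vec_square mult_left_mono[OF op_norm_bound]]) simp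
    also have "\<dots> = (sqrt (op_norm (mat_adj A * A)) * vec_norm v)\<^sup>2"
      by (simp add: power_mult_distrib op_norm_nonneg power2_eq_square[of "vec_norm v"])
    finally show "vec_norm (mat_vec A v) \<le> sqrt (op_norm (mat_adj A * A)) * vec_norm v"
      by (rule power2_le_imp_le) (simp add: op_norm_nonneg)
  qed (simp add: op_norm_nonneg)
  then have "(op_norm A)\<^sup>2 \<le> (sqrt (op_norm (mat_adj A * A)))\<^sup>2"
    by (intro power_mono op_norm_nonneg)
  then show "(op_norm A)\<^sup>2 \<le> op_norm (mat_adj A * A)" by (simp add: op_norm_nonneg)
qed

theorem cstar_seminormed_algebra_mat2: "cstar_seminormed_algebra mat_scl mat_adj op_norm"
proof -
  interpret M: star_algebra mat_scl mat_adj by (rule star_algebra_mat2)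
  show ?thesis
    by standard (simp_all add: op_norm_nonneg op_norm_cstar op_norm_scl op_norm_add op_norm_mult)
qed

end

section \<open>The universal seminorm\<close>

lemma restrict_gens_simps:
  "restrict_gens G (x + y) = restrict_gens G x + restrict_gens G y"
  "restrict_gens G (x * y) = restrict_gens G x * restrict_gens G y"
  "restrict_gens G (poly_scale c x) = poly_scale c (restrict_gens G x)"
  "restrict_gens G (poly_star x) = poly_star (restrict_gens G x)"
  by (simp_all add: restrict_gens_def free.poly_eval_simps)

text \<open>Makes the theory of C*-seminormed algebras available for the seminorms on polynomials in \<open>G\<close>.\<close>

lemma cstar_seminorm_extend:
  assumes "cstar_seminorm G R s"
  shows "cstar_seminormed_algebra poly_scale poly_star (\<lambda>x. s (restrict_gens G x))"
  using assms unfolding cstar_seminorm_def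
  by unfold_locales (simp_all add: restrict_gens_simps)

text \<open>Elements of any C*-seminormed algebra that satisfy the relations up to null elements produce a
  seminorm that competes in the supremum defining the universal one.\<close>

lemma (in cstar_seminormed_algebra) cstar_seminorm_pullback:
  assumes "\<And>r. r \<in> R \<Longrightarrow> t (poly_eval f r) = 0"
  shows "cstar_seminorm G R (\<lambda>x. t (poly_eval f x))"
  unfolding cstar_seminorm_def using assms
  by (auto simp: poly_eval_simps cstar norm_add norm_mult_le)

text \<open>The bound on the generators keeps the supremum over all seminorms finite. The constant \<open>1\<close> is the one
  for partial isometries.\<close>

locale bounded_presentation =
  fixes G :: "'g set" and R :: "'g ncpoly set"
  assumes gens_bounded: "g \<in> G \<Longrightarrow> cstar_seminorm G R s \<Longrightarrow> s (gen g) \<le> 1"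
begin

abbreviation "F \<equiv> free_star_alg G"
abbreviation "N \<equiv> univ_norm G R"

lemma seminorm_bounded:
  assumes "x \<in> F" shows "\<exists>C. \<forall>s. cstar_seminorm G R s \<longrightarrow> s x \<le> C"
  using assms
proof (induction x rule: free_star_alg_induct)
  case (scalar c)
  have "s (poly_scale c 1) \<le> cmod c" if s: "cstar_seminorm G R s" for s
  proof -
    interpret cstar_seminormed_algebra poly_scale poly_star "\<lambda>x. s (restrict_gens G x)"
      by (rule cstar_seminorm_extend[OF s])
    show ?thesis using norm_scl[of c 1] mult_left_mono[OF norm_one_le, of "cmod c"] by simp
  qed
  then show ?case by blast
next
  case (gen g)
  then show ?case using gens_bounded by blast
next
  case (star_gen g)
  have "s (poly_star (gen g)) \<le> 1" if s: "cstar_seminorm G R s" for s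
  proof -
    interpret cstar_seminormed_algebra poly_scale poly_star "\<lambda>x. s (restrict_gens G x)"
      by (rule cstar_seminorm_extend[OF s])
    show ?thesis using norm_adj[of "gen g"] gens_bounded[OF star_gen s] star_gen by simp
  qed
  then show ?case by blast
next
  case (add x y)
  then obtain C D where CD: "\<forall>s. cstar_seminorm G R s \<longrightarrow> s x \<le> C" "\<forall>s. cstar_seminorm G R s \<longrightarrow> s y \<le> D"
    by blast
  have "s (x + y) \<le> C + D" if s: "cstar_seminorm G R s" for s
  proof -
    have "s (x + y) \<le> s x + s y" using s add(1,2) by (simp add: cstar_seminorm_def)
    with CD s show ?thesis by (meson add_mono order_trans)
  qed
  then show ?case by blast
next
  case (mult x y)
  then obtain C D where CD: "\<forall>s. cstar_seminorm G R s \<longrightarrow> s x \<le> C" "\<forall>s. cstar_seminorm G R s \<longrightarrow> s y \<le> D"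
    by blast
  have "s (x * y) \<le> \<bar>C\<bar> * \<bar>D\<bar>" if s: "cstar_seminorm G R s" for s
  proof -
    have "s (x * y) \<le> s x * s y" "0 \<le> s x" "0 \<le> s y" using s mult(1,2) by (auto simp: cstar_seminorm_def)
    moreover have "s x * s y \<le> \<bar>C\<bar> * \<bar>D\<bar>"
      using CD s calculation by (intro mult_mono) (auto intro: order_trans[OF _ abs_ge_self])
    ultimately show ?thesis by linarith
  qed
  then show ?case by blast
qed

lemma zero_seminorm: "cstar_seminorm G R (\<lambda>_. 0)"
  by (simp add: cstar_seminorm_def)

lemma univ_norm_upper: "x \<in> F \<Longrightarrow> cstar_seminorm G R s \<Longrightarrow> s x \<le> N x"
  unfolding univ_norm_def using seminorm_bounded[of x]
  by (intro cSup_upper) (auto simp: bdd_above_def)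

lemma univ_norm_least: "(\<And>s. cstar_seminorm G R s \<Longrightarrow> s x \<le> C) \<Longrightarrow> N x \<le> C"
  unfolding univ_norm_def using zero_seminorm by (intro cSup_least) auto

lemma univ_norm_nonneg: "x \<in> F \<Longrightarrow> 0 \<le> N x"
  using univ_norm_upper[OF _ zero_seminorm] by simp

text \<open>The axioms pass to the supremum, the C*-identity because squaring is increasing on nonnegative
  numbers.\<close>

theorem cstar_seminorm_univ_norm: "cstar_seminorm G R N"
  unfolding cstar_seminorm_def
proof (intro conjI ballI allI)
  fix x assume x: "x \<in> F"
  show "0 \<le> N x" using x by (rule univ_norm_nonneg)
  show "N (poly_star x * x) = (N x)\<^sup>2"
  proof (rule antisym)
    show "N (poly_star x * x) \<le> (N x)\<^sup>2"
    proof (rule univ_norm_least)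
      fix s assume s: "cstar_seminorm G R s"
      have "s (poly_star x * x) = (s x)\<^sup>2" "0 \<le> s x" using s x by (auto simp: cstar_seminorm_def)
      then show "s (poly_star x * x) \<le> (N x)\<^sup>2"
        using univ_norm_upper[OF x s] by (simp add: power_mono)
    qed
    have xx: "poly_star x * x \<in> F" using x by simp
    have "N x \<le> sqrt (N (poly_star x * x))"
    proof (rule univ_norm_least)
      fix s assume s: "cstar_seminorm G R s"
      have "(s x)\<^sup>2 \<le> N (poly_star x * x)"
        using univ_norm_upper[OF xx s] s x by (simp add: cstar_seminorm_def)
      then show "s x \<le> sqrt (N (poly_star x * x))" by (rule real_le_rsqrt)
    qed
    then show "(N x)\<^sup>2 \<le> N (poly_star x * x)"
      using univ_norm_nonneg[OF x] univ_norm_nonneg[OF xx] by (metis power_mono real_sqrt_pow2)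
  qed
  have scale_le: "N (poly_scale c y) \<le> cmod c * N y" if "y \<in> F" for c y
  proof (rule univ_norm_least)
    fix s assume s: "cstar_seminorm G R s"
    have "s (poly_scale c y) = cmod c * s y" using s that by (simp add: cstar_seminorm_def)
    then show "s (poly_scale c y) \<le> cmod c * N y"
      using univ_norm_upper[OF that s] by (simp add: mult_left_mono)
  qed
  show "N (poly_scale c x) = cmod c * N x" for c
  proof (rule antisym[OF scale_le[OF x]], cases "c = 0")
    case True
    then show "cmod c * N x \<le> N (poly_scale c x)" by (simp add: univ_norm_nonneg)
  next
    case False
    have "N x = N (poly_scale (inverse c) (poly_scale c x))" using False by simp
    also have "\<dots> \<le> cmod (inverse c) * N (poly_scale c x)" using x by (intro scale_le) simp
    also have "\<dots> = N (poly_scale c x) / cmod c"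
      using False by (simp add: norm_inverse field_class.field_divide_inverse mult.commute)
    finally show "cmod c * N x \<le> N (poly_scale c x)"
      using False by (simp add: pos_le_divide_eq mult.commute)
  qed
  fix y assume y: "y \<in> F"
  show "N (x + y) \<le> N x + N y"
  proof (rule univ_norm_least)
    fix s assume s: "cstar_seminorm G R s"
    have "s (x + y) \<le> s x + s y" using s x y by (simp add: cstar_seminorm_def)
    then show "s (x + y) \<le> N x + N y"
      using univ_norm_upper[OF x s] univ_norm_upper[OF y s] by linarith
  qed
  show "N (x * y) \<le> N x * N y"
  proof (rule univ_norm_least)
    fix s assume s: "cstar_seminorm G R s"
    have "s (x * y) \<le> s x * s y" "0 \<le> s y" using s x y by (auto simp: cstar_seminorm_def)
    moreover have "s x * s y \<le> N x * N y"
      using calculation univ_norm_upper[OF x s] univ_norm_upper[OF y s] univ_norm_nonneg[OF x]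
      by (intro mult_mono) auto
    ultimately show "s (x * y) \<le> N x * N y" by linarith
  qed
next
  fix r assume r: "r \<in> R"
  have "s r = 0" if "cstar_seminorm G R s" for s using that r by (simp add: cstar_seminorm_def)
  then have "{s r | s. cstar_seminorm G R s} = {0}" using zero_seminorm by auto
  then show "N r = 0" by (simp add: univ_norm_def)
qed

sublocale U: cstar_seminormed_algebra poly_scale poly_star "\<lambda>x. N (restrict_gens G x)"
  by (rule cstar_seminorm_extend[OF cstar_seminorm_univ_norm])

lemma univ_norm_simps [simp]:
  "N 0 = 0" "x \<in> F \<Longrightarrow> N (- x) = N x" "x \<in> F \<Longrightarrow> N (poly_star x) = N x"
  "x \<in> F \<Longrightarrow> N (poly_scale c x) = cmod c * N x"
  using U.norm_zero U.norm_minus[of x] U.norm_adj[of x] U.norm_scl[of c x] by simp_all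

lemma univ_norm_add: "x \<in> F \<Longrightarrow> y \<in> F \<Longrightarrow> N (x + y) \<le> N x + N y"
  and univ_norm_diff_commute: "x \<in> F \<Longrightarrow> y \<in> F \<Longrightarrow> N (x - y) = N (y - x)"
  and univ_norm_mult: "x \<in> F \<Longrightarrow> y \<in> F \<Longrightarrow> N (x * y) \<le> N x * N y"
  and univ_norm_triangle_sub: "x \<in> F \<Longrightarrow> y \<in> F \<Longrightarrow> N x \<le> N y + N (x - y)"
  and univ_norm_cstar: "x \<in> F \<Longrightarrow> N (poly_star x * x) = (N x)\<^sup>2"
  using U.norm_add[of x y] U.norm_diff_commute[of x y]
    U.norm_mult_le[of x y] U.norm_triangle_sub[of x y] U.cstar[of x] by simp_all

lemma univ_norm_abs_diff: "x \<in> F \<Longrightarrow> y \<in> F \<Longrightarrow> \<bar>N x - N y\<bar> \<le> N (x - y)"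
  using univ_norm_triangle_sub[of x y] univ_norm_triangle_sub[of y x] univ_norm_diff_commute[of x y]
  by simp

section \<open>The completion\<close>

definition cauchy_seqs :: "(nat \<Rightarrow> 'g ncpoly) set" where
  "cauchy_seqs = carrier (cauchy_ring G R)"

lemma cs_iff: "X \<in> cauchy_seqs \<longleftrightarrow> (\<forall>n. X n \<in> F) \<and> (\<forall>e>0. \<exists>M. \<forall>m\<ge>M. \<forall>n\<ge>M. N (X m - X n) < e)"
  by (simp add: cauchy_seqs_def cauchy_ring_def)

lemma cs_mem [simp]: "X \<in> cauchy_seqs \<Longrightarrow> X n \<in> F"
  by (simp add: cs_iff)

text \<open>All closure properties of Cauchy sequences come from this domination. A single sequence is covered by taking \<open>X\<close>
  and \<open>Y\<close> equal.\<close>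

lemma cs_bounded_by:
  assumes X: "X \<in> cauchy_seqs" and Y: "Y \<in> cauchy_seqs" and Z: "\<And>n. Z n \<in> F"
    and le: "\<And>m n. N (Z m - Z n) \<le> K * (N (X m - X n) + N (Y m - Y n))"
  shows "Z \<in> cauchy_seqs"
  unfolding cs_iff
proof (intro conjI allI impI Z)
  fix e :: real assume e: "e > 0"
  define d where "d = e / (2 * (\<bar>K\<bar> + 1))"
  have d: "d > 0" "\<bar>K\<bar> * (d + d) < e"
  proof -
    show "d > 0" using e by (simp add: d_def add_nonneg_pos)
    then have "\<bar>K\<bar> * (d + d) < (\<bar>K\<bar> + 1) * (d + d)" by simp
    also have "\<dots> = e"
    proof -
      have "L * (e / (2 * L) + e / (2 * L)) = e" if "L > 0" for L :: real using that by simp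
      from this[of "\<bar>K\<bar> + 1"] show ?thesis by (simp add: d_def add_nonneg_pos)
    qed
    finally show "\<bar>K\<bar> * (d + d) < e" .
  qed
  obtain M1 M2 where "\<forall>m\<ge>M1. \<forall>n\<ge>M1. N (X m - X n) < d" "\<forall>m\<ge>M2. \<forall>n\<ge>M2. N (Y m - Y n) < d"
    using X Y d(1) unfolding cs_iff by meson
  then have *: "N (X m - X n) + N (Y m - Y n) \<le> d + d" if "m \<ge> max M1 M2" "n \<ge> max M1 M2" for m n
    using that by (meson add_mono less_imp_le max.boundedE)
  have "N (Z m - Z n) < e" if "m \<ge> max M1 M2" "n \<ge> max M1 M2" for m n
  proof -
    have "N (Z m - Z n) \<le> \<bar>K\<bar> * (N (X m - X n) + N (Y m - Y n))"
      using X Y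
      by (intro order_trans[OF le[of m n] mult_right_mono]) (simp_all add: univ_norm_nonneg add_nonneg_nonneg)
    also have "\<dots> \<le> \<bar>K\<bar> * (d + d)" using *[OF that] by (intro mult_left_mono) auto
    finally show ?thesis using d by linarith
  qed
  then show "\<exists>M. \<forall>m\<ge>M. \<forall>n\<ge>M. N (Z m - Z n) < e" by blast
qed

lemma cs_const [simp]: "x \<in> F \<Longrightarrow> (\<lambda>_. x) \<in> cauchy_seqs"
  by (simp add: cs_iff)

lemma cs_add: assumes "X \<in> cauchy_seqs" "Y \<in> cauchy_seqs" shows "(\<lambda>n. X n + Y n) \<in> cauchy_seqs"
proof (rule cs_bounded_by[OF assms, where K = 1])
  fix m n
  have "(X m + Y m) - (X n + Y n) = (X m - X n) + (Y m - Y n)" by simp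
  then show "N ((X m + Y m) - (X n + Y n)) \<le> 1 * (N (X m - X n) + N (Y m - Y n))"
    unfolding mult_1 using assms by (simp only:) (simp add: univ_norm_add)
qed (use assms in simp)

lemma cs_scale: assumes "X \<in> cauchy_seqs" shows "(\<lambda>n. poly_scale c (X n)) \<in> cauchy_seqs"
  using assms
  by (intro cs_bounded_by[OF assms assms, where K = "cmod c"])
    (simp_all flip: free.scl_diff_right, simp add: mult_left_mono univ_norm_nonneg)

lemma cs_minus: "X \<in> cauchy_seqs \<Longrightarrow> (\<lambda>n. - X n) \<in> cauchy_seqs"
  using cs_scale[of X "-1"] by (simp add: free.scl_minus_left)

lemma cs_diff: "X \<in> cauchy_seqs \<Longrightarrow> Y \<in> cauchy_seqs \<Longrightarrow> (\<lambda>n. X n - Y n) \<in> cauchy_seqs"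
  using cs_add[OF _ cs_minus, of X Y] by simp

lemma cs_star: assumes "X \<in> cauchy_seqs" shows "(\<lambda>n. poly_star (X n)) \<in> cauchy_seqs"
  using assms
  by (intro cs_bounded_by[OF assms assms, where K = 1])
    (simp_all flip: free.adj_diff, simp add: univ_norm_nonneg)

lemma cs_norm_bounded:
  assumes X: "X \<in> cauchy_seqs" obtains B where "B \<ge> 0" "\<And>n. N (X n) \<le> B"
proof -
  obtain M where M: "\<And>m n. m \<ge> M \<Longrightarrow> n \<ge> M \<Longrightarrow> N (X m - X n) < 1"
    using X unfolding cs_iff by (meson zero_less_one)
  define B where "B = (\<Sum>k\<le>M. N (X k)) + 1"
  have nn: "0 \<le> N (X k)" for k using X by (simp add: univ_norm_nonneg)
  have le: "N (X k) \<le> (\<Sum>k\<le>M. N (X k))" if "k \<le> M" for k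
    using that nn by (intro member_le_sum) auto
  have "N (X n) \<le> B" for n
  proof (cases "n \<le> M")
    case True
    then show ?thesis using le[of n] by (simp add: B_def)
  next
    case False
    then show ?thesis
      using M[of n M] le[of M] univ_norm_triangle_sub[of "X n" "X M"] X by (simp add: B_def)
  qed
  moreover have "B \<ge> 0" using sum_nonneg[of "{..M}" "\<lambda>k. N (X k)"] nn by (simp add: B_def)
  ultimately show ?thesis by (rule that[rotated])
qed

lemma cs_mult: assumes X: "X \<in> cauchy_seqs" and Y: "Y \<in> cauchy_seqs" shows "(\<lambda>n. X n * Y n) \<in> cauchy_seqs"
proof -
  obtain B where B: "B \<ge> 0" "\<And>n. N (X n) \<le> B" using cs_norm_bounded[OF X] by blast
  obtain C where C: "C \<ge> 0" "\<And>n. N (Y n) \<le> C" using cs_norm_bounded[OF Y] by blast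
  show ?thesis
  proof (rule cs_bounded_by[OF X Y, where K = "max B C"])
    fix m n
    have eq: "X m * Y m - X n * Y n = X m * (Y m - Y n) + (X m - X n) * Y n" by (simp add: algebra_simps)
    have "N (X m * Y m - X n * Y n) \<le> N (X m) * N (Y m - Y n) + N (X m - X n) * N (Y n)"
      unfolding eq using X Y by (intro order_trans[OF univ_norm_add add_mono[OF univ_norm_mult univ_norm_mult]]) simp_all
    also have "\<dots> \<le> max B C * N (Y m - Y n) + N (X m - X n) * max B C"
      using B C X Y by (intro add_mono mult_mono) (auto simp: univ_norm_nonneg le_max_iff_disj)
    finally show "N (X m * Y m - X n * Y n) \<le> max B C * (N (X m - X n) + N (Y m - Y n))"
      by (simp add: algebra_simps)
  qed (use X Y in simp)
qed

definition lim_norm :: "(nat \<Rightarrow> 'g ncpoly) \<Rightarrow> real" where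
  "lim_norm X = lim (\<lambda>n. N (X n))"

lemma lim_norm: assumes X: "X \<in> cauchy_seqs" shows "(\<lambda>n. N (X n)) \<longlonglongrightarrow> lim_norm X"
proof -
  have "Cauchy (\<lambda>n. N (X n))"
    unfolding Cauchy_def
  proof (intro allI impI)
    fix e :: real assume "e > 0"
    then obtain M where "\<forall>m\<ge>M. \<forall>n\<ge>M. N (X m - X n) < e" using X unfolding cs_iff by meson
    then have "dist (N (X m)) (N (X n)) < e" if "m \<ge> M" "n \<ge> M" for m n
      using that univ_norm_abs_diff[of "X m" "X n"] X by (fastforce simp: dist_real_def)
    then show "\<exists>M. \<forall>m\<ge>M. \<forall>n\<ge>M. dist (N (X m)) (N (X n)) < e" by blast
  qed
  then show ?thesis unfolding lim_norm_def using Cauchy_convergent convergent_LIMSEQ_iff by blast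
qed

lemma lim_norm_eq: "(\<lambda>n. N (X n)) \<longlonglongrightarrow> l \<Longrightarrow> lim_norm X = l"
  by (simp add: lim_norm_def limI)

lemma lim_norm_le:
  assumes "X \<in> cauchy_seqs" "\<And>n. n \<ge> M \<Longrightarrow> N (X n) \<le> C" shows "lim_norm X \<le> C"
  by (rule LIMSEQ_le_const2[OF lim_norm[OF assms(1)]]) (use assms(2) in auto)

lemma lim_norm_const [simp]: "lim_norm (\<lambda>_. x) = N x"
  by (rule lim_norm_eq) simp

lemma lim_norm_nonneg: "X \<in> cauchy_seqs \<Longrightarrow> 0 \<le> lim_norm X"
  by (rule LIMSEQ_le_const[OF lim_norm]) (auto simp: univ_norm_nonneg)

lemma lim_norm_add:
  assumes "X \<in> cauchy_seqs" "Y \<in> cauchy_seqs" shows "lim_norm (\<lambda>n. X n + Y n) \<le> lim_norm X + lim_norm Y"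
  by (rule LIMSEQ_le[OF lim_norm[OF cs_add[OF assms]] tendsto_add[OF lim_norm lim_norm]])
    (use assms in \<open>auto intro!: exI[of _ 0] univ_norm_add\<close>)

lemma lim_norm_mult:
  assumes "X \<in> cauchy_seqs" "Y \<in> cauchy_seqs" shows "lim_norm (\<lambda>n. X n * Y n) \<le> lim_norm X * lim_norm Y"
  by (rule LIMSEQ_le[OF lim_norm[OF cs_mult[OF assms]] tendsto_mult[OF lim_norm lim_norm]])
    (use assms in \<open>auto intro!: exI[of _ 0] univ_norm_mult\<close>)

lemma lim_norm_scale: "X \<in> cauchy_seqs \<Longrightarrow> lim_norm (\<lambda>n. poly_scale c (X n)) = cmod c * lim_norm X"
  by (rule lim_norm_eq) (simp add: tendsto_mult_left lim_norm)

lemma lim_norm_star: "X \<in> cauchy_seqs \<Longrightarrow> lim_norm (\<lambda>n. poly_star (X n)) = lim_norm X"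
  by (rule lim_norm_eq) (simp add: lim_norm)

lemma lim_norm_minus: "X \<in> cauchy_seqs \<Longrightarrow> lim_norm (\<lambda>n. - X n) = lim_norm X"
  by (rule lim_norm_eq) (simp add: lim_norm)

lemma lim_norm_cstar: "X \<in> cauchy_seqs \<Longrightarrow> lim_norm (\<lambda>n. poly_star (X n) * X n) = (lim_norm X)\<^sup>2"
  by (rule lim_norm_eq) (simp add: lim_norm univ_norm_cstar tendsto_power)

lemma lim_norm_diff_commute:
  "X \<in> cauchy_seqs \<Longrightarrow> Y \<in> cauchy_seqs \<Longrightarrow> lim_norm (\<lambda>n. X n - Y n) = lim_norm (\<lambda>n. Y n - X n)"
  using lim_norm_minus[OF cs_diff, of X Y] by simp

lemma lim_norm_diff_triangle:
  assumes "X \<in> cauchy_seqs" "Y \<in> cauchy_seqs" "Z \<in> cauchy_seqs"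
  shows "lim_norm (\<lambda>n. X n - Z n) \<le> lim_norm (\<lambda>n. X n - Y n) + lim_norm (\<lambda>n. Y n - Z n)"
  using lim_norm_add[OF cs_diff cs_diff, OF assms(1,2) assms(2,3)] by simp

abbreviation "cl \<equiv> univ_class G R"

lemma null_seqs_iff: "X \<in> null_seqs G R \<longleftrightarrow> X \<in> cauchy_seqs \<and> lim_norm X = 0"
  using lim_norm[of X] lim_norm_eq[of X 0] by (auto simp: null_seqs_def cauchy_seqs_def)

text \<open>Cosets become the classes of an equivalence relation. With this description every operation of the
  quotient is computed on representatives and the axioms are inherited pointwise.\<close>

lemma cl_eq: assumes X: "X \<in> cauchy_seqs" shows "cl X = {Y \<in> cauchy_seqs. lim_norm (\<lambda>n. Y n - X n) = 0}"
proof -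
  have "cl X = (\<lambda>Z n. Z n + X n) ` null_seqs G R"
    by (auto simp: univ_class_def a_r_coset_def r_coset_def cauchy_ring_def)
  also have "\<dots> = {Y \<in> cauchy_seqs. lim_norm (\<lambda>n. Y n - X n) = 0}"
  proof (intro equalityI subsetI)
    fix Y assume "Y \<in> {Y \<in> cauchy_seqs. lim_norm (\<lambda>n. Y n - X n) = 0}"
    then have "(\<lambda>n. Y n - X n) \<in> null_seqs G R" using X by (simp add: null_seqs_iff cs_diff)
    then show "Y \<in> (\<lambda>Z n. Z n + X n) ` null_seqs G R" by (rule image_eqI[rotated]) simp
  qed (use X in \<open>auto simp: null_seqs_iff cs_add\<close>)
  finally show ?thesis .
qed

lemma cl_self: "X \<in> cauchy_seqs \<Longrightarrow> X \<in> cl X"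
  by (simp add: cl_eq)

lemma cl_memD: "X \<in> cauchy_seqs \<Longrightarrow> Y \<in> cl X \<Longrightarrow> Y \<in> cauchy_seqs \<and> lim_norm (\<lambda>n. Y n - X n) = 0"
  by (simp add: cl_eq)

lemma cl_eqI:
  assumes "X \<in> cauchy_seqs" "Y \<in> cauchy_seqs" "lim_norm (\<lambda>n. X n - Y n) = 0" shows "cl X = cl Y"
proof -
  have *: "lim_norm (\<lambda>n. Z n - V n) = 0"
    if "Z \<in> cauchy_seqs" "U \<in> cauchy_seqs" "V \<in> cauchy_seqs" "lim_norm (\<lambda>n. Z n - U n) = 0" "lim_norm (\<lambda>n. U n - V n) = 0" for Z U V
    using lim_norm_diff_triangle[of Z U V] lim_norm_nonneg[OF cs_diff, of Z V] that by simp
  show ?thesis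
    using assms *[of _ X Y] *[of _ Y X] lim_norm_diff_commute[of X Y] by (auto simp: cl_eq)
qed

lemma cl_eq_iff: "X \<in> cauchy_seqs \<Longrightarrow> Y \<in> cauchy_seqs \<Longrightarrow> cl X = cl Y \<longleftrightarrow> lim_norm (\<lambda>n. X n - Y n) = 0"
  using cl_eqI cl_self[of X] cl_memD[of Y X] by blast

lemma UN_cl_const: "X \<in> cauchy_seqs \<Longrightarrow> (\<And>Y. Y \<in> cl X \<Longrightarrow> f Y = A) \<Longrightarrow> (\<Union>Y\<in>cl X. f Y) = A"
  using cl_self[of X] by auto

abbreviation "A \<equiv> univ_cstar G R"

lemma A_carrier: "carrier A = cl ` cauchy_seqs"
  by (auto simp: univ_cstar_def Let_def FactRing_def A_RCOSETS_def' univ_class_def cauchy_seqs_def)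

lemma A_carrierE: assumes "P \<in> carrier A" obtains X where "X \<in> cauchy_seqs" "P = cl X"
  using assms by (auto simp: A_carrier)

lemma A_closed: "X \<in> cauchy_seqs \<Longrightarrow> cl X \<in> carrier A"
  by (simp add: A_carrier)

lemma A_one: "\<one>\<^bsub>A\<^esub> = cl (\<lambda>_. 1)"
  by (simp add: univ_cstar_def Let_def FactRing_def univ_class_def cauchy_ring_def)

lemma A_zero: "\<zero>\<^bsub>A\<^esub> = cl (\<lambda>_. 0)"
  by (subst cl_eq) (auto simp: univ_cstar_def Let_def FactRing_def null_seqs_iff)

lemma A_add: assumes X: "X \<in> cauchy_seqs" and Y: "Y \<in> cauchy_seqs" shows "cl X \<oplus>\<^bsub>A\<^esub> cl Y = cl (\<lambda>n. X n + Y n)"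
proof -
  have "cl X \<oplus>\<^bsub>A\<^esub> cl Y = {\<lambda>n. a n + b n | a b. a \<in> cl X \<and> b \<in> cl Y}"
    by (auto simp: univ_cstar_def Let_def FactRing_def set_add_def' cauchy_ring_def)
  also have "\<dots> = cl (\<lambda>n. X n + Y n)"
  proof (intro equalityI subsetI)
    fix Z assume "Z \<in> {\<lambda>n. a n + b n | a b. a \<in> cl X \<and> b \<in> cl Y}"
    then obtain a b where ab: "a \<in> cl X" "b \<in> cl Y" "Z = (\<lambda>n. a n + b n)" by blast
    note a = cl_memD[OF X ab(1)] and b = cl_memD[OF Y ab(2)]
    have "lim_norm (\<lambda>n. (a n - X n) + (b n - Y n)) \<le> 0"
      using lim_norm_add[OF cs_diff cs_diff, of a X b Y] a b X Y by simp
    then have "lim_norm (\<lambda>n. (a n + b n) - (X n + Y n)) = 0"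
      using lim_norm_nonneg[OF cs_diff[OF cs_add cs_add], of a b X Y] a b X Y
      by (simp add: algebra_simps)
    then show "Z \<in> cl (\<lambda>n. X n + Y n)" using a b X Y ab(3) by (simp add: cl_eq cs_add)
  next
    fix Z assume Z: "Z \<in> cl (\<lambda>n. X n + Y n)"
    note Z = cl_memD[OF cs_add[OF X Y] Z]
    have "(\<lambda>n. Z n - Y n) \<in> cl X" using Z X Y by (simp add: cl_eq cs_diff algebra_simps)
    moreover have "Z = (\<lambda>n. (Z n - Y n) + Y n)" by simp
    ultimately show "Z \<in> {\<lambda>n. a n + b n | a b. a \<in> cl X \<and> b \<in> cl Y}"
      unfolding mem_Collect_eq using cl_self[OF Y] by (intro exI conjI)
  qed
  finally show ?thesis .
qed

lemma lim_norm_mult_null: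
  assumes "X \<in> cauchy_seqs" "Y \<in> cauchy_seqs" "lim_norm X = 0 \<or> lim_norm Y = 0" shows "lim_norm (\<lambda>n. X n * Y n) = 0"
  using lim_norm_mult[OF assms(1,2)] lim_norm_nonneg[OF cs_mult[OF assms(1,2)]] assms(3) by auto

lemma A_mult: assumes X: "X \<in> cauchy_seqs" and Y: "Y \<in> cauchy_seqs" shows "cl X \<otimes>\<^bsub>A\<^esub> cl Y = cl (\<lambda>n. X n * Y n)"
proof -
  have *: "cl (\<lambda>n. a n * b n) = cl (\<lambda>n. X n * Y n)" if a: "a \<in> cl X" and b: "b \<in> cl Y" for a b
  proof -
    note a = cl_memD[OF X a] and b = cl_memD[OF Y b]
    have eq: "a n * b n - X n * Y n = a n * (b n - Y n) + (a n - X n) * Y n" for n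
      by (simp add: algebra_simps)
    have "lim_norm (\<lambda>n. a n * b n - X n * Y n)
        \<le> lim_norm (\<lambda>n. a n * (b n - Y n)) + lim_norm (\<lambda>n. (a n - X n) * Y n)"
      unfolding eq using a b X Y by (intro lim_norm_add cs_mult cs_diff) auto
    also have "\<dots> = 0" using a b X Y by (simp add: lim_norm_mult_null cs_diff)
    finally have "lim_norm (\<lambda>n. a n * b n - X n * Y n) = 0"
      using lim_norm_nonneg[OF cs_diff[OF cs_mult cs_mult], of a b X Y] a b X Y by simp
    then show ?thesis using a b X Y by (intro cl_eqI cs_mult) auto
  qed
  have "cl X \<otimes>\<^bsub>A\<^esub> cl Y = (\<Union>a\<in>cl X. \<Union>b\<in>cl Y. cl (\<lambda>n. a n * b n))"
    by (simp add: univ_cstar_def Let_def FactRing_def rcoset_mult_def univ_class_def cauchy_ring_def)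
  also have "\<dots> = cl (\<lambda>n. X n * Y n)"
    using * by (intro UN_cl_const X Y) auto
  finally show ?thesis .
qed

lemma A_scale: assumes X: "X \<in> cauchy_seqs" shows "scale A c (cl X) = cl (\<lambda>n. poly_scale c (X n))"
proof -
  have "scale A c (cl X) = (\<Union>Z\<in>cl X. cl (\<lambda>n. poly_scale c (Z n)))" by (simp add: univ_cstar_def Let_def)
  also have "\<dots> = cl (\<lambda>n. poly_scale c (X n))"
  proof (intro UN_cl_const X cl_eqI)
    fix Z assume "Z \<in> cl X"
    note Z = cl_memD[OF X this]
    show "(\<lambda>n. poly_scale c (Z n)) \<in> cauchy_seqs" "(\<lambda>n. poly_scale c (X n)) \<in> cauchy_seqs" using Z X by (auto intro: cs_scale)
    show "lim_norm (\<lambda>n. poly_scale c (Z n) - poly_scale c (X n)) = 0"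
      using Z X lim_norm_scale[OF cs_diff, of Z X c] by (simp add: free.scl_diff_right)
  qed
  finally show ?thesis .
qed

lemma A_star: assumes X: "X \<in> cauchy_seqs" shows "star A (cl X) = cl (\<lambda>n. poly_star (X n))"
proof -
  have "star A (cl X) = (\<Union>Z\<in>cl X. cl (\<lambda>n. poly_star (Z n)))" by (simp add: univ_cstar_def Let_def)
  also have "\<dots> = cl (\<lambda>n. poly_star (X n))"
  proof (intro UN_cl_const X cl_eqI)
    fix Z assume "Z \<in> cl X"
    note Z = cl_memD[OF X this]
    show "(\<lambda>n. poly_star (Z n)) \<in> cauchy_seqs" "(\<lambda>n. poly_star (X n)) \<in> cauchy_seqs" using Z X by (auto intro: cs_star)
    show "lim_norm (\<lambda>n. poly_star (Z n) - poly_star (X n)) = 0"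
      using Z X lim_norm_star[OF cs_diff, of Z X] by simp
  qed
  finally show ?thesis .
qed

lemma A_norm: assumes X: "X \<in> cauchy_seqs" shows "nrm A (cl X) = lim_norm X"
proof -
  have "lim_norm Z = lim_norm X" if "Z \<in> cl X" for Z
  proof -
    note Z = cl_memD[OF X that]
    have le: "lim_norm U \<le> lim_norm V" if "U \<in> cauchy_seqs" "V \<in> cauchy_seqs" "lim_norm (\<lambda>n. U n - V n) = 0" for U V
      using lim_norm_add[OF cs_diff, of U V V] that by simp
    from Z have Z: "Z \<in> cauchy_seqs" "lim_norm (\<lambda>n. Z n - X n) = 0" by blast+
    then have "lim_norm (\<lambda>n. X n - Z n) = 0" using lim_norm_diff_commute[OF X Z(1)] by simp
    then show ?thesis using le[OF Z(1) X Z(2)] le[OF X Z(1)] by (intro antisym)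
  qed
  then have "lim_norm ` cl X = (\<lambda>_. lim_norm X) ` cl X" by (intro image_cong refl)
  also have "\<dots> = {lim_norm X}" using cl_self[OF X] by blast
  finally have "lim_norm ` cl X = {lim_norm X}" .
  then show ?thesis by (simp add: univ_cstar_def Let_def lim_norm_def[abs_def])
qed

lemmas A_ops = A_add A_mult A_scale A_star A_norm A_one A_zero

lemma A_ring: "ring A"
proof (rule ringI)
  show "abelian_group A"
  proof (rule abelian_groupI)
    fix x assume "x \<in> carrier A"
    then obtain X where X: "X \<in> cauchy_seqs" "x = cl X" by (rule A_carrierE)
    then have "cl (\<lambda>n. - X n) \<oplus>\<^bsub>A\<^esub> x = \<zero>\<^bsub>A\<^esub>" by (simp add: A_ops cs_minus)
    then show "\<exists>y\<in>carrier A. y \<oplus>\<^bsub>A\<^esub> x = \<zero>\<^bsub>A\<^esub>" using A_closed[OF cs_minus[OF X(1)]] by blast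
  qed (auto elim!: A_carrierE simp: A_ops cs_add algebra_simps intro!: A_closed)
  show "monoid A"
    by (rule monoidI) (auto elim!: A_carrierE simp: A_ops cs_mult mult.assoc intro!: A_closed)
qed (auto elim!: A_carrierE simp: A_ops cs_mult cs_add algebra_simps)

lemma A_minus: assumes X: "X \<in> cauchy_seqs" and Y: "Y \<in> cauchy_seqs" shows "cl X \<ominus>\<^bsub>A\<^esub> cl Y = cl (\<lambda>n. X n - Y n)"
proof -
  interpret ring A by (rule A_ring)
  have "\<ominus>\<^bsub>A\<^esub> cl Y = cl (\<lambda>n. - Y n)"
    by (rule minus_equality) (use Y in \<open>simp_all add: A_ops cs_minus A_closed\<close>)
  then show ?thesis using X Y by (simp add: a_minus_def A_ops cs_minus)
qed

text \<open>Polynomials are dense: a class is the limit of the members of any of its representatives.\<close>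

lemma const_approx: assumes X: "X \<in> cauchy_seqs"
  shows "(\<lambda>k. nrm A (cl (\<lambda>_. X k) \<ominus>\<^bsub>A\<^esub> cl X)) \<longlonglongrightarrow> 0"
proof (rule LIMSEQ_I)
  fix e :: real assume e: "e > 0"
  then have "e / 2 > 0" by simp
  then obtain M where M: "\<forall>m\<ge>M. \<forall>n\<ge>M. N (X m - X n) < e / 2" using X unfolding cs_iff by meson
  have "norm (nrm A (cl (\<lambda>_. X k) \<ominus>\<^bsub>A\<^esub> cl X) - 0) < e" if k: "k \<ge> M" for k
  proof -
    have Xk: "(\<lambda>_. X k) \<in> cauchy_seqs" using X by simp
    have "lim_norm (\<lambda>n. X k - X n) \<le> e / 2"
      using M k by (intro lim_norm_le[of _ M] cs_diff Xk X) (auto intro: less_imp_le)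
    then show ?thesis using e lim_norm_nonneg[OF cs_diff[OF Xk X]]
      by (simp add: A_minus A_norm Xk X cs_diff)
  qed
  then show "\<exists>M. \<forall>k\<ge>M. norm (nrm A (cl (\<lambda>_. X k) \<ominus>\<^bsub>A\<^esub> cl X) - 0) < e" by blast
qed

text \<open>Replace the \<open>k\<close>-th term of a Cauchy sequence of classes by a polynomial \<open>y k\<close> at distance less than
  \<open>1 / Suc k\<close>. The polynomials themselves form a Cauchy sequence, and its class is the limit.\<close>

lemma A_complete:
  assumes P: "\<And>n::nat. P n \<in> carrier A"
    and cauchy: "\<And>e. e > 0 \<Longrightarrow> \<exists>M. \<forall>m\<ge>M. \<forall>n\<ge>M. nrm A (P m \<ominus>\<^bsub>A\<^esub> P n) < e"
  shows "\<exists>x\<in>carrier A. (\<lambda>n. nrm A (P n \<ominus>\<^bsub>A\<^esub> x)) \<longlonglongrightarrow> 0"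
proof -
  have "\<exists>X. X \<in> cauchy_seqs \<and> P k = cl X" for k using A_carrierE[OF P[of k]] by blast
  then obtain X where X: "\<And>k. X k \<in> cauchy_seqs" "\<And>k. P k = cl (X k)" by metis
  have "\<exists>y\<in>F. lim_norm (\<lambda>n. X k n - y) < 1 / Suc k" for k
  proof -
    have "eventually (\<lambda>i. nrm A (cl (\<lambda>_. X k i) \<ominus>\<^bsub>A\<^esub> cl (X k)) < 1 / Suc k) sequentially"
      by (rule order_tendstoD(2)[OF const_approx[OF X(1)]]) simp
    then obtain i where "nrm A (cl (\<lambda>_. X k i) \<ominus>\<^bsub>A\<^esub> cl (X k)) < 1 / Suc k"
      by (auto simp: eventually_sequentially)
    then have "lim_norm (\<lambda>n. X k i - X k n) < 1 / Suc k" using X(1)[of k] by (simp add: A_minus A_norm cs_diff)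
    then show ?thesis using lim_norm_diff_commute[of "\<lambda>_. X k i" "X k"] X(1)[of k] by (intro bexI[of _ "X k i"]) simp_all
  qed
  then obtain y where y: "\<And>k. y k \<in> F" "\<And>k. lim_norm (\<lambda>n. X k n - y k) < 1 / Suc k" by metis
  have yk: "(\<lambda>_. y k) \<in> cauchy_seqs" for k using y by simp
  have small: "\<exists>M. \<forall>k\<ge>M. 1 / Suc k < e" if "e > 0" for e :: real
    using order_tendstoD(2)[OF LIMSEQ_Suc[OF lim_inverse_n'] that] by (auto simp: eventually_sequentially)
  have "y \<in> cauchy_seqs"
    unfolding cs_iff
  proof (intro conjI allI impI y)
    fix e :: real assume e: "e > 0"
    obtain M1 where M1: "\<And>k. k \<ge> M1 \<Longrightarrow> 1 / Suc k < e / 3" using small[of "e / 3"] e by auto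
    obtain M2 where M2: "\<And>m n. m \<ge> M2 \<Longrightarrow> n \<ge> M2 \<Longrightarrow> nrm A (P m \<ominus>\<^bsub>A\<^esub> P n) < e / 3"
      using cauchy[of "e / 3"] e by auto
    have "N (y m - y n) < e" if mn: "m \<ge> max M1 M2" "n \<ge> max M1 M2" for m n
    proof -
      have "N (y m - y n) = lim_norm (\<lambda>_. y m - y n)" by simp
      also have "\<dots> \<le> lim_norm (\<lambda>i. y m - X m i) + lim_norm (\<lambda>i. X m i - y n)"
        by (rule lim_norm_diff_triangle[OF yk X(1) yk])
      also have "lim_norm (\<lambda>i. X m i - y n) \<le> lim_norm (\<lambda>i. X m i - X n i) + lim_norm (\<lambda>i. X n i - y n)"
        by (rule lim_norm_diff_triangle[OF X(1) X(1) yk])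
      also have "lim_norm (\<lambda>i. y m - X m i) = lim_norm (\<lambda>i. X m i - y m)"
        by (rule lim_norm_diff_commute[OF yk X(1)])
      also have "lim_norm (\<lambda>i. X m i - X n i) = nrm A (P m \<ominus>\<^bsub>A\<^esub> P n)"
        by (simp add: X A_minus A_norm cs_diff)
      finally show ?thesis using M1[of m] M1[of n] M2[of m n] mn y(2)[of m] y(2)[of n] by simp
    qed
    then show "\<exists>M. \<forall>m\<ge>M. \<forall>n\<ge>M. N (y m - y n) < e" by blast
  qed
  have "(\<lambda>k. nrm A (P k \<ominus>\<^bsub>A\<^esub> cl y)) \<longlonglongrightarrow> 0"
  proof (rule tendsto_sandwich[OF _ _ tendsto_const])
    show "(\<lambda>k. 1 / Suc k + nrm A (cl (\<lambda>_. y k) \<ominus>\<^bsub>A\<^esub> cl y)) \<longlonglongrightarrow> 0"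
      using tendsto_add[OF LIMSEQ_Suc[OF lim_inverse_n'] const_approx[OF \<open>y \<in> cauchy_seqs\<close>]] by simp
    show "eventually (\<lambda>k. 0 \<le> nrm A (P k \<ominus>\<^bsub>A\<^esub> cl y)) sequentially"
      using \<open>y \<in> cauchy_seqs\<close> by (simp add: X A_minus A_norm cs_diff lim_norm_nonneg)
    show "eventually (\<lambda>k. nrm A (P k \<ominus>\<^bsub>A\<^esub> cl y) \<le> 1 / Suc k + nrm A (cl (\<lambda>_. y k) \<ominus>\<^bsub>A\<^esub> cl y)) sequentially"
    proof (intro always_eventually allI)
      fix k
      have "lim_norm (\<lambda>n. X k n - y n) \<le> lim_norm (\<lambda>n. X k n - y k) + lim_norm (\<lambda>n. y k - y n)"
        by (rule lim_norm_diff_triangle[OF X(1) yk \<open>y \<in> cauchy_seqs\<close>])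
      then show "nrm A (P k \<ominus>\<^bsub>A\<^esub> cl y) \<le> 1 / Suc k + nrm A (cl (\<lambda>_. y k) \<ominus>\<^bsub>A\<^esub> cl y)"
        using \<open>y \<in> cauchy_seqs\<close> yk y(2)[of k] by (simp add: X A_minus A_norm cs_diff)
    qed
  qed
  then show ?thesis using A_closed[OF \<open>y \<in> cauchy_seqs\<close>] by blast
qed

theorem cstar_algebra_univ: "cstar_algebra A"
proof -
  interpret ring A by (rule A_ring)
  show ?thesis
  proof (unfold_locales)
    fix P :: "nat \<Rightarrow> _"
    assume "\<And>n. P n \<in> carrier A"
      "\<And>e. e > 0 \<Longrightarrow> \<exists>M. \<forall>m\<ge>M. \<forall>n\<ge>M. nrm A (P m \<ominus>\<^bsub>A\<^esub> P n) < e"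
    then show "\<exists>x\<in>carrier A. (\<lambda>n. nrm A (P n \<ominus>\<^bsub>A\<^esub> x)) \<longlonglongrightarrow> 0" by (rule A_complete)
  next
    fix x assume "x \<in> carrier A"
    then show "nrm A x = 0 \<longleftrightarrow> x = \<zero>\<^bsub>A\<^esub>"
      by (elim A_carrierE) (simp add: A_ops cl_eq_iff)
  qed (auto elim!: A_carrierE intro!: A_closed simp: A_ops cs_add cs_mult cs_scale cs_star
      free.scl_add_right free.scl_add_left lim_norm_nonneg lim_norm_add lim_norm_scale
      lim_norm_mult lim_norm_cstar)
qed

end

section \<open>C*-subalgebras and isometric homomorphisms\<close>

text \<open>C*-subalgebras are closed under scalar multiples; this is why they are closed under negatives.\<close>

lemma (in cstar_algebra) scale_minus_one: assumes "x \<in> carrier A" shows "scale A (- 1) x = \<ominus> x"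
proof -
  have zero: "scale A 0 x = \<zero>"
    using scale_add_left[OF assms, of 0 0] scale_closed[OF assms, of 0] by (simp add: add.l_cancel_one')
  have "scale A (- 1) x \<oplus> x = scale A (- 1 + 1) x"
    using assms by (simp only: scale_add_left scale_one)
  then show ?thesis
    using assms zero minus_equality[of "scale A (- 1) x" x] scale_closed[OF assms] by simp
qed

text \<open>The carrier inherits the operations. Negation refers to the carrier, so the differences in the
  completeness axiom have to be compared with those of the ambient algebra.\<close>

lemma cstar_subalgebra_cstar_algebra:
  fixes A :: "('a, 'm) cstar_scheme" (structure)
  assumes A: "cstar_algebra A" and B: "is_cstar_subalgebra A B" and one: "\<one> \<in> B"
  shows "cstar_algebra (A\<lparr>carrier := B\<rparr>)"
proof -
  interpret cstar_algebra A by (rule A)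
  let ?B = "A\<lparr>carrier := B\<rparr>"
  have sub: "x \<in> B \<Longrightarrow> x \<in> carrier A" for x using B by (auto simp: is_cstar_subalgebra_def)
  have closed: "\<zero> \<in> B" "\<And>x y. x \<in> B \<Longrightarrow> y \<in> B \<Longrightarrow> x \<oplus> y \<in> B" "\<And>x y. x \<in> B \<Longrightarrow> y \<in> B \<Longrightarrow> x \<otimes> y \<in> B"
    "\<And>c x. x \<in> B \<Longrightarrow> scale A c x \<in> B" "\<And>x. x \<in> B \<Longrightarrow> star A x \<in> B"
    and lim_closed: "\<And>X x. (\<And>n::nat. X n \<in> B) \<Longrightarrow> x \<in> carrier A \<Longrightarrow>
      (\<lambda>n. nrm A (X n \<ominus> x)) \<longlonglongrightarrow> 0 \<Longrightarrow> x \<in> B"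
    using B unfolding is_cstar_subalgebra_def by blast+
  have neg: "\<ominus> x \<in> B" if "x \<in> B" for x
    using closed(4)[OF that, of "-1"] scale_minus_one[OF sub[OF that]] by simp
  interpret B: ring ?B
  proof (rule ringI)
    show "abelian_group ?B"
    proof (rule abelian_groupI)
      fix x assume "x \<in> carrier ?B"
      then show "\<exists>y\<in>carrier ?B. y \<oplus>\<^bsub>?B\<^esub> x = \<zero>\<^bsub>?B\<^esub>"
        using neg sub l_neg by auto
    qed (auto simp: closed sub a_ac)
    show "monoid ?B" by (rule monoidI) (auto simp: closed one sub m_assoc)
  qed (auto simp: sub l_distr r_distr)
  have minus: "x \<ominus>\<^bsub>?B\<^esub> y = x \<ominus> y" if "y \<in> B" for x y
  proof -
    have "\<ominus>\<^bsub>?B\<^esub> y = \<ominus> y"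
      by (rule B.minus_equality) (use that neg sub l_neg in auto)
    then show ?thesis by (simp add: a_minus_def)
  qed
  show ?thesis
  proof unfold_locales
    fix X :: "nat \<Rightarrow> _"
    assume X: "\<And>n. X n \<in> carrier ?B"
      and c: "\<And>e. e > 0 \<Longrightarrow> \<exists>N. \<forall>m\<ge>N. \<forall>n\<ge>N. nrm ?B (X m \<ominus>\<^bsub>?B\<^esub> X n) < e"
    have "\<exists>x\<in>carrier A. (\<lambda>n. nrm A (X n \<ominus> x)) \<longlonglongrightarrow> 0"
      by (rule complete) (use X c minus sub in auto)
    then obtain x where x: "x \<in> carrier A" "(\<lambda>n. nrm A (X n \<ominus> x)) \<longlonglongrightarrow> 0" by blast
    then have "x \<in> B" using lim_closed X by auto
    then show "\<exists>x\<in>carrier ?B. (\<lambda>n. nrm ?B (X n \<ominus>\<^bsub>?B\<^esub> x)) \<longlonglongrightarrow> 0"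
      using x minus by auto
  qed (auto simp: closed sub scale_add_right scale_add_left scale_scale scale_one scale_mult_left
      scale_mult_right star_star star_add star_scale star_mult nrm_nonneg nrm_eq_zero_iff
      nrm_triangle nrm_scale nrm_mult cstar_identity)
qed

lemma cstar_iso_sym:
  assumes A: "cstar_algebra A" and f: "f \<in> cstar_iso A B"
  shows "inv_into (carrier A) f \<in> cstar_iso B A"
proof -
  interpret cstar_algebra A by (rule A)
  let ?g = "inv_into (carrier A) f"
  have iso: "f \<in> ring_iso A B" and ops: "\<And>x. x \<in> carrier A \<Longrightarrow> f (star A x) = star B (f x)"
    "\<And>x c. x \<in> carrier A \<Longrightarrow> f (scale A c x) = scale B c (f x)"
    using f by (auto simp: cstar_iso_def)
  have bij: "bij_betw f (carrier A) (carrier B)" using iso by (simp add: ring_iso_def)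
  have g: "?g y \<in> carrier A" "f (?g y) = y" if "y \<in> carrier B" for y
    using bij that by (auto simp: bij_betw_def inv_into_into f_inv_into_f)
  have gf: "?g (f x) = x" if "x \<in> carrier A" for x
    using bij that by (simp add: bij_betw_def inv_into_f_f)
  have "?g (star B y) = star A (?g y)" "?g (scale B c y) = scale A c (?g y)" if "y \<in> carrier B" for y c
    using gf[of "star A (?g y)"] gf[of "scale A c (?g y)"] ops g[OF that] star_closed scale_closed by simp_all
  then show ?thesis using ring_iso_set_sym[OF ring_axioms iso] by (simp add: cstar_iso_def)
qed

text \<open>A *-homomorphism between free *-algebras that preserves the universal seminorms. C*-subalgebras need not contain
  the unit of the ambient algebra, hence the last assumption: the images of the generators produce it.\<close>

locale isometric_embedding = D: bounded_presentation G R + E: bounded_presentation H S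
  for G :: "'g set" and R and H :: "'h set" and S +
  fixes f :: "'g \<Rightarrow> 'h ncpoly"
  assumes f_closed: "g \<in> G \<Longrightarrow> f g \<in> free_star_alg H"
    and isometric: "x \<in> free_star_alg G \<Longrightarrow> univ_norm H S (free.poly_eval f x) = univ_norm G R x"
    and unit_generated: "\<lbrakk>is_cstar_subalgebra (univ_cstar H S) B;
        \<And>g. g \<in> G \<Longrightarrow> univ_class H S (\<lambda>_. f g) \<in> B\<rbrakk> \<Longrightarrow> \<one>\<^bsub>univ_cstar H S\<^esub> \<in> B"
begin

abbreviation "\<phi> \<equiv> free.poly_eval f"

lemma phi_closed: "x \<in> free_star_alg G \<Longrightarrow> \<phi> x \<in> free_star_alg H"
  by (rule free_poly_eval_closed[of x G f H, OF _ f_closed])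

lemma phi_cs: "X \<in> D.cauchy_seqs \<Longrightarrow> (\<lambda>n. \<phi> (X n)) \<in> E.cauchy_seqs"
  unfolding D.cs_iff E.cs_iff by (simp add: phi_closed isometric flip: free.poly_eval_diff)

lemma phi_lim_norm: "X \<in> D.cauchy_seqs \<Longrightarrow> E.lim_norm (\<lambda>n. \<phi> (X n)) = D.lim_norm X"
  by (rule E.lim_norm_eq) (simp add: isometric D.lim_norm)

text \<open>The extension to classes; by isometry it does not depend on the representative.\<close>

definition \<Phi> where "\<Phi> P = (\<Union>X\<in>P. E.cl (\<lambda>n. \<phi> (X n)))"

lemma Phi_cl: assumes X: "X \<in> D.cauchy_seqs" shows "\<Phi> (D.cl X) = E.cl (\<lambda>n. \<phi> (X n))"
  unfolding \<Phi>_def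
proof (intro D.UN_cl_const X E.cl_eqI phi_cs)
  fix Y assume "Y \<in> D.cl X"
  note Y = D.cl_memD[OF X this]
  then show "Y \<in> D.cauchy_seqs" by blast
  show "E.lim_norm (\<lambda>n. \<phi> (Y n) - \<phi> (X n)) = 0"
    using phi_lim_norm[OF D.cs_diff, of Y X] X Y by (simp add: free.poly_eval_diff)
qed

lemma Phi_inj: "inj_on \<Phi> (carrier D.A)"
proof (rule inj_onI)
  fix P Q assume "P \<in> carrier D.A" "Q \<in> carrier D.A" and eq: "\<Phi> P = \<Phi> Q"
  then obtain X Y where XY: "X \<in> D.cauchy_seqs" "P = D.cl X" "Y \<in> D.cauchy_seqs" "Q = D.cl Y"
    by (metis D.A_carrierE)
  then show "P = Q"
    using eq phi_lim_norm[OF D.cs_diff, of X Y]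
    by (simp add: Phi_cl E.cl_eq_iff D.cl_eq_iff phi_cs free.poly_eval_diff)
qed

lemma Phi_minus_norm:
  assumes "P \<in> carrier D.A" "Q \<in> carrier D.A"
  shows "nrm E.A (\<Phi> P \<ominus>\<^bsub>E.A\<^esub> \<Phi> Q) = nrm D.A (P \<ominus>\<^bsub>D.A\<^esub> Q)"
proof -
  obtain X Y where XY: "X \<in> D.cauchy_seqs" "P = D.cl X" "Y \<in> D.cauchy_seqs" "Q = D.cl Y"
    using assms by (metis D.A_carrierE)
  then show ?thesis
    using phi_lim_norm[OF D.cs_diff, of X Y]
    by (simp add: Phi_cl E.A_minus D.A_minus E.A_norm D.A_norm phi_cs D.cs_diff E.cs_diff free.poly_eval_diff)
qed

lemma Phi_closed: "P \<in> carrier D.A \<Longrightarrow> \<Phi> P \<in> carrier E.A"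
  by (elim D.A_carrierE) (simp add: Phi_cl phi_cs E.A_closed)

lemma Phi_hom:
  assumes "P \<in> carrier D.A" "Q \<in> carrier D.A"
  shows "\<Phi> (P \<oplus>\<^bsub>D.A\<^esub> Q) = \<Phi> P \<oplus>\<^bsub>E.A\<^esub> \<Phi> Q" "\<Phi> (P \<otimes>\<^bsub>D.A\<^esub> Q) = \<Phi> P \<otimes>\<^bsub>E.A\<^esub> \<Phi> Q"
    "\<Phi> (scale D.A c P) = scale E.A c (\<Phi> P)" "\<Phi> (star D.A P) = star E.A (\<Phi> P)"
proof -
  obtain X Y where XY: "X \<in> D.cauchy_seqs" "P = D.cl X" "Y \<in> D.cauchy_seqs" "Q = D.cl Y"
    using assms by (metis D.A_carrierE)
  then show "\<Phi> (P \<oplus>\<^bsub>D.A\<^esub> Q) = \<Phi> P \<oplus>\<^bsub>E.A\<^esub> \<Phi> Q" "\<Phi> (P \<otimes>\<^bsub>D.A\<^esub> Q) = \<Phi> P \<otimes>\<^bsub>E.A\<^esub> \<Phi> Q"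
    "\<Phi> (scale D.A c P) = scale E.A c (\<Phi> P)" "\<Phi> (star D.A P) = star E.A (\<Phi> P)"
    by (simp_all add: Phi_cl D.A_ops E.A_ops phi_cs E.A_closed D.cs_add D.cs_mult D.cs_scale
        D.cs_star free.poly_eval_simps)
qed

lemma Phi_one: "\<Phi> \<one>\<^bsub>D.A\<^esub> = \<one>\<^bsub>E.A\<^esub>"
  by (simp add: D.A_one E.A_one Phi_cl)

lemma Phi_zero: "\<Phi> \<zero>\<^bsub>D.A\<^esub> = \<zero>\<^bsub>E.A\<^esub>"
  by (simp add: D.A_zero E.A_zero Phi_cl)

lemma E_limit_unique:
  assumes X: "\<And>n. X n \<in> carrier E.A" and x: "x \<in> carrier E.A" "(\<lambda>n. nrm E.A (X n \<ominus>\<^bsub>E.A\<^esub> x)) \<longlonglongrightarrow> 0"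
    and y: "y \<in> carrier E.A" "(\<lambda>n. nrm E.A (X n \<ominus>\<^bsub>E.A\<^esub> y)) \<longlonglongrightarrow> 0"
  shows "x = y"
proof -
  obtain U V where UV: "U \<in> E.cauchy_seqs" "x = E.cl U" "V \<in> E.cauchy_seqs" "y = E.cl V"
    using x(1) y(1) by (metis E.A_carrierE)
  have le: "E.lim_norm (\<lambda>k. U k - V k) \<le> nrm E.A (X n \<ominus>\<^bsub>E.A\<^esub> x) + nrm E.A (X n \<ominus>\<^bsub>E.A\<^esub> y)" for n
  proof -
    obtain Z where Z: "Z \<in> E.cauchy_seqs" "X n = E.cl Z" by (rule E.A_carrierE[OF X])
    show ?thesis
      using E.lim_norm_diff_triangle[OF UV(1) Z(1) UV(3)] E.lim_norm_diff_commute[OF UV(1) Z(1)] UV Z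
      by (simp add: E.A_minus E.A_norm E.cs_diff)
  qed
  have "E.lim_norm (\<lambda>k. U k - V k) \<le> 0 + 0"
    by (rule LIMSEQ_le_const[OF tendsto_add[OF x(2) y(2)]]) (use le in blast)
  then have "E.lim_norm (\<lambda>k. U k - V k) = 0"
    using E.lim_norm_nonneg[OF E.cs_diff, of U V] UV by simp
  then show ?thesis using UV by (simp add: E.cl_eq_iff)
qed

text \<open>The only point is closedness. If images converge, then their preimages form a Cauchy sequence by
  isometry; their limit exists by completeness, and \<open>\<Phi>\<close> sends it to the given limit.\<close>

lemma range_subalgebra: "is_cstar_subalgebra E.A (\<Phi> ` carrier D.A)"
proof -
  interpret cstar_algebra D.A by (rule D.cstar_algebra_univ)
  have limit: "x \<in> \<Phi> ` carrier D.A"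
    if X: "\<And>n::nat. X n \<in> \<Phi> ` carrier D.A" and x: "x \<in> carrier E.A"
      "(\<lambda>n. nrm E.A (X n \<ominus>\<^bsub>E.A\<^esub> x)) \<longlonglongrightarrow> 0" for X x
  proof -
    have "\<exists>p. p \<in> carrier D.A \<and> X n = \<Phi> p" for n using X by blast
    then obtain P where P: "\<And>n. P n \<in> carrier D.A" "\<And>n. X n = \<Phi> (P n)" by metis
    have XE: "X n \<in> carrier E.A" for n using P Phi_closed by simp
    have "\<exists>N. \<forall>m\<ge>N. \<forall>n\<ge>N. nrm D.A (P m \<ominus>\<^bsub>D.A\<^esub> P n) < e" if e: "e > 0" for e
    proof -
      have "eventually (\<lambda>n. nrm E.A (X n \<ominus>\<^bsub>E.A\<^esub> x) < e / 2) sequentially"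
        by (rule order_tendstoD(2)[OF x(2)]) (use e in simp)
      then obtain M where M: "\<And>n. n \<ge> M \<Longrightarrow> nrm E.A (X n \<ominus>\<^bsub>E.A\<^esub> x) < e / 2"
        by (auto simp: eventually_sequentially)
      have "nrm D.A (P m \<ominus>\<^bsub>D.A\<^esub> P n) < e" if mn: "m \<ge> M" "n \<ge> M" for m n
      proof -
        obtain U V W where U: "U \<in> E.cauchy_seqs" "X m = E.cl U" and V: "V \<in> E.cauchy_seqs" "X n = E.cl V"
          and W: "W \<in> E.cauchy_seqs" "x = E.cl W"
          using XE[of m] XE[of n] x(1) by (metis E.A_carrierE)
        have "nrm D.A (P m \<ominus>\<^bsub>D.A\<^esub> P n) = nrm E.A (X m \<ominus>\<^bsub>E.A\<^esub> X n)"
          using Phi_minus_norm P by simp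
        also have "\<dots> \<le> nrm E.A (X m \<ominus>\<^bsub>E.A\<^esub> x) + nrm E.A (X n \<ominus>\<^bsub>E.A\<^esub> x)"
          using E.lim_norm_diff_triangle[OF U(1) W(1) V(1)] E.lim_norm_diff_commute[OF W(1) V(1)] U V W
          by (simp add: E.A_minus E.A_norm E.cs_diff)
        finally show ?thesis using M[OF mn(1)] M[OF mn(2)] by linarith
      qed
      then show ?thesis by blast
    qed
    then obtain p where p: "p \<in> carrier D.A" "(\<lambda>n. nrm D.A (P n \<ominus>\<^bsub>D.A\<^esub> p)) \<longlonglongrightarrow> 0"
      using complete[of P] P(1) by blast
    have "(\<lambda>n. nrm E.A (X n \<ominus>\<^bsub>E.A\<^esub> \<Phi> p)) \<longlonglongrightarrow> 0" using p P by (simp add: Phi_minus_norm)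
    then have "x = \<Phi> p" using E_limit_unique[OF XE x] Phi_closed p(1) by blast
    then show ?thesis using p(1) by blast
  qed
  show ?thesis
    unfolding is_cstar_subalgebra_def
  proof (intro conjI ballI allI impI)
    show "\<Phi> ` carrier D.A \<subseteq> carrier E.A" using Phi_closed by blast
    show "\<zero>\<^bsub>E.A\<^esub> \<in> \<Phi> ` carrier D.A" using Phi_zero zero_closed by (metis imageI)
    show "x \<in> \<Phi> ` carrier D.A"
      if "(\<forall>n. X n \<in> \<Phi> ` carrier D.A) \<and> x \<in> carrier E.A \<and> (\<lambda>n. nrm E.A (X n \<ominus>\<^bsub>E.A\<^esub> x)) \<longlonglongrightarrow> 0" for X x
      using limit that by blast
  qed (use Phi_hom in \<open>auto simp flip: Phi_hom intro!: imageI star_closed scale_closed\<close>)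
qed

text \<open>A closed subalgebra that contains the images of the generators and the unit contains all images of polynomials, hence
  their limits.\<close>

lemma range_least:
  assumes B: "is_cstar_subalgebra E.A B" and gens: "\<And>g. g \<in> G \<Longrightarrow> E.cl (\<lambda>_. f g) \<in> B"
  shows "\<Phi> ` carrier D.A \<subseteq> B"
proof -
  have one: "E.cl (\<lambda>_. 1) \<in> B" using unit_generated[OF B gens] by (simp add: E.A_one)
  have closed: "\<And>x y. x \<in> B \<Longrightarrow> y \<in> B \<Longrightarrow> x \<oplus>\<^bsub>E.A\<^esub> y \<in> B" "\<And>x y. x \<in> B \<Longrightarrow> y \<in> B \<Longrightarrow> x \<otimes>\<^bsub>E.A\<^esub> y \<in> B"
    "\<And>c x. x \<in> B \<Longrightarrow> scale E.A c x \<in> B" "\<And>x. x \<in> B \<Longrightarrow> star E.A x \<in> B"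
    and lim_closed: "\<And>X x. (\<And>n::nat. X n \<in> B) \<Longrightarrow> x \<in> carrier E.A \<Longrightarrow>
      (\<lambda>n. nrm E.A (X n \<ominus>\<^bsub>E.A\<^esub> x)) \<longlonglongrightarrow> 0 \<Longrightarrow> x \<in> B"
    using B unfolding is_cstar_subalgebra_def by blast+
  have const: "E.cl (\<lambda>_. \<phi> x) \<in> B" if "x \<in> free_star_alg G" for x
    using that
  proof (induction x rule: free_star_alg_induct)
    case (scalar c)
    then show ?case using closed(3)[OF one, of c] by (simp add: E.A_scale free.poly_eval_simps)
  next
    case (gen g)
    then show ?case by (simp add: gens)
  next
    case (star_gen g)
    then show ?case using closed(4)[OF gens[OF star_gen]] by (simp add: E.A_star f_closed free.poly_eval_simps)
  next
    case (add x y)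
    then show ?case using closed(1)[OF add(3,4)] by (simp add: E.A_add phi_closed free.poly_eval_simps)
  next
    case (mult x y)
    then show ?case using closed(2)[OF mult(3,4)] by (simp add: E.A_mult phi_closed free.poly_eval_simps)
  qed
  show ?thesis
  proof
    fix q assume "q \<in> \<Phi> ` carrier D.A"
    then obtain X where X: "X \<in> D.cauchy_seqs" "q = E.cl (\<lambda>n. \<phi> (X n))"
      by (auto simp: D.A_carrier Phi_cl)
    show "q \<in> B"
      unfolding X(2)
      by (rule lim_closed[OF _ _ E.const_approx[OF phi_cs[OF X(1)]]])
        (simp_all add: const X(1) E.A_closed phi_cs)
  qed
qed

lemma generated_cstar_eq:
  "generated_cstar E.A ((\<lambda>g. E.cl (\<lambda>_. f g)) ` G) = E.A\<lparr>carrier := \<Phi> ` carrier D.A\<rparr>"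
proof -
  have "E.cl (\<lambda>_. f g) \<in> \<Phi> ` carrier D.A" if "g \<in> G" for g
  proof -
    have "\<Phi> (D.cl (\<lambda>_. gen g)) = E.cl (\<lambda>_. f g)" using that by (simp add: Phi_cl)
    moreover have "D.cl (\<lambda>_. gen g) \<in> carrier D.A" using that by (simp add: D.A_closed)
    ultimately show ?thesis by blast
  qed
  then have "\<Inter>{B. is_cstar_subalgebra E.A B \<and> (\<lambda>g. E.cl (\<lambda>_. f g)) ` G \<subseteq> B} = \<Phi> ` carrier D.A"
    using range_subalgebra by (intro equalityI Inter_lower Inter_greatest range_least) blast+
  then show ?thesis by (simp add: generated_cstar_def)
qed

theorem generated_cstar_isomorphic:
  "cstar_isomorphic (generated_cstar E.A ((\<lambda>g. E.cl (\<lambda>_. f g)) ` G)) D.A"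
proof -
  interpret cstar_algebra D.A by (rule D.cstar_algebra_univ)
  let ?S = "E.A\<lparr>carrier := \<Phi> ` carrier D.A\<rparr>"
  have one: "\<one>\<^bsub>E.A\<^esub> \<in> \<Phi> ` carrier D.A" using Phi_one one_closed by (metis imageI)
  have "\<Phi> \<in> ring_hom D.A ?S"
    by (rule ring_hom_memI) (use Phi_hom(1,2) Phi_one in auto)
  then have "\<Phi> \<in> cstar_iso D.A ?S"
    using Phi_inj Phi_hom(3,4) by (auto simp: cstar_iso_def ring_iso_def bij_betw_def)
  then have "inv_into (carrier D.A) \<Phi> \<in> cstar_iso ?S D.A"
    by (rule cstar_iso_sym[OF D.cstar_algebra_univ])
  then show ?thesis
    unfolding generated_cstar_eq cstar_isomorphic_def
    using cstar_subalgebra_cstar_algebra[OF E.cstar_algebra_univ range_subalgebra one]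
      D.cstar_algebra_univ by blast
qed

end

section \<open>Magic unitaries and the relations of $A_h(p,q)$\<close>

context cstar_seminormed_algebra
begin

text \<open>Equality in the C*-algebra obtained by dividing out the null elements.\<close>

definition null_eq :: "'a \<Rightarrow> 'a \<Rightarrow> bool" (infix "\<approx>" 50) where
  "x \<approx> y \<longleftrightarrow> t (x - y) = 0"

lemma null_eq_refl [simp, intro]: "x \<approx> x"
  by (simp add: null_eq_def)

lemma null_eq_sym: "x \<approx> y \<Longrightarrow> y \<approx> x"
  by (simp add: null_eq_def norm_diff_commute)

lemma null_eq_trans [trans]: "x \<approx> y \<Longrightarrow> y \<approx> z \<Longrightarrow> x \<approx> z"
  using norm_null_add[of "x - y" "y - z"] by (simp add: null_eq_def)

lemma null_eq_add: "x \<approx> y \<Longrightarrow> z \<approx> w \<Longrightarrow> x + z \<approx> y + w"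
  using norm_null_add[of "x - y" "z - w"] by (simp add: null_eq_def algebra_simps)

lemma null_eq_mult: "x \<approx> y \<Longrightarrow> z \<approx> w \<Longrightarrow> x * z \<approx> y * w"
  using norm_null_add[OF norm_null_mult(1)[of "x - y" z] norm_null_mult(2)[of "z - w" y]]
  by (simp add: null_eq_def algebra_simps)

lemma null_eq_adj: "x \<approx> y \<Longrightarrow> x\<^sup>\<dagger> \<approx> y\<^sup>\<dagger>"
  using norm_adj[of "x - y"] by (simp add: null_eq_def)

lemma null_eq_sum: "(\<And>i. i \<in> I \<Longrightarrow> f i \<approx> g i) \<Longrightarrow> (\<Sum>i\<in>I. f i) \<approx> (\<Sum>i\<in>I. g i)"
  by (induction I rule: infinite_finite_induct) (auto intro: null_eq_add)

lemma null_eq_norm: "x \<approx> y \<Longrightarrow> t x = t y"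
  by (simp add: null_eq_def norm_cong)

text \<open>\<open>u\<^sup>\<dagger> * u\<close> is idempotent, so \<open>(t u)\<^sup>2\<close> is equal to its own square.\<close>

lemma norm_partial_isometry_le:
  assumes "u * u\<^sup>\<dagger> * u \<approx> u" shows "t u \<le> 1"
proof -
  have "u\<^sup>\<dagger> * (u * u\<^sup>\<dagger> * u) \<approx> u\<^sup>\<dagger> * u" using assms by (intro null_eq_mult) auto
  then have "t ((u\<^sup>\<dagger> * u) * (u\<^sup>\<dagger> * u)) = t (u\<^sup>\<dagger> * u)" by (simp add: null_eq_norm mult.assoc)
  then have "((t u)\<^sup>2)\<^sup>2 = (t u)\<^sup>2" using norm_square_hermitian[of "u\<^sup>\<dagger> * u"] by (simp add: cstar)
  then have "(t u)\<^sup>2 * (t u)\<^sup>2 = (t u)\<^sup>2 * 1" by (simp only: power2_eq_square[of "(t u)\<^sup>2"] mult_1_right)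
  then have "(t u)\<^sup>2 = 0 \<or> (t u)\<^sup>2 = 1" by (simp only: mult_cancel_left)
  then have "(t u)\<^sup>2 \<le> 1\<^sup>2" by auto
  then show ?thesis by (rule power2_le_imp_le) simp
qed

text \<open>Compressing the sum by \<open>P j\<close> gives \<open>P j\<close>, and the summand for \<open>j\<close> already accounts for all of it. The remaining summands
  are of the form \<open>x\<^sup>\<dagger> * x\<close> with sum null, so each of them is null.\<close>

lemma projections_orthogonal:
  assumes K: "finite K" and P: "\<And>k. k \<in> K \<Longrightarrow> (P k)\<^sup>\<dagger> = P k" "\<And>k. k \<in> K \<Longrightarrow> P k * P k \<approx> P k"
    and sum: "(\<Sum>k\<in>K. P k) \<approx> 1" and ij: "i \<in> K" "j \<in> K" "i \<noteq> j"
  shows "P i * P j \<approx> 0"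
proof -
  let ?Q = "\<lambda>k. (P k * P j)\<^sup>\<dagger> * (P k * P j)"
  have Q: "?Q k \<approx> P j * P k * P j" if k: "k \<in> K" for k
  proof -
    have "P j * (P k * P k) * P j \<approx> P j * P k * P j" using P k by (intro null_eq_mult) auto
    then show ?thesis using P(1)[OF k] P(1)[OF ij(2)] by (simp add: mult.assoc)
  qed
  have Qj: "?Q j \<approx> P j"
  proof -
    have "P j * P j * P j \<approx> P j * P j" using P ij by (intro null_eq_mult) auto
    then show ?thesis using Q[OF ij(2)] P(2)[OF ij(2)] null_eq_trans by blast
  qed
  have "(\<Sum>k\<in>K. ?Q k) \<approx> (\<Sum>k\<in>K. P j * P k * P j)" by (rule null_eq_sum[OF Q])
  also have "(\<Sum>k\<in>K. P j * P k * P j) = P j * (\<Sum>k\<in>K. P k) * P j"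
    by (simp add: sum_distrib_left sum_distrib_right)
  also have "\<dots> \<approx> P j * 1 * P j" using sum by (intro null_eq_mult) auto
  also have "P j * 1 * P j \<approx> P j" using P(2)[OF ij(2)] by simp
  finally have "(\<Sum>k\<in>K. ?Q k) \<approx> P j" .
  then have "(\<Sum>k\<in>K. ?Q k) \<approx> ?Q j" using Qj null_eq_sym null_eq_trans by blast
  then have "t (\<Sum>k\<in>K - {j}. ?Q k) = 0"
    unfolding null_eq_def sum.remove[OF K ij(2), of ?Q] by simp
  then have "t (P i * P j) = 0"
    using norm_sum_adj_mult_null[of "K - {j}" "\<lambda>k. P k * P j" i] K ij by simp
  then show ?thesis by (simp add: null_eq_def)
qed

text \<open>The next three predicates are the relations of the presentations, read as equations between
  elements of a C*-seminormed algebra up to null elements.\<close>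

definition unitary_matrix :: "'i set \<Rightarrow> ('i \<times> 'i \<Rightarrow> 'a) \<Rightarrow> bool" where
  "unitary_matrix I f \<longleftrightarrow> (\<forall>i\<in>I. \<forall>j\<in>I.
     (\<Sum>k\<in>I. f (i, k) * (f (j, k))\<^sup>\<dagger>) \<approx> (if i = j then 1 else 0) \<and>
     (\<Sum>k\<in>I. (f (k, i))\<^sup>\<dagger> * f (k, j)) \<approx> (if i = j then 1 else 0))"

definition magic_unitary :: "'i set \<Rightarrow> ('i \<times> 'i \<Rightarrow> 'a) \<Rightarrow> bool" where
  "magic_unitary I f \<longleftrightarrow> unitary_matrix I f \<and>
     (\<forall>i\<in>I. \<forall>j\<in>I. (f (i, j))\<^sup>\<dagger> \<approx> f (i, j) \<and> f (i, j) * f (i, j) \<approx> f (i, j))"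

definition Ah_matrix :: "nat \<Rightarrow> nat \<Rightarrow> (jindex \<times> jindex \<Rightarrow> 'a) \<Rightarrow> bool" where
  "Ah_matrix p q f \<longleftrightarrow> unitary_matrix (Jpq p q) f \<and>
     (\<forall>z\<in>Jpq p q. \<forall>y\<in>Jpq p q. f (z, y) * (f (z, y))\<^sup>\<dagger> * f (z, y) \<approx> f (z, y) \<and>
        f (z, y) \<approx> (f (bar z, bar y))\<^sup>\<dagger>)"

lemma ball_setcompr2:
  "(\<forall>r\<in>{F i j | i j. i \<in> I \<and> j \<in> I}. Q r) \<longleftrightarrow> (\<forall>i\<in>I. \<forall>j\<in>I. Q (F i j))"
  by blast

lemma poly_eval_delta: "poly_eval f (if b then 1 else 0) = (if b then 1 else 0)"
  by simp

lemma unitary_rels_iff: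
  "(\<forall>r\<in>unitary_rels I gen_matrix. t (poly_eval f r) = 0) \<longleftrightarrow> unitary_matrix I f"
  unfolding unitary_rels_def unitary_matrix_def null_eq_def ball_Un ball_setcompr2
  by (simp only: poly_eval_simps poly_eval_delta poly_eval_gen) blast

lemma magic_rels_iff:
  "(\<forall>r\<in>unitary_rels I gen_matrix \<union> projection_rels I gen_matrix. t (poly_eval f r) = 0) \<longleftrightarrow> magic_unitary I f"
  unfolding ball_Un unitary_rels_iff magic_unitary_def projection_rels_def null_eq_def ball_setcompr2
  by (simp only: poly_eval_simps poly_eval_gen) blast

lemma Ah_rels_iff:
  "(\<forall>r\<in>Ah_rels p q. t (poly_eval f r) = 0) \<longleftrightarrow> Ah_matrix p q f"
  unfolding Ah_rels_def ball_Un unitary_rels_iff Ah_matrix_def partial_isometry_rels_def null_eq_def ball_setcompr2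
  by (simp only: poly_eval_simps poly_eval_gen) blast

lemma unitary_matrix_reindex:
  assumes "bij_betw \<beta> I J" "unitary_matrix J f"
  shows "unitary_matrix I (\<lambda>(i, j). f (\<beta> i, \<beta> j))"
proof -
  have sum: "(\<Sum>k\<in>I. h (\<beta> k)) = (\<Sum>k\<in>J. h k)" for h :: "_ \<Rightarrow> 'a"
    by (rule sum.reindex_bij_betw[OF assms(1)])
  have mem: "\<beta> i \<in> J" if "i \<in> I" for i using assms(1) that by (rule bij_betw_apply)
  have eq: "\<beta> i = \<beta> j \<longleftrightarrow> i = j" if "i \<in> I" "j \<in> I" for i j
    using assms(1) that by (auto simp: bij_betw_def inj_on_eq_iff)
  show ?thesis
    unfolding unitary_matrix_def split
  proof (intro ballI)
    fix i j assume ij: "i \<in> I" "j \<in> I"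
    have "(\<Sum>k\<in>J. f (\<beta> i, k) * (f (\<beta> j, k))\<^sup>\<dagger>) \<approx> (if \<beta> i = \<beta> j then 1 else 0) \<and>
        (\<Sum>k\<in>J. (f (k, \<beta> i))\<^sup>\<dagger> * f (k, \<beta> j)) \<approx> (if \<beta> i = \<beta> j then 1 else 0)"
      using assms(2) mem[OF ij(1)] mem[OF ij(2)] unfolding unitary_matrix_def by blast
    then show "(\<Sum>k\<in>I. f (\<beta> i, \<beta> k) * (f (\<beta> j, \<beta> k))\<^sup>\<dagger>) \<approx> (if i = j then 1 else 0) \<and>
        (\<Sum>k\<in>I. (f (\<beta> k, \<beta> i))\<^sup>\<dagger> * f (\<beta> k, \<beta> j)) \<approx> (if i = j then 1 else 0)"
      unfolding eq[OF ij] sum[of "\<lambda>k. f (\<beta> i, k) * (f (\<beta> j, k))\<^sup>\<dagger>"]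
        sum[of "\<lambda>k. (f (k, \<beta> i))\<^sup>\<dagger> * f (k, \<beta> j)"] .
  qed
qed

lemma magic_unitary_reindex:
  assumes "bij_betw \<beta> I J" "magic_unitary J f"
  shows "magic_unitary I (\<lambda>(i, j). f (\<beta> i, \<beta> j))"
  using assms unitary_matrix_reindex[of \<beta> I J f] unfolding magic_unitary_def
  by (simp add: bij_betw_apply)

end

lemma bar_Jpq: "z \<in> Jpq p q \<Longrightarrow> bar z \<in> Jpq p q"
  by (auto simp: Jpq_def)

lemma bar_bar: "z \<in> Jpq p q \<Longrightarrow> bar (bar z) = z"
  by (auto simp: Jpq_def)

lemma bij_betw_bar: "bij_betw bar (Jpq p q) (Jpq p q)"
  by (rule bij_betw_byWitness[where f' = bar]) (auto simp: bar_bar bar_Jpq)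

lemma finite_Jpq [simp]: "finite (Jpq p q)"
  by (simp add: Jpq_def)

lemma card_Jpq: "card (Jpq p q) = 2 * p + q"
  by (simp add: Jpq_def card_Plus card_cartesian_product)

context cstar_seminormed_algebra
begin

text \<open>The columns of \<open>u\<^sup>\<dagger> * u\<close> sum to \<open>1\<close> since \<open>u\<close> is unitary; the rows do after the bar relation has exchanged
  \<open>u\<^sup>\<dagger> * u\<close> for \<open>u * u\<^sup>\<dagger>\<close> at the barred indices. Orthogonality makes the off-diagonal unitarity
  relations hold.\<close>

lemma Ah_matrix_magic_unitary:
  assumes u: "Ah_matrix p q u"
  shows "magic_unitary (Jpq p q) (\<lambda>(z, y). (u (z, y))\<^sup>\<dagger> * u (z, y))"
proof -
  let ?J = "Jpq p q"
  define P where "P z y = (u (z, y))\<^sup>\<dagger> * u (z, y)" for z y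
  have herm: "(P z y)\<^sup>\<dagger> = P z y" for z y by (simp add: P_def)
  have idem: "P z y * P z y \<approx> P z y" if "z \<in> ?J" "y \<in> ?J" for z y
  proof -
    have "(u (z, y))\<^sup>\<dagger> * (u (z, y) * (u (z, y))\<^sup>\<dagger> * u (z, y)) \<approx> (u (z, y))\<^sup>\<dagger> * u (z, y)"
      using u that by (intro null_eq_mult) (auto simp: Ah_matrix_def)
    then show ?thesis by (simp add: P_def mult.assoc)
  qed
  have col: "(\<Sum>z\<in>?J. P z y) \<approx> 1" if y: "y \<in> ?J" for y
  proof -
    have "(\<Sum>z\<in>?J. (u (z, y))\<^sup>\<dagger> * u (z, y)) \<approx> (if y = y then 1 else 0)"
      using u y unfolding Ah_matrix_def unitary_matrix_def by blast
    then show ?thesis by (simp add: P_def)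
  qed
  have row: "(\<Sum>y\<in>?J. P z y) \<approx> 1" if z: "z \<in> ?J" for z
  proof -
    let ?v = "\<lambda>y. u (bar z, y) * (u (bar z, y))\<^sup>\<dagger>"
    have "P z y \<approx> ?v (bar y)" if y: "y \<in> ?J" for y
    proof -
      have *: "u (z, y) \<approx> (u (bar z, bar y))\<^sup>\<dagger>" using u z y by (simp add: Ah_matrix_def)
      from null_eq_mult[OF null_eq_adj[OF *] *] show ?thesis by (simp add: P_def)
    qed
    then have "(\<Sum>y\<in>?J. P z y) \<approx> (\<Sum>y\<in>?J. ?v (bar y))" by (rule null_eq_sum)
    also have "(\<Sum>y\<in>?J. ?v (bar y)) = (\<Sum>y\<in>?J. ?v y)"
      by (rule sum.reindex_bij_betw[OF bij_betw_bar])
    also have "(\<Sum>y\<in>?J. ?v y) \<approx> (if bar z = bar z then 1 else 0)"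
      using u bar_Jpq[OF z] unfolding Ah_matrix_def unitary_matrix_def by blast
    finally show ?thesis by simp
  qed
  have rows: "(\<Sum>k\<in>?J. P i k * (P j k)\<^sup>\<dagger>) \<approx> (if i = j then 1 else 0)" if ij: "i \<in> ?J" "j \<in> ?J" for i j
  proof (cases "i = j")
    case True
    have "(\<Sum>k\<in>?J. P i k * (P i k)\<^sup>\<dagger>) \<approx> (\<Sum>k\<in>?J. P i k)"
      unfolding herm using ij idem by (intro null_eq_sum) auto
    from null_eq_trans[OF this row[OF ij(1)]] show ?thesis using True by simp
  next
    case False
    have "P i k * P j k \<approx> 0" if "k \<in> ?J" for k
      by (rule projections_orthogonal[of ?J "\<lambda>z. P z k"]) (use that herm idem col ij False in auto)
    then have "(\<Sum>k\<in>?J. P i k * (P j k)\<^sup>\<dagger>) \<approx> (\<Sum>k\<in>?J. 0)"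
      unfolding herm by (rule null_eq_sum)
    then show ?thesis using False by simp
  qed
  have cols: "(\<Sum>k\<in>?J. (P k i)\<^sup>\<dagger> * P k j) \<approx> (if i = j then 1 else 0)" if ij: "i \<in> ?J" "j \<in> ?J" for i j
  proof (cases "i = j")
    case True
    have "(\<Sum>k\<in>?J. (P k i)\<^sup>\<dagger> * P k i) \<approx> (\<Sum>k\<in>?J. P k i)"
      unfolding herm using ij idem by (intro null_eq_sum) auto
    from null_eq_trans[OF this col[OF ij(1)]] show ?thesis using True by simp
  next
    case False
    have "P k i * P k j \<approx> 0" if "k \<in> ?J" for k
      by (rule projections_orthogonal[of ?J "\<lambda>y. P k y"]) (use that herm idem row ij False in auto)
    then have "(\<Sum>k\<in>?J. (P k i)\<^sup>\<dagger> * P k j) \<approx> (\<Sum>k\<in>?J. 0)"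
      unfolding herm by (rule null_eq_sum)
    then show ?thesis using False by simp
  qed
  have "magic_unitary ?J (\<lambda>(z, y). P z y)"
    unfolding magic_unitary_def unitary_matrix_def using rows cols herm idem by simp
  then show ?thesis by (simp add: P_def)
qed

lemma mat_null_eqI:
  assumes "m11 A \<approx> m11 B" "m12 A \<approx> m12 B" "m21 A \<approx> m21 B" "m22 A \<approx> m22 B"
  shows "cstar_seminormed_algebra.null_eq op_norm A B"
proof -
  interpret M: cstar_seminormed_algebra mat_scl mat_adj op_norm
    by (rule cstar_seminormed_algebra_mat2)
  show ?thesis
    unfolding M.null_eq_def
    by (rule op_norm_eq_zero) (use assms in \<open>simp_all add: mat2_simps null_eq_def\<close>)
qed

text \<open>This is the matrix of the \<open>w * g (z, y)\<close>, with \<open>w\<close> the flip of the two coordinates. A product of an entry with the adjoint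
  of another is diagonal, with \<open>g\<close> in one place and the barred \<open>g\<close> in the other. So the relations reduce to those of the
  two magic unitaries; the adjoint exchanges the two places, which is the bar relation.\<close>

lemma magic_unitary_Ah_matrix:
  assumes g: "magic_unitary (Jpq p q) g"
  shows "cstar_seminormed_algebra.Ah_matrix mat_adj op_norm p q
    (\<lambda>(z, y). Mat2 0 (g (bar z, bar y)) (g (z, y)) 0)"
proof -
  interpret M: cstar_seminormed_algebra mat_scl mat_adj op_norm
    by (rule cstar_seminormed_algebra_mat2)
  let ?J = "Jpq p q"
  let ?h = "\<lambda>(z, y). Mat2 0 (g (bar z, bar y)) (g (z, y)) 0"
  have delta: "(if b then 1 else 0) = Mat2 (if b then 1 else 0) 0 0 (if b then 1 else 0)" for b
    by (simp add: mat2_simps)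
  have bar_eq: "bar i = bar j \<longleftrightarrow> i = j" if "i \<in> ?J" "j \<in> ?J" for i j
    using that bar_bar by metis
  have g_adj: "(g (z, y))\<^sup>\<dagger> \<approx> g (z, y)" and g_idem: "g (z, y) * g (z, y) \<approx> g (z, y)"
    if "z \<in> ?J" "y \<in> ?J" for z y using g that by (simp_all add: magic_unitary_def)
  have g_pi: "g (z, y) * (g (z, y))\<^sup>\<dagger> * g (z, y) \<approx> g (z, y)" if zy: "z \<in> ?J" "y \<in> ?J" for z y
  proof -
    have "g (z, y) * (g (z, y))\<^sup>\<dagger> * g (z, y) \<approx> g (z, y) * g (z, y) * g (z, y)"
      using g_adj[OF zy] by (intro null_eq_mult) auto
    also have "\<dots> \<approx> g (z, y) * g (z, y)" using g_idem[OF zy] by (intro null_eq_mult) auto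
    also have "\<dots> \<approx> g (z, y)" by (rule g_idem[OF zy])
    finally show ?thesis .
  qed
  have uni: "unitary_matrix ?J g" using g by (simp add: magic_unitary_def)
  have uni_bar: "unitary_matrix ?J (\<lambda>(z, y). g (bar z, bar y))"
    by (rule unitary_matrix_reindex[OF bij_betw_bar uni])
  have "M.unitary_matrix ?J ?h"
    unfolding M.unitary_matrix_def
  proof (intro ballI conjI)
    fix i j assume ij: "i \<in> ?J" "j \<in> ?J"
    show "M.null_eq (\<Sum>k\<in>?J. ?h (i, k) * mat_adj (?h (j, k))) (if i = j then 1 else 0)"
      unfolding delta by (rule mat_null_eqI)
        (use uni uni_bar ij in \<open>simp_all add: mat2_sum mat_adj_def times_mat2_def unitary_matrix_def\<close>)
    show "M.null_eq (\<Sum>k\<in>?J. mat_adj (?h (k, i)) * ?h (k, j)) (if i = j then 1 else 0)"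
      unfolding delta by (rule mat_null_eqI)
        (use uni uni_bar ij in \<open>simp_all add: mat2_sum mat_adj_def times_mat2_def unitary_matrix_def\<close>)
  qed
  moreover have "M.null_eq (?h (z, y) * mat_adj (?h (z, y)) * ?h (z, y)) (?h (z, y))"
    if "z \<in> ?J" "y \<in> ?J" for z y
    by (rule mat_null_eqI) (use g_pi that bar_Jpq in \<open>simp_all add: mat_adj_def times_mat2_def\<close>)
  moreover have "M.null_eq (?h (z, y)) (mat_adj (?h (bar z, bar y)))" if "z \<in> ?J" "y \<in> ?J" for z y
    by (rule mat_null_eqI)
      (use g_adj that bar_Jpq bar_bar in \<open>simp_all add: mat_adj_def null_eq_sym\<close>)
  ultimately show ?thesis unfolding M.Ah_matrix_def by blast
qed

end

abbreviation magic_rels :: "'i set \<Rightarrow> ('i \<times> 'i) ncpoly set" where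
  "magic_rels I \<equiv> unitary_rels I gen_matrix \<union> projection_rels I gen_matrix"

lemma unitary_rels_subset: "unitary_rels I gen_matrix \<subseteq> free_star_alg (I \<times> I)"
  unfolding unitary_rels_def
  by (auto intro!: free_star_alg_diff free_star_alg_sum)

lemma magic_rels_subset: "magic_rels I \<subseteq> free_star_alg (I \<times> I)"
  using unitary_rels_subset[of "I"] by (auto simp: projection_rels_def)

lemma Ah_rels_subset: "Ah_rels p q \<subseteq> free_star_alg (Jpq p q \<times> Jpq p q)"
  using unitary_rels_subset[of "Jpq p q"] by (auto simp: Ah_rels_def partial_isometry_rels_def bar_Jpq)

text \<open>The generators satisfy the relations up to null elements of any admissible seminorm.\<close>

lemma magic_unitary_gen:
  assumes "cstar_seminorm (I \<times> I) (magic_rels I) s"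
  shows "cstar_seminormed_algebra.magic_unitary poly_star (\<lambda>x. s (restrict_gens (I \<times> I) x)) I gen"
proof -
  interpret cstar_seminormed_algebra poly_scale poly_star "\<lambda>x. s (restrict_gens (I \<times> I) x)"
    by (rule cstar_seminorm_extend[OF assms])
  show ?thesis
    unfolding magic_rels_iff[symmetric] free_poly_eval_gen
    using assms magic_rels_subset[of I] by (auto simp: cstar_seminorm_def subset_eq)
qed

lemma Ah_matrix_gen:
  assumes "cstar_seminorm (Jpq p q \<times> Jpq p q) (Ah_rels p q) s"
  shows "cstar_seminormed_algebra.Ah_matrix poly_star (\<lambda>x. s (restrict_gens (Jpq p q \<times> Jpq p q) x)) p q gen"
proof -
  interpret cstar_seminormed_algebra poly_scale poly_star "\<lambda>x. s (restrict_gens (Jpq p q \<times> Jpq p q) x)"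
    by (rule cstar_seminorm_extend[OF assms])
  show ?thesis
    unfolding Ah_rels_iff[symmetric] free_poly_eval_gen
    using assms Ah_rels_subset[of p q] by (auto simp: cstar_seminorm_def subset_eq)
qed

lemma bounded_presentation_magic: "bounded_presentation (I \<times> I) (magic_rels I)"
proof
  fix g s assume g: "g \<in> I \<times> I" and s: "cstar_seminorm (I \<times> I) (magic_rels I) s"
  interpret cstar_seminormed_algebra poly_scale poly_star "\<lambda>x. s (restrict_gens (I \<times> I) x)"
    by (rule cstar_seminorm_extend[OF s])
  have *: "null_eq (poly_star (gen g)) (gen g)" "null_eq (gen g * gen g) (gen g)"
    using magic_unitary_gen[OF s] g unfolding magic_unitary_def by blast+
  have "null_eq (gen g * poly_star (gen g) * gen g) (gen g * gen g * gen g)"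
    using * by (intro null_eq_mult) auto
  also have "null_eq (gen g * gen g * gen g) (gen g * gen g)" using * by (intro null_eq_mult) auto
  also have "null_eq (gen g * gen g) (gen g)" by (rule *)
  finally have "null_eq (gen g * poly_star (gen g) * gen g) (gen g)" .
  from norm_partial_isometry_le[OF this] show "s (gen g) \<le> 1" using g by simp
qed

lemma bounded_presentation_Ah: "bounded_presentation (Jpq p q \<times> Jpq p q) (Ah_rels p q)"
proof
  fix g s assume g: "g \<in> Jpq p q \<times> Jpq p q" and s: "cstar_seminorm (Jpq p q \<times> Jpq p q) (Ah_rels p q) s"
  interpret cstar_seminormed_algebra poly_scale poly_star "\<lambda>x. s (restrict_gens (Jpq p q \<times> Jpq p q) x)"
    by (rule cstar_seminorm_extend[OF s])
  have "null_eq (gen g * poly_star (gen g) * gen g) (gen g)"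
    using Ah_matrix_gen[OF s] g by (auto simp: Ah_matrix_def)
  from norm_partial_isometry_le[OF this] show "s (gen g) \<le> 1" using g by simp
qed

section \<open>The algebra generated by the projections\<close>

definition proj_poly :: "jindex \<Rightarrow> jindex \<Rightarrow> (jindex \<times> jindex) ncpoly" where
  "proj_poly z y = poly_star (gen (z, y)) * gen (z, y)"

lemma Ah_proj_eq:
  assumes "z \<in> Jpq p q" "y \<in> Jpq p q"
  shows "Ah_proj p q z y = univ_class (Jpq p q \<times> Jpq p q) (Ah_rels p q) (\<lambda>_. proj_poly z y)"
proof -
  interpret E: bounded_presentation "Jpq p q \<times> Jpq p q" "Ah_rels p q" by (rule bounded_presentation_Ah)
  show ?thesis
    using assms by (simp add: Ah_proj_def Ah_def Ah_gen_def univ_gen_def proj_poly_def E.A_star E.A_mult)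
qed

lemma Ah_proj_is_projection:
  assumes zy: "z \<in> Jpq p q" "y \<in> Jpq p q"
  shows "is_projection (Ah p q) (Ah_proj p q z y)"
proof -
  interpret E: bounded_presentation "Jpq p q \<times> Jpq p q" "Ah_rels p q" by (rule bounded_presentation_Ah)
  let ?P = "proj_poly z y"
  have P: "(\<lambda>_. ?P) \<in> E.cauchy_seqs" using zy by (simp add: proj_poly_def)
  have "E.U.magic_unitary (Jpq p q) (\<lambda>(z, y). poly_star (gen (z, y)) * gen (z, y))"
    by (rule E.U.Ah_matrix_magic_unitary[OF Ah_matrix_gen[OF E.cstar_seminorm_univ_norm]])
  then have "E.U.null_eq (?P * ?P) ?P"
    using zy by (simp add: E.U.magic_unitary_def proj_poly_def)
  then have "E.N (?P * ?P - ?P) = 0"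
    using zy by (simp add: E.U.null_eq_def proj_poly_def)
  then have "E.cl (\<lambda>_. ?P * ?P) = E.cl (\<lambda>_. ?P)"
    using zy by (subst E.cl_eq_iff) (simp_all add: proj_poly_def)
  then show ?thesis
    unfolding is_projection_def Ah_proj_eq[OF zy] Ah_def
    using P by (simp add: E.A_closed E.A_star E.A_mult) (simp add: proj_poly_def)
qed

text \<open>\<open>\<beta>\<close> identifies the indices of \<open>A\<^sub>s\<close> with those of \<open>A\<^sub>h\<close>, and \<open>\<gamma>\<close> below is its inverse.\<close>

locale index_bijection =
  fixes p q :: nat and I :: "'i set" and \<beta> :: "'i \<Rightarrow> jindex"
  assumes bij: "bij_betw \<beta> I (Jpq p q)" and nonempty: "p \<noteq> 0 \<or> q \<noteq> 0"
begin

abbreviation "J \<equiv> Jpq p q"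

definition proj_entry :: "'i \<times> 'i \<Rightarrow> (jindex \<times> jindex) ncpoly" where
  "proj_entry = (\<lambda>(i, j). proj_poly (\<beta> i) (\<beta> j))"

definition \<gamma> :: "jindex \<Rightarrow> 'i" where "\<gamma> = inv_into I \<beta>"

sublocale D: bounded_presentation "I \<times> I" "magic_rels I" by (rule bounded_presentation_magic)
sublocale E: bounded_presentation "J \<times> J" "Ah_rels p q" by (rule bounded_presentation_Ah)

lemma beta_in: "i \<in> I \<Longrightarrow> \<beta> i \<in> J"
  using bij by (rule bij_betw_apply)

lemma gamma_bij: "bij_betw \<gamma> J I"
  unfolding \<gamma>_def by (rule bij_betw_inv_into[OF bij])

lemma gamma_beta: "i \<in> I \<Longrightarrow> \<gamma> (\<beta> i) = i"
  unfolding \<gamma>_def using bij by (rule bij_betw_inv_into_left)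

lemma proj_entry_closed: "g \<in> I \<times> I \<Longrightarrow> proj_entry g \<in> E.F"
  using beta_in by (auto simp: proj_entry_def proj_poly_def)

abbreviation "\<phi> \<equiv> free.poly_eval proj_entry"

lemma phi_closed: "x \<in> D.F \<Longrightarrow> \<phi> x \<in> E.F"
  by (rule free_poly_eval_closed[of x "I \<times> I" proj_entry "J \<times> J", OF _ proj_entry_closed])

text \<open>The universal property: every seminorm that is admissible for \<open>A\<^sub>h\<close> pulls back to one that is
  admissible for \<open>A\<^sub>s\<close>, because the \<open>u\<^sup>\<dagger> * u\<close> form a magic unitary.\<close>

lemma contractive: assumes x: "x \<in> D.F" shows "E.N (\<phi> x) \<le> D.N x"
proof (rule E.univ_norm_least)
  fix s assume s: "cstar_seminorm (J \<times> J) (Ah_rels p q) s"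
  interpret T: cstar_seminormed_algebra poly_scale poly_star "\<lambda>x. s (restrict_gens (J \<times> J) x)"
    by (rule cstar_seminorm_extend[OF s])
  have "T.magic_unitary I (\<lambda>(i, j). (\<lambda>(z, y). poly_star (gen (z, y)) * gen (z, y)) (\<beta> i, \<beta> j))"
    by (rule T.magic_unitary_reindex[OF bij T.Ah_matrix_magic_unitary[OF Ah_matrix_gen[OF s]]])
  then have "T.magic_unitary I proj_entry" by (simp add: proj_entry_def proj_poly_def)
  then have "\<forall>r\<in>magic_rels I. s (restrict_gens (J \<times> J) (\<phi> r)) = 0"
    by (simp only: T.magic_rels_iff)
  then have "cstar_seminorm (I \<times> I) (magic_rels I) (\<lambda>x. s (restrict_gens (J \<times> J) (\<phi> x)))"
    by (intro T.cstar_seminorm_pullback) blast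
  from D.univ_norm_upper[OF x this] show "s (\<phi> x) \<le> D.N x"
    using phi_closed[OF x] by simp
qed

definition flip_matrix :: "jindex \<times> jindex \<Rightarrow> ('i \<times> 'i) ncpoly mat2" where
  "flip_matrix = (\<lambda>(z, y). Mat2 0 (gen (\<gamma> (bar z), \<gamma> (bar y))) (gen (\<gamma> z, \<gamma> y)) 0)"

text \<open>The substitution that induces the bar automorphism of \<open>A\<^sub>s\<close>.\<close>

definition \<sigma> :: "('i \<times> 'i) ncpoly \<Rightarrow> ('i \<times> 'i) ncpoly" where
  "\<sigma> = free.poly_eval (\<lambda>(i, j). gen (\<gamma> (bar (\<beta> i)), \<gamma> (bar (\<beta> j))))"

sublocale M: cstar_seminormed_algebra free.mat_scl free.mat_adj D.U.op_norm
  by (rule D.U.cstar_seminormed_algebra_mat2)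

abbreviation "\<psi> \<equiv> M.poly_eval flip_matrix"

lemma magic_gamma: "D.U.magic_unitary J (\<lambda>(z, y). gen (\<gamma> z, \<gamma> y))"
  by (rule D.U.magic_unitary_reindex[OF gamma_bij magic_unitary_gen[OF D.cstar_seminorm_univ_norm]])

lemma gamma_star_mult:
  assumes "z \<in> J" "y \<in> J"
  shows "D.U.null_eq (poly_star (gen (\<gamma> z, \<gamma> y)) * gen (\<gamma> z, \<gamma> y)) (gen (\<gamma> z, \<gamma> y))"
proof -
  let ?g = "gen (\<gamma> z, \<gamma> y)"
  have *: "D.U.null_eq (poly_star ?g) ?g" "D.U.null_eq (?g * ?g) ?g"
    using magic_gamma assms by (simp_all add: D.U.magic_unitary_def)
  from D.U.null_eq_trans[OF D.U.null_eq_mult[OF *(1) D.U.null_eq_refl[of ?g]] *(2)] show ?thesis .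
qed

lemma psi_seminorm: "cstar_seminorm (J \<times> J) (Ah_rels p q) (\<lambda>x. D.U.op_norm (\<psi> x))"
proof (rule M.cstar_seminorm_pullback)
  fix r assume r: "r \<in> Ah_rels p q"
  have "M.Ah_matrix p q flip_matrix"
    using D.U.magic_unitary_Ah_matrix[OF magic_gamma] by (simp add: flip_matrix_def)
  then show "D.U.op_norm (\<psi> r) = 0" using r M.Ah_rels_iff by blast
qed

lemma psi_phi_gen:
  assumes ij: "i \<in> I" "j \<in> I"
  shows "M.null_eq (\<psi> (\<phi> (gen (i, j)))) (Mat2 (gen (i, j)) 0 0 (\<sigma> (gen (i, j))))"
proof -
  have b: "\<beta> i \<in> J" "\<beta> j \<in> J" "bar (\<beta> i) \<in> J" "bar (\<beta> j) \<in> J" using ij by (auto intro: beta_in bar_Jpq)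
  have "\<psi> (\<phi> (gen (i, j))) = free.mat_adj (flip_matrix (\<beta> i, \<beta> j)) * flip_matrix (\<beta> i, \<beta> j)"
    by (simp add: proj_entry_def proj_poly_def M.poly_eval_mult M.poly_eval_star)
  then show ?thesis
    using gamma_star_mult[OF b(1,2)] gamma_star_mult[OF b(3,4)]
    by (intro D.U.mat_null_eqI) (simp_all add: flip_matrix_def \<sigma>_def free.mat_adj_def times_mat2_def
        gamma_beta[OF ij(1)] gamma_beta[OF ij(2)])
qed

text \<open>Both sides are *-homomorphisms in \<open>x\<close> and agree on the generators up to null elements.\<close>

lemma psi_phi:
  assumes "x \<in> D.F" shows "M.null_eq (\<psi> (\<phi> x)) (Mat2 x 0 0 (\<sigma> x))"
  using assms
proof (induction x rule: free_star_alg_induct)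
  case (scalar c)
  have "\<psi> (\<phi> (poly_scale c 1)) = Mat2 (poly_scale c 1) 0 0 (\<sigma> (poly_scale c 1))"
    by (simp add: \<sigma>_def free.poly_eval_scale M.poly_eval_scale free.mat_scl_def one_mat2_def)
  then show ?case by simp
next
  case (gen g)
  then show ?case using psi_phi_gen by auto
next
  case (star_gen g)
  then have "M.null_eq (\<psi> (\<phi> (gen g))) (Mat2 (gen g) 0 0 (\<sigma> (gen g)))" using psi_phi_gen by auto
  from M.null_eq_adj[OF this] show ?case
    by (simp add: free.poly_eval_star M.poly_eval_star \<sigma>_def) (simp add: free.mat_adj_def)
next
  case (add x y)
  from M.null_eq_add[OF add(3,4)] show ?case
    by (simp add: free.poly_eval_add M.poly_eval_add \<sigma>_def plus_mat2_def)
next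
  case (mult x y)
  from M.null_eq_mult[OF mult(3,4)] show ?case
    by (simp add: free.poly_eval_mult M.poly_eval_mult \<sigma>_def times_mat2_def)
qed

text \<open>The seminorm in \<open>psi_seminorm\<close> competes in the universal seminorm of \<open>A\<^sub>h\<close>, and at \<open>\<phi> x\<close> it is at least
  the universal seminorm of \<open>x\<close> because \<open>x\<close> is a corner of \<open>\<psi> (\<phi> x)\<close>.\<close>

lemma expansive: assumes x: "x \<in> D.F" shows "D.N x \<le> E.N (\<phi> x)"
proof -
  have "D.N x \<le> D.U.op_norm (Mat2 x 0 0 (\<sigma> x))"
    using D.U.norm_m11_le_op_norm[of "Mat2 x 0 0 (\<sigma> x)"] x by simp
  also have "\<dots> = D.U.op_norm (\<psi> (\<phi> x))" using M.null_eq_norm[OF psi_phi[OF x]] by simp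
  also have "\<dots> \<le> E.N (\<phi> x)" by (rule E.univ_norm_upper[OF phi_closed[OF x] psi_seminorm])
  finally show ?thesis .
qed

lemma J_nonempty: "J \<noteq> {}"
  using card_Jpq[of p q] nonempty by auto

text \<open>The projections in one column sum to the unit. There is a column because the index set is not empty.\<close>

lemma unit_generated:
  assumes B: "is_cstar_subalgebra E.A B" and gens: "\<And>g. g \<in> I \<times> I \<Longrightarrow> E.cl (\<lambda>_. proj_entry g) \<in> B"
  shows "\<one>\<^bsub>E.A\<^esub> \<in> B"
proof -
  have P: "E.cl (\<lambda>_. proj_poly z y) \<in> B" if "z \<in> J" "y \<in> J" for z y
  proof -
    have "\<beta> (\<gamma> z) = z" "\<beta> (\<gamma> y) = y" "\<gamma> z \<in> I" "\<gamma> y \<in> I"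
      using bij that bij_betw_apply[OF gamma_bij] by (simp_all add: \<gamma>_def bij_betw_inv_into_right)
    then show ?thesis using gens[of "(\<gamma> z, \<gamma> y)"] by (simp add: proj_entry_def)
  qed
  have P_in: "proj_poly z y \<in> E.F" if "z \<in> J" "y \<in> J" for z y
    using that by (simp add: proj_poly_def)
  obtain y where y: "y \<in> J" using J_nonempty by blast
  have sum: "E.cl (\<lambda>_. \<Sum>z\<in>K. proj_poly z y) \<in> B \<and> (\<Sum>z\<in>K. proj_poly z y) \<in> E.F"
    if "finite K" "K \<subseteq> J" for K
    using that
  proof (induction K)
    case empty
    show ?case using B by (simp add: is_cstar_subalgebra_def flip: E.A_zero)
  next
    case (insert z K)
    then have z: "z \<in> J" and IH: "E.cl (\<lambda>_. \<Sum>z\<in>K. proj_poly z y) \<in> B" "(\<Sum>z\<in>K. proj_poly z y) \<in> E.F"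
      by auto
    have "E.cl (\<lambda>_. proj_poly z y) \<oplus>\<^bsub>E.A\<^esub> E.cl (\<lambda>_. \<Sum>z\<in>K. proj_poly z y) \<in> B"
      using B P[OF z y] IH(1) unfolding is_cstar_subalgebra_def by blast
    then show ?case using insert(1,2) P_in[OF z y] IH(2) by (simp add: E.A_add)
  qed
  have "E.U.Ah_matrix p q gen" by (rule Ah_matrix_gen[OF E.cstar_seminorm_univ_norm])
  then have "E.U.null_eq (\<Sum>z\<in>J. poly_star (gen (z, y)) * gen (z, y)) (if y = y then 1 else 0)"
    using y unfolding E.U.Ah_matrix_def E.U.unitary_matrix_def by blast
  then have "E.N ((\<Sum>z\<in>J. proj_poly z y) - 1) = 0"
    using sum[of J] by (simp add: E.U.null_eq_def proj_poly_def)
  then have "E.cl (\<lambda>_. \<Sum>z\<in>J. proj_poly z y) = E.cl (\<lambda>_. 1)"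
    using sum[of J] by (subst E.cl_eq_iff) simp_all
  then show ?thesis using sum[of J] by (simp add: E.A_one)
qed

sublocale embedding: isometric_embedding "I \<times> I" "magic_rels I" "J \<times> J" "Ah_rels p q" proj_entry
  by unfold_locales (use proj_entry_closed contractive expansive unit_generated in \<open>auto intro: antisym\<close>)

lemma proj_set_eq:
  "{Ah_proj p q z y | z y. z \<in> J \<and> y \<in> J} = (\<lambda>g. E.cl (\<lambda>_. proj_entry g)) ` (I \<times> I)"
proof -
  have "(\<lambda>g. E.cl (\<lambda>_. proj_entry g)) ` (I \<times> I) = (\<lambda>(z, y). E.cl (\<lambda>_. proj_poly z y)) ` (\<beta> ` I \<times> \<beta> ` I)"
    by (fastforce simp: proj_entry_def image_iff)
  also have "\<dots> = (\<lambda>(z, y). E.cl (\<lambda>_. proj_poly z y)) ` (J \<times> J)"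
    using bij by (simp add: bij_betw_def)
  also have "\<dots> = (\<lambda>(z, y). Ah_proj p q z y) ` (J \<times> J)"
    by (intro image_cong) (auto simp: Ah_proj_eq)
  also have "\<dots> = {Ah_proj p q z y | z y. z \<in> J \<and> y \<in> J}" by auto
  finally show ?thesis by simp
qed

end

theorem theorem5p9:
  fixes p q :: nat
  assumes "p \<noteq> 0 \<or> q \<noteq> 0"
  shows "(\<forall>z\<in>Jpq p q. \<forall>y\<in>Jpq p q. is_projection (Ah p q) (Ah_proj p q z y)) \<and>
    cstar_isomorphic
      (generated_cstar (Ah p q) {Ah_proj p q z y | z y. z \<in> Jpq p q \<and> y \<in> Jpq p q})
      (As (2 * p + q))"
proof -
  obtain \<beta> where "bij_betw \<beta> {1..2 * p + q} (Jpq p q)"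
    using ex_bij_betw_nat_finite_1[OF finite_Jpq[of p q]] by (auto simp: card_Jpq)
  with assms interpret index_bijection p q "{1..2 * p + q}" \<beta> by unfold_locales
  have "cstar_isomorphic
      (generated_cstar (Ah p q) {Ah_proj p q z y | z y. z \<in> Jpq p q \<and> y \<in> Jpq p q})
      (As (2 * p + q))"
    unfolding proj_set_eq unfolding Ah_def As_def by (rule embedding.generated_cstar_isomorphic)
  then show ?thesis using Ah_proj_is_projection by blast
qed

end
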